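(* Let $\Omega\subset\mathbb{R}^n$ be a bounded domain with $0\in\partial\Omega$, let $0<\alpha<1$, and let $u$ be a viscosity solution of $$\Delta u=f\ \text{ in }\Omega\cap B_1,\qquad u=g\ \text{ on }\partial\Omega\cap B_1.$$ Suppose that for some integers $k,l\ge 1$, $u\in C^{k,\alpha}(0)$, $f\in C^{k+l-2,\alpha}(0)$, $g\in C^{k+l,\alpha}(0)$ and $\partial\Omega\in C^{l,\alpha}(0)$. Moreover, assume that $$u(0)=\cdots=|D^ku(0)|=|Dg(0)|=\cdots=|D^kg(0)|=0 .$$ Then $u\in C^{k+l,\alpha}(0)$. That is, there exists $P\in\mathcal{P}_{k+l}$ such that $$|u(x)-P(x)|\le C|x|^{k+l+\alpha}\left(\|u\|_{L^\infty(\Omega_1)}+\|f\|_{C^{k+l-2,\alpha}(0)}+\|g\|_{C^{k+l,\alpha}(0)}\right),\quad\forall x\in\Omega\cap B_1,$$ $$|D^{k+1}u(0)|+\cdots+|D^{k+l}u(0)|\le C\left(\|u\|_{L^\infty(\Omega_1)}+\|f\|_{C^{k+l-2,\alpha}(0)}+\|g\|_{C^{k+l,\alpha}(0)}\right)$$ and $$\Delta P\equiv P_f,\qquad \mathbf{\Pi}_{k+l}\big(P(x',P_\Omega(x'))\big)\equiv\mathbf{\Pi}_{k+l}\big(P_g(x',P_\Omega(x'))\big),$$ where $C$ depends only on $n,k,l,\alpha$ and $\|\partial\Omega\cap B_1\|_{C^{l,\alpha}(0)}$.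
   Context: Notation: $x=(x',x_n)\in\mathbb{R}^n$, $x'=(x_1,\dots,x_{n-1})$; $B_r$ is the open ball of radius $r$ centred at $0$; $\Omega_1=\Omega\cap B_1$. $\mathcal{P}_k$ is the set of polynomials of degree $\le k$; writing $P(x)=\sum_{|\sigma|\le k}\frac{a_\sigma}{\sigma!}x^\sigma$, set $\|P\|=\sum_{|\sigma|\le k}|a_\sigma|$. $\mathbf{\Pi}_k$ is the truncation of a polynomial to its terms of degree $\le k$. Viscosity solutions are understood in the standard sense. Pointwise regularity of functions at $0$: let $k\ge0$ be an integer, $0<\alpha\le1$, and let $h$ be a function on a set $D$ ($D=\Omega\cap B_1$ for $u,f$; $D=\partial\Omega\cap B_1$ for $g$). Then $h\in C^{k,\alpha}(0)$ means that there are $K>0$ and a polynomial $P\in\mathcal{P}_k$ with $|h(x)-P(x)|\le K|x|^{k+\alpha}$ for all $x\in D\cap B_1$. The (fixed) polynomial is denoted $P_h$; one sets $h(0)=P_h(0)$, $D^ih(0)=D^iP_h(0)$ for $1\le i\le k$, $[h]_{C^{k,\alpha}(0)}$ = the minimal such $K$, and $\|h\|_{C^{k,\alpha}(0)}=\|P_h\|+[h]_{C^{k,\alpha}(0)}$. Pointwise regularity of the boundary at $0$: $\partial\Omega\in C^{l,\alpha}(0)$ (equivalently $\partial\Omega\cap B_1\in C^{l,\alpha}(0)$), $l\ge1$, means that there are $K>0$ and a polynomial $P_\Omega\in\mathcal{P}_l$ in $x'$ with $P_\Omega(0)=0$, $DP_\Omega(0)=0$ such that, in the given coordinates, $B_1\cap\{x_n>P_\Omega(x')+K|x'|^{l+\alpha}\}\subset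 B_1\cap\Omega$ and $B_1\cap\{x_n<P_\Omega(x')-K|x'|^{l+\alpha}\}\subset B_1\cap\Omega^c$. $[\partial\Omega\cap B_1]_{C^{l,\alpha}(0)}$ is the minimal such $K$, and $\|\partial\Omega\cap B_1\|_{C^{l,\alpha}(0)}=\|P_\Omega\|+[\partial\Omega\cap B_1]_{C^{l,\alpha}(0)}$. *)

theory Defs
  imports
    "HOL-Analysis.Analysis"
    "HOL-Library.Poly_Mapping"
    "HOL-Probability.Essential_Supremum"
begin

section \<open>Polynomials in the coordinates of \<open>\<real>\<^sup>n\<close>\<close>

text \<open>
  A polynomial is a finitely supported map from exponents to coefficients; the type carries the
  ring structure (convolution product) of \<open>HOL-Library.Poly_Mapping\<close>.
\<close>

type_synonym 'n mpoly = "('n \<Rightarrow>\<^sub>0 nat) \<Rightarrow>\<^sub>0 real"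

definition mdeg :: "('n::finite \<Rightarrow>\<^sub>0 nat) \<Rightarrow> nat" where
  "mdeg \<sigma> = (\<Sum>i\<in>UNIV. Poly_Mapping.lookup \<sigma> i)"

definition mfact :: "('n::finite \<Rightarrow>\<^sub>0 nat) \<Rightarrow> real" where
  "mfact \<sigma> = (\<Prod>i\<in>UNIV. fact (Poly_Mapping.lookup \<sigma> i))"

definition mon :: "('n::finite \<Rightarrow>\<^sub>0 nat) \<Rightarrow> real ^ 'n \<Rightarrow> real" where
  "mon \<sigma> x = (\<Prod>i\<in>UNIV. (x $ i) ^ Poly_Mapping.lookup \<sigma> i)"

definition peval :: "'n::finite mpoly \<Rightarrow> real ^ 'n \<Rightarrow> real" where
  "peval P x = (\<Sum>\<sigma>\<in>Poly_Mapping.keys P. Poly_Mapping.lookup P \<sigma> * mon \<sigma> x)"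

definition polys :: "nat \<Rightarrow> 'n::finite mpoly set" where
  "polys k = {P. \<forall>\<sigma>\<in>Poly_Mapping.keys P. mdeg \<sigma> \<le> k}"

text \<open>
  Writing \<open>P(x) = \<Sum> a\<^sub>\<sigma> / \<sigma>! x\<^sup>\<sigma>\<close>, this is \<open>a\<^sub>\<sigma>\<close>, which is the partial derivative
  \<open>D\<^sup>\<sigma> P(0)\<close>; \<^const>\<open>Poly_Mapping.lookup\<close> itself gives the coefficient \<open>a\<^sub>\<sigma> / \<sigma>!\<close>.
\<close>

definition taylor_coeff :: "'n::finite mpoly \<Rightarrow> ('n \<Rightarrow>\<^sub>0 nat) \<Rightarrow> real" where
  "taylor_coeff P \<sigma> = mfact \<sigma> * Poly_Mapping.lookup P \<sigma>"

definition poly_norm :: "'n::finite mpoly \<Rightarrow> real" where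
  "poly_norm P = (\<Sum>\<sigma>\<in>Poly_Mapping.keys P. \<bar>taylor_coeff P \<sigma>\<bar>)"

text \<open>
  \<open>|D\<^sup>i P(0)| = (\<Sum> |D\<^sup>\<sigma> P(0)|\<^sup>2)\<^sup>1\<^sup>/\<^sup>2\<close>, the sum over \<open>|\<sigma>| = i\<close>; exponents outside the support
  contribute nothing.
\<close>

definition deriv_norm0 :: "nat \<Rightarrow> 'n::finite mpoly \<Rightarrow> real" where
  "deriv_norm0 i P =
     sqrt (\<Sum>\<sigma> | \<sigma> \<in> Poly_Mapping.keys P \<and> mdeg \<sigma> = i. (taylor_coeff P \<sigma>)\<^sup>2)"

lift_definition poly_truncate :: "nat \<Rightarrow> 'n::finite mpoly \<Rightarrow> 'n mpoly"
  is "\<lambda>k a \<sigma>. if mdeg \<sigma> \<le> k then a \<sigma> else 0"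
  by (erule finite_subset[rotated]) auto

definition pconst :: "real \<Rightarrow> 'n mpoly" where
  "pconst c = Poly_Mapping.single 0 c"

definition pvar :: "'n \<Rightarrow> 'n mpoly" where
  "pvar i = Poly_Mapping.single (Poly_Mapping.single i 1) 1"

text \<open>The polynomial \<open>P(x', Q)\<close>, i.e. \<open>Q\<close> substituted for the variable of index \<open>N\<close> in \<open>P\<close>.\<close>

definition psubst :: "'n::finite \<Rightarrow> 'n mpoly \<Rightarrow> 'n mpoly \<Rightarrow> 'n mpoly" where
  "psubst N P Q = (\<Sum>\<sigma>\<in>Poly_Mapping.keys P. pconst (Poly_Mapping.lookup P \<sigma>) *
      (\<Prod>i\<in>UNIV. (if i = N then Q else pvar i) ^ Poly_Mapping.lookup \<sigma> i))"

lemma peval_superset: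
  assumes "finite S" "Poly_Mapping.keys P \<subseteq> S"
  shows "peval P x = (\<Sum>\<sigma>\<in>S. Poly_Mapping.lookup P \<sigma> * mon \<sigma> x)"
  unfolding peval_def
  by (rule sum.mono_neutral_left) (use assms in \<open>auto simp: in_keys_iff\<close>)

lemma peval_0 [simp]: "peval 0 x = 0" by (simp add: peval_def)

lemma peval_single: "peval (Poly_Mapping.single \<sigma> c) x = c * mon \<sigma> x"
  by (cases "c = 0") (simp_all add: peval_def mon_def)

lemma peval_add: "peval (P + Q) x = peval P x + peval Q x"
proof -
  let ?S = "Poly_Mapping.keys P \<union> Poly_Mapping.keys Q"
  have "Poly_Mapping.keys (P + Q) \<subseteq> ?S" by (rule Poly_Mapping.keys_add)
  then show ?thesis
    by (simp add: peval_superset[of ?S] lookup_add algebra_simps sum.distrib)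
qed

lemma peval_sum: "peval (sum F A) x = (\<Sum>a\<in>A. peval (F a) x)"
  by (induction A rule: infinite_finite_induct) (auto simp: peval_add)

lemma mon_add: "mon (s + t) x = mon s x * mon t x"
  by (simp add: mon_def lookup_add power_add prod.distrib)

lemma mpoly_expand:
  "(\<Sum>i\<in>Poly_Mapping.keys P. Poly_Mapping.single i (Poly_Mapping.lookup P i)) = (P :: 'n::finite mpoly)"
  by (rule poly_mapping_eqI) (auto simp: lookup_sum lookup_single when_def in_keys_iff)

lemma peval_mult: "peval (P * Q) x = peval P x * peval Q x"
proof -
  have "P * Q = (\<Sum>i\<in>Poly_Mapping.keys P. \<Sum>j\<in>Poly_Mapping.keys Q.
      Poly_Mapping.single (i+j) (Poly_Mapping.lookup P i * Poly_Mapping.lookup Q j))"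
    by (subst (1) mpoly_expand[of P, symmetric], subst (1) mpoly_expand[of Q, symmetric])
       (simp add: sum_product mult_single)
  then have "peval (P * Q) x = (\<Sum>i\<in>Poly_Mapping.keys P. \<Sum>j\<in>Poly_Mapping.keys Q.
      (Poly_Mapping.lookup P i * mon i x) * (Poly_Mapping.lookup Q j * mon j x))"
    by (simp add: peval_sum peval_single mon_add mult_ac)
  then show ?thesis
    unfolding peval_def[of P] peval_def[of Q] sum_product .
qed

lemma peval_1: "peval 1 x = 1"
  by (simp add: mon_def peval_single flip: single_one)

lemma peval_power: "peval (P ^ m) x = peval P x ^ m"
  by (induction m) (auto simp: peval_1 peval_mult)

lemma peval_prod: "peval (prod F A) x = (\<Prod>a\<in>A. peval (F a) x)"
  by (induction A rule: infinite_finite_induct) (auto simp: peval_mult peval_1)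

lemma peval_const: "peval (pconst c) x = c"
  by (simp add: pconst_def peval_single mon_def)

lemma peval_var: "peval (pvar i) x = x $ i"
proof -
  have "mon (Poly_Mapping.single i 1) x = (\<Prod>j\<in>UNIV. if j = i then x $ i else 1)"
    unfolding mon_def by (rule prod.cong) (auto simp: lookup_single when_def)
  then show ?thesis by (simp add: pvar_def peval_single)
qed

lemma peval_psubst:
  "peval (psubst N P Q) x = peval P (\<chi> i. if i = N then peval Q x else x $ i)"
proof -
  have "(if i = N then peval Q x else x $ i) = peval (if i = N then Q else pvar i) x" for i
    by (simp add: peval_var)
  then show ?thesis
    by (simp add: psubst_def peval_sum peval_mult peval_const peval_prod peval_power
        peval_def[of P] mon_def)
qed

lemma lookup_poly_truncate:
  "Poly_Mapping.lookup (poly_truncate k P) \<sigma> =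
     (if mdeg \<sigma> \<le> k then Poly_Mapping.lookup P \<sigma> else 0)"
  by (simp add: poly_truncate.rep_eq)


section \<open>Viscosity solutions of the Dirichlet problem for \<open>\<Delta>u = f\<close>\<close>

definition partial_deriv :: "'n::finite \<Rightarrow> (real ^ 'n \<Rightarrow> real) \<Rightarrow> real ^ 'n \<Rightarrow> real" where
  "partial_deriv i \<phi> x = deriv (\<lambda>t. \<phi> (x + t *\<^sub>R axis i 1)) 0"

definition laplacian :: "(real ^ 'n::finite \<Rightarrow> real) \<Rightarrow> real ^ 'n \<Rightarrow> real" where
  "laplacian \<phi> x = (\<Sum>i\<in>UNIV. partial_deriv i (partial_deriv i \<phi>) x)"

definition C2_on :: "(real ^ 'n::finite) set \<Rightarrow> (real ^ 'n \<Rightarrow> real) \<Rightarrow> bool" where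
  "C2_on A \<phi> \<longleftrightarrow> (\<exists>(G :: real ^ 'n \<Rightarrow> real ^ 'n) (H :: real ^ 'n \<Rightarrow> real ^ 'n ^ 'n).
     (\<forall>x\<in>A. (\<phi> has_derivative (\<lambda>h. G x \<bullet> h)) (at x)) \<and>
     (\<forall>x\<in>A. (G has_derivative (\<lambda>h. H x *v h)) (at x)) \<and>
     continuous_on A H)"

definition viscosity_subsolution ::
    "(real ^ 'n::finite) set \<Rightarrow> (real ^ 'n \<Rightarrow> real) \<Rightarrow> (real ^ 'n \<Rightarrow> real) \<Rightarrow> bool" where
  "viscosity_subsolution U f u \<longleftrightarrow>
     (\<forall>x0 A \<phi>. open A \<and> x0 \<in> A \<and> A \<subseteq> U \<and> C2_on A \<phi> \<and>
        (\<forall>x\<in>A. u x - \<phi> x \<le> u x0 - \<phi> x0) \<longrightarrow> f x0 \<le> laplacian \<phi> x0)"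

definition viscosity_supersolution ::
    "(real ^ 'n::finite) set \<Rightarrow> (real ^ 'n \<Rightarrow> real) \<Rightarrow> (real ^ 'n \<Rightarrow> real) \<Rightarrow> bool" where
  "viscosity_supersolution U f u \<longleftrightarrow>
     (\<forall>x0 A \<phi>. open A \<and> x0 \<in> A \<and> A \<subseteq> U \<and> C2_on A \<phi> \<and>
        (\<forall>x\<in>A. u x0 - \<phi> x0 \<le> u x - \<phi> x) \<longrightarrow> laplacian \<phi> x0 \<le> f x0)"

text \<open>\<open>\<Delta>u = f\<close> in the open set \<open>U\<close> and \<open>u = g\<close> on the portion \<open>\<Gamma>\<close> of its boundary.\<close>

definition viscosity_solution ::
    "(real ^ 'n::finite) set \<Rightarrow> (real ^ 'n) set \<Rightarrow> (real ^ 'n \<Rightarrow> real) \<Rightarrow> (real ^ 'n \<Rightarrow> real) \<Rightarrow>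
     (real ^ 'n \<Rightarrow> real) \<Rightarrow> bool" where
  "viscosity_solution U \<Gamma> f g u \<longleftrightarrow>
     continuous_on (U \<union> \<Gamma>) u \<and> viscosity_subsolution U f u \<and> viscosity_supersolution U f u \<and>
     (\<forall>x\<in>\<Gamma>. u x = g x)"

definition Linf_norm :: "(real ^ 'n::finite) set \<Rightarrow> (real ^ 'n \<Rightarrow> real) \<Rightarrow> real" where
  "Linf_norm D u = real_of_ereal (esssup (lebesgue_on D) (\<lambda>x. ereal \<bar>u x\<bar>))"


section \<open>Pointwise regularity of functions at 0\<close>

text \<open>
  The polynomial \<open>P\<^sub>h\<close> is an explicit argument: for functions on \<open>\<partial>\<Omega>\<close> it is in general not determined
  by \<open>h\<close>, and both the derivatives of \<open>h\<close> at 0 and its norm refer to the chosen one.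
\<close>

definition C_pt_bound ::
    "nat \<Rightarrow> real \<Rightarrow> (real ^ 'n::finite) set \<Rightarrow> (real ^ 'n \<Rightarrow> real) \<Rightarrow> 'n mpoly \<Rightarrow> real \<Rightarrow> bool" where
  "C_pt_bound k \<alpha> D h P K \<longleftrightarrow>
     (\<forall>x \<in> D \<inter> ball 0 1. \<bar>h x - peval P x\<bar> \<le> K * norm x powr (real k + \<alpha>))"

definition C_pt ::
    "nat \<Rightarrow> real \<Rightarrow> (real ^ 'n::finite) set \<Rightarrow> (real ^ 'n \<Rightarrow> real) \<Rightarrow> 'n mpoly \<Rightarrow> bool" where
  "C_pt k \<alpha> D h P \<longleftrightarrow> P \<in> polys k \<and> (\<exists>K>0. C_pt_bound k \<alpha> D h P K)"

definition C_pt_seminorm ::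
    "nat \<Rightarrow> real \<Rightarrow> (real ^ 'n::finite) set \<Rightarrow> (real ^ 'n \<Rightarrow> real) \<Rightarrow> 'n mpoly \<Rightarrow> real" where
  "C_pt_seminorm k \<alpha> D h P = Inf {K. 0 < K \<and> C_pt_bound k \<alpha> D h P K}"

definition C_pt_norm ::
    "nat \<Rightarrow> real \<Rightarrow> (real ^ 'n::finite) set \<Rightarrow> (real ^ 'n \<Rightarrow> real) \<Rightarrow> 'n mpoly \<Rightarrow> real" where
  "C_pt_norm k \<alpha> D h P = poly_norm P + C_pt_seminorm k \<alpha> D h P"


section \<open>Pointwise regularity of the boundary at 0\<close>

text \<open>
  \<open>N\<close> is the index of the distinguished coordinate \<open>x\<^sub>n\<close>, and \<open>x'\<close> is represented by the vector
  \<open>(x', 0)\<close>.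
\<close>

definition tangential :: "'n::finite \<Rightarrow> real ^ 'n \<Rightarrow> real ^ 'n" where
  "tangential N x = (\<chi> i. if i = N then 0 else x $ i)"

definition bdry_bound ::
    "nat \<Rightarrow> real \<Rightarrow> 'n::finite \<Rightarrow> (real ^ 'n) set \<Rightarrow> 'n mpoly \<Rightarrow> real \<Rightarrow> bool" where
  "bdry_bound l \<alpha> N \<Omega> P K \<longleftrightarrow>
     ball 0 1 \<inter> {x. x $ N > peval P (tangential N x) + K * norm (tangential N x) powr (real l + \<alpha>)}
       \<subseteq> ball 0 1 \<inter> \<Omega> \<and>
     ball 0 1 \<inter> {x. x $ N < peval P (tangential N x) - K * norm (tangential N x) powr (real l + \<alpha>)}
       \<subseteq> ball 0 1 \<inter> - \<Omega>"

definition bdry_C_pt ::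
    "nat \<Rightarrow> real \<Rightarrow> 'n::finite \<Rightarrow> (real ^ 'n) set \<Rightarrow> 'n mpoly \<Rightarrow> bool" where
  "bdry_C_pt l \<alpha> N \<Omega> P \<longleftrightarrow>
     P \<in> polys l \<and> (\<forall>\<sigma>\<in>Poly_Mapping.keys P. Poly_Mapping.lookup \<sigma> N = 0) \<and>
     peval P 0 = 0 \<and> deriv_norm0 1 P = 0 \<and> (\<exists>K>0. bdry_bound l \<alpha> N \<Omega> P K)"

definition bdry_seminorm ::
    "nat \<Rightarrow> real \<Rightarrow> 'n::finite \<Rightarrow> (real ^ 'n) set \<Rightarrow> 'n mpoly \<Rightarrow> real" where
  "bdry_seminorm l \<alpha> N \<Omega> P = Inf {K. 0 < K \<and> bdry_bound l \<alpha> N \<Omega> P K}"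

definition bdry_norm ::
    "nat \<Rightarrow> real \<Rightarrow> 'n::finite \<Rightarrow> (real ^ 'n) set \<Rightarrow> 'n mpoly \<Rightarrow> real" where
  "bdry_norm l \<alpha> N \<Omega> P = poly_norm P + bdry_seminorm l \<alpha> N \<Omega> P"

end

theory Submission
  imports Defs
begin

text \<open>
  After subtracting suitable polynomials one may assume that the data vanish to high order, and it
  remains to expand a function that is almost harmonic and almost zero on an almost flat boundary.
  At each dyadic scale \<open>r\<close> such a function is compared with a harmonic polynomial that is odd in \<open>x\<^sub>N\<close>.
  The Dirichlet problem on a ball with polynomial data is solvable by polynomials, and by
  Weierstrass approximation polynomials suffice as data, so the only tool needed from the theory of
  viscosity solutions is comparison with polynomials. A barrier shows that passing from the true to
  the flat boundary costs a factor \<open>r\<^sup>\<alpha>\<close>. Interior estimates for harmonic polynomials allow the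
  approximations to be summed over all scales, which improves \<open>O(|x|\<^sup>\<beta>)\<close> to \<open>O(|x|\<^sup>\<gamma>)\<close> for any
  non-integer \<open>\<gamma> \<le> \<beta> + \<alpha>\<close>, modulo an odd harmonic polynomial. Finitely many such steps gain one
  order. Starting from \<open>|u| \<le> S\<close>, this is done for the orders \<open>0, \<dots>, k + l\<close> in turn; up to order
  \<open>k\<close> the polynomials found must vanish because \<open>u = O(|x|\<^sup>k\<^sup>+\<^sup>\<alpha>)\<close>.
\<close>

section \<open>Formal calculus of polynomials\<close>

text \<open>The boundary is only C^(l,\<alpha>), yet order k + l is reached, because P_g and the
  polynomials approximating u start in degree k + 1: replacing x_N by P_\<Omega>(x') in them costs
  only O(|x|^k |x|^(l+\<alpha>)) on the boundary. The harmonic approximation itself uses no more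
  than the flatness x_N = O(|x|^(1+\<alpha>)). Oddness in x_N matters twice: an odd polynomial
  vanishes on the flat model, and if homogeneous of degree m + 1 it is O(|x|^(m+1+\<alpha>)) on the
  true boundary, so it can be subtracted without spoiling boundary data of that order. Integers are
  avoided as exponents because for integer \<gamma> the dyadic increments of the coefficients of
  degree \<gamma> are bounded but need not decay, and their sum may grow logarithmically. The final
  constant must not depend on the C^(k,\<alpha>) seminorm of u. Hence the decay of u enters only
  qualitatively, to exclude terms of degree at most k, and the quantitative induction starts from
  the supremum of |u|.\<close>

abbreviation lookup :: "('a \<Rightarrow>\<^sub>0 'b::zero) \<Rightarrow> 'a \<Rightarrow> 'b" where "lookup \<equiv> Poly_Mapping.lookup"
abbreviation keys :: "('a \<Rightarrow>\<^sub>0 'b::zero) \<Rightarrow> 'a set" where "keys \<equiv> Poly_Mapping.keys"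
abbreviation expo :: "'n \<Rightarrow> ('n \<Rightarrow>\<^sub>0 nat)" where "expo i \<equiv> Poly_Mapping.single i (Suc 0)"

lemma mdeg_add: "mdeg (\<sigma> + \<tau>) = mdeg \<sigma> + mdeg \<tau>"
  by (simp add: mdeg_def lookup_add sum.distrib)

lemma mdeg_zero [simp]: "mdeg 0 = 0"
  by (simp add: mdeg_def)

lemma mdeg_expo [simp]: "mdeg (Poly_Mapping.single i m) = m"
  by (simp add: mdeg_def lookup_single when_def)

lemma lookup_le_mdeg: "lookup \<sigma> i \<le> mdeg \<sigma>"
  unfolding mdeg_def by (rule member_le_sum) auto

lemma mdeg_eq_0: "mdeg \<sigma> = 0 \<longleftrightarrow> \<sigma> = 0"
  by (auto simp: mdeg_def intro!: poly_mapping_eqI)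

lemma expo_decompose:
  assumes "lookup \<sigma> i > 0"
  obtains \<tau> where "\<sigma> = \<tau> + expo i"
proof
  show "\<sigma> = (\<sigma> - expo i) + expo i"
    using assms by (intro poly_mapping_eqI) (auto simp: lookup_add lookup_minus lookup_single when_def)
qed

lemma expo_induct [case_names zero add]:
  fixes \<sigma> :: "'n::finite \<Rightarrow>\<^sub>0 nat"
  assumes "Q 0" and "\<And>\<sigma> i. Q \<sigma> \<Longrightarrow> Q (\<sigma> + expo i)"
  shows "Q \<sigma>"
proof (induction "mdeg \<sigma>" arbitrary: \<sigma>)
  case 0
  then show ?case using assms(1) by (metis mdeg_eq_0)
next
  case (Suc d)
  then obtain i where "lookup \<sigma> i > 0"
    by (metis bot_nat_0.not_eq_extremum mdeg_def sum.neutral zero_less_Suc less_irrefl)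
  then obtain \<tau> where \<tau>: "\<sigma> = \<tau> + expo i" by (rule expo_decompose)
  then have "d = mdeg \<tau>" using Suc(2) by (simp add: mdeg_add)
  then show ?case using Suc(1) assms(2) \<tau> by metis
qed

lemma finite_mdeg_le: "finite {\<sigma> :: 'n::finite \<Rightarrow>\<^sub>0 nat. mdeg \<sigma> \<le> d}"
proof (rule finite_imageD)
  have "lookup ` {\<sigma> :: 'n \<Rightarrow>\<^sub>0 nat. mdeg \<sigma> \<le> d} \<subseteq> Pi\<^sub>E UNIV (\<lambda>_. {..d})"
    using lookup_le_mdeg order_trans by (fastforce simp: PiE_def)
  then show "finite (lookup ` {\<sigma> :: 'n \<Rightarrow>\<^sub>0 nat. mdeg \<sigma> \<le> d})"
    by (rule finite_subset) (intro finite_PiE, auto)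
  show "inj_on lookup {\<sigma> :: 'n \<Rightarrow>\<^sub>0 nat. mdeg \<sigma> \<le> d}"
    by (meson injI inj_on_subset lookup_inject subset_UNIV)
qed

lemma finite_mdeg_eq: "finite {\<sigma> :: 'n::finite \<Rightarrow>\<^sub>0 nat. mdeg \<sigma> = d}"
  by (rule finite_subset[OF _ finite_mdeg_le[of d]]) auto

lemma lookup_pconst_mult: "lookup (pconst c * P) \<sigma> = c * lookup P \<sigma>"
proof -
  have "lookup (pconst c * P) \<sigma> = Sum_any (\<lambda>l. lookup (pconst c) l * Sum_any (\<lambda>q. lookup P q when \<sigma> = l + q))"
    by (rule lookup_mult)
  also have "\<dots> = Sum_any (\<lambda>l. (c * Sum_any (\<lambda>q. lookup P q when \<sigma> = l + q)) when l = 0)"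
    by (rule arg_cong[where f=Sum_any]) (auto simp: pconst_def lookup_single when_def)
  finally show ?thesis by simp
qed

lemma lookup_mult_pvar_add: "lookup (P * pvar i) (\<sigma> + expo i) = lookup P \<sigma>"
  and lookup_mult_pvar_0: "lookup \<tau> i = 0 \<Longrightarrow> lookup (P * pvar i) \<tau> = 0"
proof -
  have *: "lookup (P * pvar i) \<sigma> = Sum_any (\<lambda>q. lookup P q when \<sigma> = expo i + q)" for \<sigma>
  proof -
    have "lookup (pvar i * P) \<sigma> = Sum_any (\<lambda>l. lookup (pvar i) l * Sum_any (\<lambda>q. lookup P q when \<sigma> = l + q))"
      by (rule lookup_mult)
    also have "\<dots> = Sum_any (\<lambda>l. Sum_any (\<lambda>q. lookup P q when \<sigma> = l + q) when l = expo i)"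
      by (rule arg_cong[where f=Sum_any]) (auto simp: pvar_def lookup_single when_def)
    finally show ?thesis by (simp add: mult.commute)
  qed
  have "lookup (P * pvar i) (\<sigma> + expo i) = Sum_any (\<lambda>q. lookup P q when q = \<sigma>)"
    unfolding * by (rule arg_cong[where f=Sum_any]) (auto simp: when_def add.commute)
  then show "lookup (P * pvar i) (\<sigma> + expo i) = lookup P \<sigma>" by simp
  assume "lookup \<tau> i = 0"
  then have "\<tau> \<noteq> expo i + q" for q
    by (metis lookup_add lookup_single_eq add_is_0 Suc_neq_Zero)
  then show "lookup (P * pvar i) \<tau> = 0" unfolding * by simp
qed

lemma single_decompose: "Poly_Mapping.single (\<sigma> + expo i) c = Poly_Mapping.single \<sigma> c * pvar i"
  by (simp add: pvar_def mult_single)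

text \<open>Adding one variable at a time reduces the product rule and the link with analytic
  derivatives to the case of a single factor x_i.\<close>

lemma mpoly_induct [case_names const add var]:
  fixes P :: "'n::finite mpoly"
  assumes const: "\<And>c. Q (pconst c)" and add: "\<And>P R. Q P \<Longrightarrow> Q R \<Longrightarrow> Q (P + R)"
    and var: "\<And>P i. Q P \<Longrightarrow> Q (P * pvar i)"
  shows "Q P"
proof -
  have 1: "Q (Poly_Mapping.single \<sigma> c)" for \<sigma> c
  proof (induction \<sigma> rule: expo_induct)
    case zero
    show ?case using const by (simp add: pconst_def)
  next
    case (add \<sigma> i)
    then show ?case unfolding single_decompose by (rule var)
  qed
  have 2: "finite A \<Longrightarrow> Q (\<Sum>i\<in>A. Poly_Mapping.single i (lookup P i))" for A
    by (induction A rule: finite_induct) (use const[of 0] in \<open>auto intro: add 1 simp: pconst_def\<close>)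
  show ?thesis using 2[of "keys P"] by (simp add: mpoly_expand)
qed

section \<open>Formal partial derivatives\<close>

lift_definition pdiff :: "'n \<Rightarrow> 'n mpoly \<Rightarrow> 'n mpoly"
  is "\<lambda>i a \<sigma>. (real (lookup \<sigma> i) + 1) * a (\<sigma> + expo i)"
proof -
  fix i :: 'n and a :: "('n \<Rightarrow>\<^sub>0 nat) \<Rightarrow> real" assume "finite {x. a x \<noteq> 0}"
  then have "finite ((\<lambda>\<sigma>. \<sigma> + expo i) -` {x. a x \<noteq> 0})"
    by (rule finite_vimageI) (simp add: inj_def)
  then show "finite {x. (real (lookup x i) + 1) * a (x + expo i) \<noteq> 0}"
    by (rule finite_subset[rotated]) auto
qed

lemma lookup_pdiff: "lookup (pdiff i P) \<sigma> = (real (lookup \<sigma> i) + 1) * lookup P (\<sigma> + expo i)"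
  by (simp add: pdiff.rep_eq)

lemma pdiff_add: "pdiff i (P + Q) = pdiff i P + pdiff i Q"
  and pdiff_diff: "pdiff i (P - Q) = pdiff i P - pdiff i Q"
  and pdiff_uminus: "pdiff i (- P) = - pdiff i P"
  by (auto intro!: poly_mapping_eqI simp: lookup_pdiff lookup_add lookup_minus algebra_simps)

lemma pdiff_0 [simp]: "pdiff i 0 = 0"
  by (auto intro!: poly_mapping_eqI simp: lookup_pdiff)

lemma pdiff_pconst [simp]: "pdiff i (pconst c) = 0"
proof (rule poly_mapping_eqI)
  fix \<sigma> show "lookup (pdiff i (pconst c)) \<sigma> = lookup 0 \<sigma>"
    by (simp add: lookup_pdiff pconst_def lookup_single when_def) 
       (metis lookup_add lookup_single_eq lookup_zero add_is_0 Suc_neq_Zero)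
qed

lemma pdiff_mult_pvar:
  "pdiff j (P * pvar i) = pdiff j P * pvar i + (if i = j then P else 0)"
proof (rule poly_mapping_eqI)
  fix \<sigma>
  show "lookup (pdiff j (P * pvar i)) \<sigma> = lookup (pdiff j P * pvar i + (if i = j then P else 0)) \<sigma>"
  proof (cases "lookup \<sigma> i = 0")
    case True
    then show ?thesis
      by (cases "i = j") (auto simp: lookup_pdiff lookup_add lookup_mult_pvar_0 lookup_mult_pvar_add lookup_single when_def)
  next
    case False
    then obtain \<tau> where \<tau>: "\<sigma> = \<tau> + expo i" using expo_decompose[of \<sigma> i] by auto
    have e: "lookup (P * pvar i) (\<tau> + expo i + expo j) = lookup P (\<tau> + expo j)"
      by (simp only: add.assoc add.commute[of "expo i"]) (simp only: add.assoc[symmetric] lookup_mult_pvar_add)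
    have "lookup (pdiff j P * pvar i) \<sigma> = (real (lookup \<tau> j) + 1) * lookup P (\<tau> + expo j)"
      unfolding \<tau> lookup_mult_pvar_add lookup_pdiff ..
    moreover have "lookup (pdiff j (P * pvar i)) \<sigma> = (real (lookup (\<tau> + expo i) j) + 1) * lookup P (\<tau> + expo j)"
      unfolding \<tau> lookup_pdiff e ..
    ultimately show ?thesis
      by (cases "i = j") (simp_all add: \<tau> lookup_add lookup_single algebra_simps)
  qed
qed

lemma pdiff_mult:
  fixes P Q :: "'n::finite mpoly"
  shows "pdiff i (P * Q) = pdiff i P * Q + P * pdiff i Q"
proof (induction Q rule: mpoly_induct)
  case (const c)
  have "pdiff i (pconst c * P) = pconst c * pdiff i P"
    by (rule poly_mapping_eqI) (simp add: lookup_pdiff lookup_pconst_mult)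
  then show ?case by (simp add: mult.commute)
next
  case (add P R) then show ?case by (simp add: pdiff_add algebra_simps)
next
  case (var Q j)
  have "pdiff i (P * (Q * pvar j)) = pdiff i (P * Q) * pvar j + (if j = i then P * Q else 0)"
    by (simp add: pdiff_mult_pvar mult.assoc[symmetric])
  then show ?case by (simp add: var pdiff_mult_pvar algebra_simps)
qed

lemma pdiff_sum: "pdiff i (sum F A) = (\<Sum>a\<in>A. pdiff i (F a))"
  by (induction A rule: infinite_finite_induct) (auto simp: pdiff_add)

lemma pconst_1: "pconst 1 = 1"
  by (simp add: pconst_def)

lemma pdiff_1 [simp]: "pdiff i 1 = 0"
  using pdiff_pconst[of i 1] by (simp only: pconst_1)

lemma pdiff_pvar: "pdiff j (pvar i) = (if i = j then 1 else 0)"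
  using pdiff_mult_pvar[of j 1 i] by simp

lemma peval_uminus: "peval (- P) x = - peval P x"
  using peval_add[of P "-P" x] by simp

lemma peval_diff: "peval (P - Q) x = peval P x - peval Q x"
  using peval_add[of P "-Q" x] by (simp add: peval_uminus)

section \<open>Formal derivatives as derivatives of polynomial functions\<close>

lemma peval_has_derivative:
  "(peval P has_derivative (\<lambda>h. \<Sum>i\<in>UNIV. peval (pdiff i P) x * h $ i)) (at x)"
proof (induction P rule: mpoly_induct)
  case (const c)
  show ?case by (simp add: peval_const[abs_def])
next
  case (add P R)
  then show ?case
    by (auto simp: peval_add[abs_def] pdiff_add algebra_simps sum.distrib intro!: derivative_eq_intros)
next
  case (var P j)
  have "((\<lambda>x. peval P x * x $ j) has_derivative
     (\<lambda>h. peval P x * h $ j + (\<Sum>i\<in>UNIV. peval (pdiff i P) x * h $ i) * x $ j)) (at x)"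
    by (rule derivative_eq_intros var bounded_linear_imp_has_derivative bounded_linear_vec_nth | simp)+
  moreover have "(\<Sum>i\<in>UNIV. peval (pdiff i (P * pvar j)) x * h $ i) =
      peval P x * h $ j + (\<Sum>i\<in>UNIV. peval (pdiff i P) x * h $ i) * x $ j" for h
  proof -
    have "(\<Sum>i\<in>UNIV. peval (pdiff i (P * pvar j)) x * h $ i) =
      (\<Sum>i\<in>UNIV. (peval (pdiff i P) x * h $ i) * x $ j + (if j = i then peval P x * h $ i else 0))"
      by (rule sum.cong) (auto simp: pdiff_mult_pvar peval_add peval_mult peval_var algebra_simps)
    then show ?thesis by (simp add: sum.distrib sum_distrib_right)
  qed
  ultimately show ?case by (simp add: peval_mult[abs_def] peval_var)
qed

lemma peval_DERIV_line:
  "((\<lambda>t. peval P (x + t *\<^sub>R y)) has_real_derivative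
     (\<Sum>i\<in>UNIV. peval (pdiff i P) (x + t *\<^sub>R y) * y $ i)) (at t)"
proof -
  have "((\<lambda>t. x + t *\<^sub>R y) has_derivative (\<lambda>s. s *\<^sub>R y)) (at t)"
    by (auto intro!: derivative_eq_intros)
  from has_derivative_compose[OF this peval_has_derivative[of P]]
  show ?thesis
    by (rule has_derivative_imp_has_field_derivative)
       (simp add: sum_distrib_left sum_distrib_right mult_ac)
qed

lemma sum_mult_axis: "(\<Sum>j\<in>UNIV. F j * axis i (1::real) $ j) = F i"
proof -
  have "(\<Sum>j\<in>UNIV. F j * axis i (1::real) $ j) = (\<Sum>j\<in>UNIV. if j = i then F i else 0)"
    by (rule sum.cong) (auto simp: axis_def)
  then show ?thesis by simp
qed

lemma partial_deriv_peval: "partial_deriv i (peval P) = peval (pdiff i P)"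
proof
  fix x
  show "partial_deriv i (peval P) x = peval (pdiff i P) x"
    unfolding partial_deriv_def
    by (rule DERIV_imp_deriv) (use peval_DERIV_line[of P x "axis i 1" 0] in \<open>simp add: sum_mult_axis\<close>)
qed

definition lap :: "'n::finite mpoly \<Rightarrow> 'n mpoly" where
  "lap P = (\<Sum>i\<in>UNIV. pdiff i (pdiff i P))"

lemma laplacian_peval: "laplacian (peval P) x = peval (lap P) x"
  by (simp add: laplacian_def partial_deriv_peval lap_def peval_sum)

lemma continuous_on_peval [continuous_intros]: "continuous_on A (peval P)"
  by (meson continuous_at_imp_continuous_on has_derivative_continuous peval_has_derivative)

lemma C2_on_peval: "C2_on A (peval P)"
  unfolding C2_on_def
proof (intro exI conjI ballI)
  let ?G = "\<lambda>x. \<chi> i. peval (pdiff i P) x"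
  let ?H = "\<lambda>x. \<chi> i j. peval (pdiff j (pdiff i P)) x"
  show "(peval P has_derivative (\<lambda>h. ?G x \<bullet> h)) (at x)" for x
    using peval_has_derivative[of P x] by (simp add: inner_vec_def)
  show "(?G has_derivative (\<lambda>h. ?H x *v h)) (at x)" for x
    unfolding matrix_vector_mult_def
    by (subst has_derivative_componentwise_within)
       (use peval_has_derivative in \<open>auto simp: Basis_vec_def inner_axis\<close>)
  show "continuous_on A ?H"
    by (intro continuous_on_vec_lambda continuous_intros)
qed

lemma lap_add: "lap (P + Q) = lap P + lap Q"
  and lap_diff: "lap (P - Q) = lap P - lap Q"
  and lap_uminus: "lap (- P) = - lap P"
  by (auto simp: lap_def pdiff_add pdiff_diff pdiff_uminus sum.distrib sum_subtractf sum_negf)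

lemma lap_0 [simp]: "lap 0 = 0" by (simp add: lap_def)

lemma lap_sum: "lap (sum F A) = (\<Sum>a\<in>A. lap (F a))"
  by (induction A rule: infinite_finite_induct) (auto simp: lap_add)

lemma lap_mult: "lap (P * Q) = lap P * Q + 2 * (\<Sum>i\<in>UNIV. pdiff i P * pdiff i Q) + P * lap Q"
proof -
  have "pdiff i (pdiff i (P * Q)) = pdiff i (pdiff i P) * Q + 2 * (pdiff i P * pdiff i Q) + P * pdiff i (pdiff i Q)"
    for i by (simp add: pdiff_mult pdiff_add algebra_simps)
  then show ?thesis
    by (simp add: lap_def sum.distrib sum_distrib_left sum_distrib_right)
qed

lemma lap_pconst_mult: "lap (pconst c * P) = pconst c * lap P"
  by (simp add: lap_def pdiff_mult sum_distrib_left)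

lemma pdiff_commute: "pdiff i (pdiff j P) = pdiff j (pdiff i P)"
proof (rule poly_mapping_eqI)
  fix \<sigma>
  have "\<sigma> + expo i + expo j = \<sigma> + expo j + expo i" by (simp add: ac_simps)
  then show "lookup (pdiff i (pdiff j P)) \<sigma> = lookup (pdiff j (pdiff i P)) \<sigma>"
    by (cases "i = j") (auto simp: lookup_pdiff lookup_add lookup_single)
qed

lemma lap_pdiff: "lap (pdiff i P) = pdiff i (lap P)"
  by (simp add: lap_def pdiff_sum pdiff_commute[of _ i])

lemma lookup_0_eq_peval: "lookup P 0 = peval P 0"
proof -
  have m: "mon \<sigma> (0 :: real ^ 'a) = (if \<sigma> = 0 then 1 else 0)" for \<sigma> :: "'a \<Rightarrow>\<^sub>0 nat"
  proof (cases "\<sigma> = 0")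
    case True then show ?thesis by (simp add: mon_def)
  next
    case False
    then obtain i where "lookup \<sigma> i \<noteq> 0" by (metis lookup_zero poly_mapping_eqI)
    then show ?thesis using False by (auto simp: mon_def intro!: prod_zero)
  qed
  then have "peval P 0 = (\<Sum>\<sigma>\<in>keys P. if \<sigma> = 0 then lookup P \<sigma> else 0)"
    unfolding peval_def by (intro sum.cong) (simp_all add: m)
  then show ?thesis by (simp add: in_keys_iff del: peval_0)
qed

text \<open>A coefficient is, up to a positive factor, a derivative at 0, and a polynomial vanishing
  everywhere has derivatives vanishing everywhere. Identities such as those for
  \<open>psubst\<close> can thus be checked pointwise.\<close>

lemma peval_inject:
  fixes P Q :: "'n::finite mpoly"
  shows "(\<And>x. peval P x = peval Q x) \<Longrightarrow> P = Q"
proof -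
  have *: "\<forall>R :: 'n mpoly. (\<forall>x. peval R x = 0) \<longrightarrow> lookup R \<sigma> = 0" for \<sigma>
  proof (induction \<sigma> rule: expo_induct)
    case zero
    then show ?case by (simp add: lookup_0_eq_peval)
  next
    case (add \<sigma> i)
    show ?case
    proof (intro allI impI)
      fix R :: "'n mpoly" assume R: "\<forall>x. peval R x = 0"
      then have "peval R = (\<lambda>_. 0)" by auto
      then have "peval (pdiff i R) x = 0" for x
        by (simp add: partial_deriv_peval[symmetric] partial_deriv_def)
      with add have "lookup (pdiff i R) \<sigma> = 0" by blast
      then show "lookup R (\<sigma> + expo i) = 0"
        by (simp add: lookup_pdiff add_nonneg_eq_0_iff)
    qed
  qed
  assume "\<And>x. peval P x = peval Q x"
  then have "lookup (P - Q) \<sigma> = 0" for \<sigma> using * by (simp add: peval_diff)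
  then show "P = Q" by (intro poly_mapping_eqI) (simp add: lookup_minus)
qed

section \<open>Degrees and coefficient filters\<close>

definition homogeneous :: "nat \<Rightarrow> 'n::finite mpoly \<Rightarrow> bool" where
  "homogeneous d P \<longleftrightarrow> (\<forall>\<sigma>. lookup P \<sigma> \<noteq> 0 \<longrightarrow> mdeg \<sigma> = d)"

text \<open>The formal version of P(x) = O(|x|^d) near 0.\<close>

definition low_order :: "nat \<Rightarrow> 'n::finite mpoly \<Rightarrow> bool" where
  "low_order d P \<longleftrightarrow> (\<forall>\<sigma>. lookup P \<sigma> \<noteq> 0 \<longrightarrow> d \<le> mdeg \<sigma>)"

text \<open>One operation for truncations by degree, homogeneous parts and the odd part.\<close>

definition pfilter :: "(('n \<Rightarrow>\<^sub>0 nat) \<Rightarrow> bool) \<Rightarrow> 'n mpoly \<Rightarrow> 'n mpoly" where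
  "pfilter S P = (\<Sum>\<sigma> | \<sigma> \<in> keys P \<and> S \<sigma>. Poly_Mapping.single \<sigma> (lookup P \<sigma>))"

lemma lookup_pfilter: "lookup (pfilter S P) \<sigma> = (if S \<sigma> then lookup P \<sigma> else 0)"
  by (auto simp: pfilter_def lookup_sum lookup_single when_def in_keys_iff)

lemma polys_iff: "P \<in> polys d \<longleftrightarrow> (\<forall>\<sigma>. lookup P \<sigma> \<noteq> 0 \<longrightarrow> mdeg \<sigma> \<le> d)"
  by (auto simp: polys_def in_keys_iff)

lemma lookup_mult_nonzero:
  assumes "lookup (P * Q) \<sigma> \<noteq> 0"
  obtains a b where "\<sigma> = a + b" "lookup P a \<noteq> 0" "lookup Q b \<noteq> 0"
  using assms keys_mult[of P Q] in_keys_iff[of \<sigma> "P * Q"] by (auto simp: in_keys_iff)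

lemma homogeneous_mult: "homogeneous d P \<Longrightarrow> homogeneous e Q \<Longrightarrow> homogeneous (d + e) (P * Q)"
  unfolding homogeneous_def by (metis lookup_mult_nonzero mdeg_add)

lemma low_order_mult: "low_order d P \<Longrightarrow> low_order e Q \<Longrightarrow> low_order (d + e) (P * Q)"
  unfolding low_order_def by (metis lookup_mult_nonzero mdeg_add add_mono)

lemma homogeneous_0 [simp]: "homogeneous d 0"
  by (simp add: homogeneous_def)

lemma homogeneous_add: "homogeneous d P \<Longrightarrow> homogeneous d Q \<Longrightarrow> homogeneous d (P + Q)"
  unfolding homogeneous_def by (metis add_0 lookup_add)

lemma homogeneous_diff: "homogeneous d P \<Longrightarrow> homogeneous d Q \<Longrightarrow> homogeneous d (P - Q)"
  unfolding homogeneous_def by (metis diff_0_right diff_self lookup_minus)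

lemma homogeneous_pconst_mult: "homogeneous d P \<Longrightarrow> homogeneous d (pconst c * P)"
  unfolding homogeneous_def by (simp add: lookup_pconst_mult)

lemma homogeneous_sum: "(\<And>a. a \<in> A \<Longrightarrow> homogeneous d (F a)) \<Longrightarrow> homogeneous d (sum F A)"
  by (induction A rule: infinite_finite_induct) (auto intro: homogeneous_add)

lemma homogeneous_pvar: "homogeneous 1 (pvar i)"
  by (auto simp: homogeneous_def pvar_def lookup_single when_def)

text \<open>For d = 0 the derivative is 0, so the truncated subtraction does no harm.\<close>

lemma homogeneous_pdiff: "homogeneous d P \<Longrightarrow> homogeneous (d - 1) (pdiff i P)"
  unfolding homogeneous_def by (auto simp: lookup_pdiff mdeg_add)

lemma homogeneous_lap: "homogeneous d P \<Longrightarrow> homogeneous (d - 2) (lap P)"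
  unfolding lap_def using homogeneous_pdiff[OF homogeneous_pdiff, of d P]
  by (intro homogeneous_sum) (simp add: numeral_2_eq_2)

lemma lap_homogeneous_lt_2:
  assumes "homogeneous d P" "d < 2" shows "lap P = 0"
proof (rule poly_mapping_eqI)
  fix \<sigma>
  have "lookup P (\<sigma> + expo i + expo i) = 0" for i
    using assms by (auto simp: homogeneous_def mdeg_add)
  then show "lookup (lap P) \<sigma> = lookup 0 \<sigma>"
    by (simp add: lap_def lookup_sum lookup_pdiff)
qed

lemma mpoly_degree_bound: obtains d where "\<And>\<sigma>. lookup P \<sigma> \<noteq> 0 \<Longrightarrow> mdeg \<sigma> < d"
proof
  fix \<sigma> assume "lookup P \<sigma> \<noteq> 0"
  then have "mdeg \<sigma> \<le> Max (mdeg ` keys P)" by (intro Max_ge) (auto simp: in_keys_iff)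
  then show "mdeg \<sigma> < Suc (Max (mdeg ` keys P))" by simp
qed

section \<open>The Dirichlet problem on a ball with polynomial data\<close>

lemma pconst_numeral: "pconst (numeral k) = numeral k"
  by (simp add: pconst_def)

lemma peval_numeral [simp]: "peval (numeral k) x = numeral k"
  by (metis peval_const pconst_numeral)

lemma pdiff_numeral [simp]: "pdiff i (numeral k) = 0"
  by (metis pconst_numeral pdiff_pconst)

lemma pconst_add: "pconst (a + b) = pconst a + pconst b"
  by (simp add: pconst_def single_add)

lemma pconst_mult: "pconst (a * b) = pconst a * pconst b"
  by (simp add: pconst_def mult_single)

lemma pconst_of_nat: "pconst (of_nat m) = of_nat m"
  by (simp add: pconst_def)

lemma lookup_pdiff_mult_pvar: "lookup (pvar i * pdiff i P) \<sigma> = real (lookup \<sigma> i) * lookup P \<sigma>"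
proof (cases "lookup \<sigma> i = 0")
  case True
  then show ?thesis by (simp add: mult.commute[of "pvar i"] lookup_mult_pvar_0)
next
  case False
  then obtain \<tau> where "\<sigma> = \<tau> + expo i" using expo_decompose[of \<sigma> i] by auto
  then show ?thesis
    by (simp add: mult.commute[of "pvar i"] lookup_mult_pvar_add lookup_pdiff lookup_add)
qed

lemma euler_homogeneous:
  "homogeneous d P \<Longrightarrow> (\<Sum>i\<in>UNIV. pvar i * pdiff i P) = pconst d * P"
proof (rule poly_mapping_eqI)
  fix \<sigma> assume P: "homogeneous d P"
  have "lookup (\<Sum>i\<in>UNIV. pvar i * pdiff i P) \<sigma> = real (mdeg \<sigma>) * lookup P \<sigma>"
    by (simp add: lookup_sum lookup_pdiff_mult_pvar mdeg_def sum_distrib_right)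
  then show "lookup (\<Sum>i\<in>UNIV. pvar i * pdiff i P) \<sigma> = lookup (pconst d * P) \<sigma>"
    using P by (cases "lookup P \<sigma> = 0") (auto simp: lookup_pconst_mult homogeneous_def)
qed

definition rsq :: "'n::finite mpoly" where "rsq = (\<Sum>i\<in>UNIV. pvar i * pvar i)"

lemma peval_rsq: "peval rsq x = (norm x)\<^sup>2"
  by (simp add: rsq_def peval_sum peval_mult peval_var power2_norm_eq_inner inner_vec_def)

lemma pdiff_rsq: "pdiff i rsq = 2 * pvar i"
proof -
  have "pdiff i rsq = (\<Sum>j\<in>UNIV. if j = i then 2 * pvar i else 0)"
    unfolding rsq_def pdiff_sum by (rule sum.cong) (auto simp: pdiff_mult pdiff_pvar)
  then show ?thesis by simp
qed

lemma lap_rsq: "lap (rsq :: 'n::finite mpoly) = pconst (2 * real CARD('n))"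
  by (simp add: lap_def pdiff_rsq pdiff_mult pdiff_pvar pconst_mult pconst_of_nat pconst_numeral)

lemma homogeneous_rsq: "homogeneous 2 rsq"
  unfolding rsq_def by (intro homogeneous_sum) (metis homogeneous_mult homogeneous_pvar one_add_one)

lemma homogeneous_rsq_power: "homogeneous d P \<Longrightarrow> homogeneous (2 * j + d) (rsq ^ j * P)"
proof (induction j)
  case (Suc j)
  then show ?case
    using homogeneous_mult[OF homogeneous_rsq, of "2 * j + d" "rsq ^ j * P"] by (simp add: mult.assoc)
qed simp

lemma lap_rsq_mult:
  assumes "homogeneous d (P :: 'n::finite mpoly)"
  shows "lap (rsq * P) = pconst (2 * real CARD('n) + 4 * real d) * P + rsq * lap P"
proof -
  have "(\<Sum>i\<in>UNIV. pdiff i rsq * pdiff i P) = 2 * (pconst d * P)"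
    unfolding euler_homogeneous[OF assms, symmetric] by (simp add: pdiff_rsq sum_distrib_left mult.assoc)
  then show ?thesis
    by (simp add: lap_mult lap_rsq pconst_add pconst_mult pconst_numeral algebra_simps)
qed

text \<open>Iterates \<open>lap_rsq_mult\<close>; what matters about the constant is its sign, since
  it will be divided by.\<close>

lemma lap_rsq_power_mult:
  assumes "homogeneous d (P :: 'n::finite mpoly)"
  shows "\<exists>c>0. lap (rsq ^ Suc j * P) = pconst c * (rsq ^ j * P) + rsq ^ Suc j * lap P"
proof (induction j)
  case 0
  show ?case
    by (rule exI[of _ "2 * real CARD('n) + 4 * real d"]) (use lap_rsq_mult[OF assms] in \<open>simp add: add_pos_nonneg\<close>)
next
  case (Suc j)
  then obtain c where c: "c > 0" "lap (rsq ^ Suc j * P) = pconst c * (rsq ^ j * P) + rsq ^ Suc j * lap P" by blast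
  let ?c' = "2 * real CARD('n) + 4 * real (2 * Suc j + d)"
  have "lap (rsq ^ Suc (Suc j) * P) = lap (rsq * (rsq ^ Suc j * P))" by (simp add: mult.assoc)
  also have "\<dots> = pconst ?c' * (rsq ^ Suc j * P) + rsq * lap (rsq ^ Suc j * P)"
    by (rule lap_rsq_mult[OF homogeneous_rsq_power[OF assms]])
  also have "\<dots> = pconst (?c' + c) * (rsq ^ Suc j * P) + rsq ^ Suc (Suc j) * lap P"
    unfolding c(2) by (simp add: pconst_add algebra_simps)
  finally show ?case using c(1) by (intro exI[of _ "?c' + c"]) (auto intro: add_nonneg_pos)
qed

text \<open>The Laplacian of |x|^(2j+2) P is a positive multiple of |x|^(2j) P plus |x|^(2j+2)
  \<Delta>P. The last term has the same shape with the degree of P lowered by two, so induction on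
  that degree removes it; below degree 2 it is zero.\<close>

lemma lap_rsq_surj_homogeneous:
  "homogeneous d P \<Longrightarrow> \<exists>Q. homogeneous (2 * j + d) Q \<and> lap (rsq * Q) = rsq ^ j * (P :: 'n::finite mpoly)"
proof (induction d arbitrary: j P rule: less_induct)
  case (less d)
  obtain c where c: "c > 0" "lap (rsq ^ Suc j * P) = pconst c * (rsq ^ j * P) + rsq ^ Suc j * lap P"
    using lap_rsq_power_mult[OF less.prems] by blast
  obtain Q' where Q': "homogeneous (2 * j + d) Q'" "lap (rsq * Q') = rsq ^ Suc j * lap P"
  proof (cases "d < 2")
    case True
    then show ?thesis using that[of 0] lap_homogeneous_lt_2[OF less.prems] by simp
  next
    case False
    moreover from this have "2 * Suc j + (d - 2) = 2 * j + d" by simp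
    ultimately show ?thesis
      using that less.IH[OF _ homogeneous_lap[OF less.prems], of "Suc j"] by (metis zero_less_numeral diff_less not_less_iff_gr_or_eq order_less_trans)
  qed
  have "lap (rsq * (pconst (1/c) * (rsq ^ j * P - Q'))) = lap (pconst (1/c) * (rsq ^ Suc j * P - rsq * Q'))"
    by (simp add: algebra_simps)
  also have "\<dots> = pconst (1/c) * (pconst c * (rsq ^ j * P))"
    by (simp add: lap_pconst_mult lap_diff c Q' del: power_Suc)
  also have "\<dots> = rsq ^ j * P"
    using c(1) by (simp add: mult.assoc[symmetric] pconst_mult[symmetric] pconst_1)
  finally show ?case
    using Q'(1) homogeneous_rsq_power[OF less.prems]
    by (intro exI[of _ "pconst (1/c) * (rsq ^ j * P - Q')"]) (auto intro: homogeneous_pconst_mult homogeneous_diff)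
qed

text \<open>Solved from the top degree downwards: the leading part of \<Delta>((c - |x|^2) Q) is
  -\<Delta>(|x|^2 Q), which can match the top homogeneous part of P; the term c \<Delta>Q has
  smaller degree and joins what remains.\<close>

lemma lap_ball_surj:
  "(\<And>\<sigma>. lookup P \<sigma> \<noteq> 0 \<Longrightarrow> mdeg \<sigma> < d) \<Longrightarrow> \<exists>Q. lap ((pconst c - rsq) * Q) = (P :: 'n::finite mpoly)"
proof (induction d arbitrary: P)
  case 0
  then have "P = 0" by (intro poly_mapping_eqI) (metis lookup_zero not_less_zero)
  then show ?case by (intro exI[of _ 0]) simp
next
  case (Suc d)
  let ?T = "pfilter (\<lambda>\<sigma>. mdeg \<sigma> = d) P"
  have "homogeneous d ?T" by (auto simp: homogeneous_def lookup_pfilter)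
  then obtain Q where Q: "homogeneous d Q" "lap (rsq * Q) = ?T"
    using lap_rsq_surj_homogeneous[of d ?T 0] by auto
  define P' where "P' = P - ?T + pconst c * lap Q"
  have lapQ: "lookup (lap Q) \<sigma> \<noteq> 0 \<Longrightarrow> mdeg \<sigma> < d" for \<sigma>
    using homogeneous_lap[OF Q(1)] lap_homogeneous_lt_2[OF Q(1)]
    by (cases "d < 2") (auto simp: homogeneous_def)
  have "mdeg \<sigma> < d" if "lookup P' \<sigma> \<noteq> 0" for \<sigma>
  proof (cases "lookup (lap Q) \<sigma> = 0")
    case True
    then show ?thesis using that Suc.prems[of \<sigma>]
      by (auto simp: P'_def lookup_add lookup_minus lookup_pfilter lookup_pconst_mult split: if_splits)
  qed (rule lapQ)
  then obtain Q' where Q': "lap ((pconst c - rsq) * Q') = P'" using Suc.IH by blast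
  have "lap ((pconst c - rsq) * (Q' - Q)) = P' - (pconst c * lap Q - ?T)"
    by (simp add: right_diff_distrib lap_diff Q') (simp add: left_diff_distrib lap_diff Q lap_pconst_mult)
  also have "\<dots> = P" by (simp add: P'_def)
  finally show ?case by blast
qed

text \<open>A multiple of R^2 - |x|^2 vanishes on the sphere, and a suitable one carries the whole
  Laplacian of P.\<close>

lemma harmonic_polynomial_sphere:
  obtains H :: "'n::finite mpoly" where "lap H = 0" "\<And>x. norm x = R \<Longrightarrow> peval H x = peval P x"
proof -
  obtain d where "\<And>\<sigma>. lookup (lap P) \<sigma> \<noteq> 0 \<Longrightarrow> mdeg \<sigma> < d" using mpoly_degree_bound[of "lap P"] by blast
  then obtain Q where Q: "lap ((pconst (R\<^sup>2) - rsq) * Q) = lap P" using lap_ball_surj by blast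
  show ?thesis
    by (rule that[of "P - (pconst (R\<^sup>2) - rsq) * Q"])
       (simp_all add: lap_diff Q peval_diff peval_mult peval_const peval_rsq)
qed

section \<open>Maximum principle for polynomials\<close>

lemma second_derivative_at_local_max:
  assumes "0 < r" and max: "\<And>y. dist y x < r \<Longrightarrow> peval F y \<le> peval F x"
  shows "peval (pdiff i (pdiff i F)) x \<le> 0"
proof (rule ccontr)
  let ?\<phi> = "\<lambda>P t. peval P (x + t *\<^sub>R axis i 1)"
  have d: "(?\<phi> P has_real_derivative ?\<phi> (pdiff i P) t) (at t)" for P t
    using peval_DERIV_line[of P x "axis i 1" t] by (simp add: sum_mult_axis)
  have max': "?\<phi> F t \<le> ?\<phi> F 0" if "\<bar>0 - t\<bar> < r" for t
    using max[of "x + t *\<^sub>R axis i 1"] that by (simp add: dist_norm)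
  have 0: "?\<phi> (pdiff i F) 0 = 0"
    by (rule DERIV_local_max[OF d \<open>0 < r\<close>]) (use max' in auto)
  assume "\<not> ?thesis"
  then have "0 < ?\<phi> (pdiff i (pdiff i F)) 0" by simp
  from DERIV_pos_inc_right[OF d this] obtain e where
    e: "e > 0" "\<And>h. 0 < h \<Longrightarrow> h < e \<Longrightarrow> ?\<phi> (pdiff i F) 0 < ?\<phi> (pdiff i F) h" by (auto simp del: scaleR_zero_left)
  define s where "s = min e r / 2"
  have s: "0 < s" "s < e" "s < r" using e(1) \<open>0 < r\<close> by (auto simp: s_def)
  obtain z where z: "0 < z" "z < s" "?\<phi> F s - ?\<phi> F 0 = (s - 0) * ?\<phi> (pdiff i F) z"
    using MVT2[OF \<open>0 < s\<close> d] by blast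
  have "0 < ?\<phi> (pdiff i F) z" using e(2)[of z] z s 0 by simp
  with z s have "0 < ?\<phi> F s - ?\<phi> F 0" by simp
  with max'[of s] s show False by simp
qed

text \<open>The boundary is taken to be K minus G, so that balls and half balls are treated alike
  without describing their frontiers.\<close>

lemma maximum_principle:
  fixes F :: "'n::finite mpoly"
  assumes K: "compact K" and G: "open G" "G \<subseteq> K"
    and sub: "\<And>x. x \<in> G \<Longrightarrow> 0 \<le> peval (lap F) x"
    and bdry: "\<And>x. x \<in> K \<Longrightarrow> x \<notin> G \<Longrightarrow> peval F x \<le> 0"
    and "x \<in> K"
  shows "peval F x \<le> 0"
proof -
  obtain B where B: "\<And>y. y \<in> K \<Longrightarrow> norm y \<le> B" using compact_imp_bounded[OF K] by (auto simp: bounded_iff)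
  \<comment> \<open>Adding e |x|^2 makes F strictly subharmonic on G, which excludes a maximum
    there; e tends to 0 at the end.\<close>
  have "peval F x \<le> e * B\<^sup>2" if "e > 0" for e
  proof -
    let ?F = "F + pconst e * rsq"
    obtain z where z: "z \<in> K" "\<And>y. y \<in> K \<Longrightarrow> peval ?F y \<le> peval ?F z"
      using continuous_attains_sup[OF K, of "peval ?F"] \<open>x \<in> K\<close> continuous_on_peval by blast
    have "z \<notin> G"
    proof
      assume "z \<in> G"
      then obtain r where r: "r > 0" "ball z r \<subseteq> G" using G(1) open_contains_ball by blast
      have "peval (pdiff i (pdiff i ?F)) z \<le> 0" for i
        by (rule second_derivative_at_local_max[OF r(1)]) (use r G z(2) in \<open>auto simp: dist_commute mem_ball subset_iff\<close>)
      then have "peval (lap ?F) z \<le> 0" by (auto simp: lap_def peval_sum intro: sum_nonpos)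
      moreover have "peval (lap ?F) z = peval (lap F) z + e * (2 * real CARD('n))"
        by (simp add: lap_add lap_pconst_mult lap_rsq peval_add peval_mult peval_const)
      ultimately show False using sub[OF \<open>z \<in> G\<close>] \<open>e > 0\<close> by (smt (verit) mult_pos_pos of_nat_0_less_iff zero_less_card_finite)
    qed
    then have "peval F z \<le> 0" using bdry z by blast
    moreover have "(norm z)\<^sup>2 \<le> B\<^sup>2" using B[OF z(1)] by (intro power_mono) auto
    then have "e * (norm z)\<^sup>2 \<le> e * B\<^sup>2" using \<open>e > 0\<close> by simp
    moreover have "peval F x \<le> peval ?F x" using \<open>e > 0\<close> by (simp add: peval_add peval_mult peval_const peval_rsq)
    ultimately show ?thesis using z(2)[OF \<open>x \<in> K\<close>] by (simp add: peval_add peval_mult peval_const peval_rsq)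
  qed
  moreover have "((\<lambda>e. e * B\<^sup>2) \<longlongrightarrow> 0 * B\<^sup>2) (at_right 0)" by (intro tendsto_intros)
  ultimately show ?thesis
    by (intro tendsto_lowerbound[of "\<lambda>e. e * B\<^sup>2" "0" "at_right (0::real)"])
       (auto simp: eventually_at_filter)
qed

section \<open>Estimates for harmonic polynomials\<close>

definition dist_sq :: "real ^ 'n \<Rightarrow> 'n::finite mpoly" where
  "dist_sq y = (\<Sum>j\<in>UNIV. (pvar j - pconst (y $ j)) * (pvar j - pconst (y $ j)))"

lemma peval_dist_sq: "peval (dist_sq y) x = (norm (x - y))\<^sup>2"
  by (simp add: dist_sq_def peval_diff peval_const peval_sum peval_mult peval_var power2_norm_eq_inner inner_vec_def)

lemma pdiff_dist_sq: "pdiff j (dist_sq y) = 2 * (pvar j - pconst (y $ j))"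
proof -
  have "pdiff j (dist_sq y) = (\<Sum>l\<in>UNIV. if l = j then 2 * (pvar j - pconst (y $ j)) else 0)"
    unfolding dist_sq_def pdiff_sum by (rule sum.cong) (auto simp: pdiff_mult pdiff_diff pdiff_pvar)
  then show ?thesis by simp
qed

lemma lap_dist_sq: "lap (dist_sq (y :: real ^ 'n::finite)) = pconst (2 * real CARD('n))"
  by (simp add: lap_def pdiff_dist_sq pdiff_mult pdiff_diff pdiff_pvar pconst_mult pconst_of_nat pconst_numeral)

lemma lap_pconst [simp]: "lap (pconst c) = 0"
  by (simp add: lap_def)

lemma lap_square: "lap h = 0 \<Longrightarrow> lap (h * h) = 2 * (\<Sum>i\<in>UNIV. pdiff i h * pdiff i h)"
  by (simp add: lap_mult)

text \<open>
  Bernstein's method: with \<open>\<eta> = s\<^sup>2 - |x - y|\<^sup>2\<close> and \<open>\<mu> = (2n + 12) s\<^sup>2\<close> the function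
  \<open>\<eta>\<^sup>2 (\<partial>\<^sub>i h)\<^sup>2 + \<mu> h\<^sup>2\<close> is subharmonic on the ball.
\<close>

lemma harmonic_gradient_bound:
  fixes h :: "'n::finite mpoly"
  assumes h: "lap h = 0" and s: "s > 0" and A: "\<And>x. x \<in> cball y s \<Longrightarrow> \<bar>peval h x\<bar> \<le> A"
  shows "\<bar>peval (pdiff i h) y\<bar> \<le> (real CARD('n) + 6) * A / s"
proof -
  define n where "n = real CARD('n)"
  define \<mu> where "\<mu> = (2 * n + 12) * s\<^sup>2"
  define \<eta> where "\<eta> = pconst (s\<^sup>2) - dist_sq y"
  define g where "g = pdiff i h"
  define F where "F = \<eta> * \<eta> * (g * g) + pconst \<mu> * (h * h) - pconst (\<mu> * A\<^sup>2)"
  have n: "n \<ge> 1" by (simp add: n_def Suc_leI)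
  have \<eta>: "peval \<eta> x = s\<^sup>2 - (norm (x - y))\<^sup>2" for x
    by (simp add: \<eta>_def peval_diff peval_const peval_dist_sq)
  have d\<eta>: "pdiff j \<eta> = - 2 * (pvar j - pconst (y $ j))" for j
    by (simp add: \<eta>_def pdiff_diff pdiff_dist_sq)
  have l\<eta>: "lap \<eta> = pconst (- 2 * n)"
    by (rule peval_inject) (simp add: \<eta>_def lap_diff lap_dist_sq n_def peval_uminus peval_const)
  have lg: "lap g = 0" by (simp add: g_def lap_pdiff h)
  have sub: "0 \<le> peval (lap F) x" if "x \<in> ball y s" for x
  proof -
    define e where "e = peval \<eta> x"
    define G where "G = peval g x"
    define ej where "ej j = peval (pdiff j \<eta>) x" for j
    define gj where "gj j = peval (pdiff j g) x" for j
    define hj where "hj j = peval (pdiff j h) x" for j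
    have lF: "lap F = lap (\<eta> * \<eta>) * (g * g) + 2 * (\<Sum>j\<in>UNIV. pdiff j (\<eta> * \<eta>) * pdiff j (g * g)) +
        \<eta> * \<eta> * lap (g * g) + pconst \<mu> * lap (h * h)"
      unfolding F_def lap_diff lap_add lap_pconst_mult lap_pconst lap_mult[of "\<eta> * \<eta>" "g * g"] by simp
    have "peval (lap F) x = (2 * e * (- 2 * n) + 2 * (\<Sum>j\<in>UNIV. (ej j)\<^sup>2)) * G\<^sup>2
        + 2 * (\<Sum>j\<in>UNIV. (2 * e * ej j) * (2 * G * gj j)) + e\<^sup>2 * (2 * (\<Sum>j\<in>UNIV. (gj j)\<^sup>2)) + \<mu> * (2 * (\<Sum>j\<in>UNIV. (hj j)\<^sup>2))"
      unfolding lF lap_square[OF lg] lap_square[OF h] lap_mult[of \<eta> \<eta>] l\<eta> pdiff_mult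
      by (simp add: peval_add peval_mult peval_sum peval_const power2_eq_square
          e_def G_def ej_def gj_def hj_def algebra_simps sum_distrib_left)
    \<comment> \<open>Completing the square absorbs the mixed terms: 2 (e gj + 2 G ej)^2 contains an
      extra 8 G^2 ej^2, which turns the coefficient 2 into -6.\<close>
    also have "\<dots> = (2 * e * (- 2 * n) - 6 * (\<Sum>j\<in>UNIV. (ej j)\<^sup>2)) * G\<^sup>2
        + 2 * (\<Sum>j\<in>UNIV. (e * gj j + 2 * G * ej j)\<^sup>2) + 2 * \<mu> * (\<Sum>j\<in>UNIV. (hj j)\<^sup>2)"
      by (simp add: power2_eq_square algebra_simps sum_distrib_left sum.distrib)
         (auto simp: sum.distrib[symmetric] intro: sum.cong)
    also have "\<dots> \<ge> (2 * e * (- 2 * n) - 6 * (\<Sum>j\<in>UNIV. (ej j)\<^sup>2)) * G\<^sup>2 + 2 * \<mu> * G\<^sup>2"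
    proof -
      have "G\<^sup>2 \<le> (\<Sum>j\<in>UNIV. (hj j)\<^sup>2)"
        using member_le_sum[of i UNIV "\<lambda>j. (hj j)\<^sup>2"] by (simp add: G_def g_def hj_def)
      moreover have "\<mu> \<ge> 0" using n by (simp add: \<mu>_def)
      ultimately have "2 * \<mu> * G\<^sup>2 \<le> 2 * \<mu> * (\<Sum>j\<in>UNIV. (hj j)\<^sup>2)" by (intro mult_left_mono) auto
      moreover have "0 \<le> (\<Sum>j\<in>UNIV. (e * gj j + 2 * G * ej j)\<^sup>2)" by (intro sum_nonneg) auto
      ultimately show ?thesis by linarith
    qed
    \<comment> \<open>This fixes \<mu>: as e \<le> s^2 and the ej^2 sum to at most 4 s^2, one needs
      2\<mu> = 4n s^2 + 24 s^2.\<close>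
    moreover have "0 \<le> (2 * e * (- 2 * n) - 6 * (\<Sum>j\<in>UNIV. (ej j)\<^sup>2)) * G\<^sup>2 + 2 * \<mu> * G\<^sup>2"
    proof -
      have nn: "(norm (x - y))\<^sup>2 \<le> s\<^sup>2"
        using that s by (intro power_mono) (auto simp: dist_norm norm_minus_commute)
      have "(\<Sum>j\<in>UNIV. (ej j)\<^sup>2) = 4 * (norm (x - y))\<^sup>2"
        unfolding power2_norm_eq_inner inner_vec_def sum_distrib_left ej_def d\<eta>
        by (rule sum.cong) (auto simp: peval_mult peval_uminus peval_diff peval_var peval_const power2_eq_square algebra_simps)
      moreover have "n * e \<le> n * s\<^sup>2" using n by (intro mult_left_mono) (auto simp: e_def \<eta>)
      ultimately have "0 \<le> 2 * e * (- 2 * n) - 6 * (\<Sum>j\<in>UNIV. (ej j)\<^sup>2) + 2 * \<mu>"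
        using nn by (simp add: \<mu>_def algebra_simps)
      then have "0 \<le> (2 * e * (- 2 * n) - 6 * (\<Sum>j\<in>UNIV. (ej j)\<^sup>2) + 2 * \<mu>) * G\<^sup>2" by (intro mult_nonneg_nonneg) auto
      then show ?thesis by (simp add: algebra_simps)
    qed
    ultimately show ?thesis by linarith
  qed
  have A0: "A \<ge> 0" using A[of y] s by force
  have "peval F y \<le> 0"
  proof (rule maximum_principle[of "cball y s" "ball y s"])
    fix x assume x: "x \<in> cball y s" "x \<notin> ball y s"
    then have "norm (x - y) = s" by (auto simp: dist_norm norm_minus_commute)
    moreover have "(peval h x)\<^sup>2 \<le> A\<^sup>2" using A[OF x(1)] by (simp add: abs_le_square_iff[symmetric] A0)
    moreover have "\<mu> \<ge> 0" using n by (simp add: \<mu>_def)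
    ultimately show "peval F x \<le> 0"
      by (simp add: F_def peval_add peval_diff peval_mult peval_const \<eta> power2_eq_square mult_left_mono)
  qed (use s sub in auto)
  then have "s ^ 4 * (peval g y)\<^sup>2 \<le> \<mu> * A\<^sup>2 - \<mu> * (peval h y)\<^sup>2"
    by (simp add: F_def peval_add peval_diff peval_mult peval_const \<eta> power2_eq_square power4_eq_xxxx)
  also have "\<dots> \<le> \<mu> * A\<^sup>2" using n by (simp add: \<mu>_def)
  also have "\<dots> = s\<^sup>2 * ((2 * n + 12) * A\<^sup>2)" by (simp add: \<mu>_def)
  also have "\<dots> \<le> s\<^sup>2 * ((n + 6)\<^sup>2 * A\<^sup>2)"
    using n by (intro mult_left_mono mult_right_mono) (auto simp: power2_eq_square algebra_simps)
  finally have "s\<^sup>2 * (s * peval g y)\<^sup>2 \<le> s\<^sup>2 * ((n + 6) * A)\<^sup>2"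
    by (simp add: power_mult_distrib power2_eq_square power4_eq_xxxx mult_ac)
  then have "(s * peval g y)\<^sup>2 \<le> ((n + 6) * A)\<^sup>2" using s by simp
  then have "\<bar>s * peval g y\<bar> \<le> \<bar>(n + 6) * A\<bar>" by (simp only: abs_le_square_iff)
  then have "s * \<bar>peval g y\<bar> \<le> (n + 6) * A" using s n A0 by (simp add: abs_mult)
  then show ?thesis using s by (simp add: field_simps g_def n_def)
qed

lemma harmonic_gradient_bound_half:
  fixes h :: "'n::finite mpoly"
  assumes h: "lap h = 0" and \<rho>: "\<rho> > 0" and A: "\<And>x. norm x \<le> \<rho> \<Longrightarrow> \<bar>peval h x\<bar> \<le> A"
    and x: "norm x \<le> \<rho> / 2"
  shows "\<bar>peval (pdiff i h) x\<bar> \<le> 2 * (real CARD('n) + 6) * A / \<rho>"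
proof -
  have "\<bar>peval h z\<bar> \<le> A" if "z \<in> cball x (\<rho>/2)" for z
  proof (rule A)
    have "norm z \<le> norm x + dist x z" by (metis dist_norm norm_triangle_sub norm_minus_commute)
    then show "norm z \<le> \<rho>" using that x by simp
  qed
  then show ?thesis using harmonic_gradient_bound[OF h, of "\<rho>/2" x A i] \<rho> by (simp add: mult_ac)
qed

text \<open>Cauchy estimates. Each derivative is paid for with half of the radius, and returning
  from a coefficient of \<partial>_i h to one of h divides by an integer at least 1.\<close>

lemma harmonic_coefficient_bound:
  "\<exists>c>0. \<forall>(h :: 'n::finite mpoly) \<rho> A \<sigma>. lap h = 0 \<and> \<rho> > 0 \<and> (\<forall>x. norm x \<le> \<rho> \<longrightarrow> \<bar>peval h x\<bar> \<le> A)
     \<and> mdeg \<sigma> = d \<longrightarrow> \<bar>lookup h \<sigma>\<bar> \<le> c * A / \<rho> ^ d"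
proof (induction d)
  case 0
  show ?case
    by (intro exI[of _ 1]) (auto simp: mdeg_eq_0 lookup_0_eq_peval)
next
  case (Suc d)
  then obtain c where c: "c > 0" "\<And>(h :: 'n mpoly) \<rho> A \<sigma>. lap h = 0 \<Longrightarrow> \<rho> > 0 \<Longrightarrow>
      (\<And>x. norm x \<le> \<rho> \<Longrightarrow> \<bar>peval h x\<bar> \<le> A) \<Longrightarrow> mdeg \<sigma> = d \<Longrightarrow> \<bar>lookup h \<sigma>\<bar> \<le> c * A / \<rho> ^ d"
    by metis
  define n where "n = real CARD('n)"
  show ?case
  proof (intro exI[of _ "c * 2 ^ Suc d * (n + 6)"] conjI allI impI)
    show "c * 2 ^ Suc d * (n + 6) > 0" using c(1) by (simp add: n_def add_nonneg_pos)
    fix h :: "'n mpoly" and \<rho> A :: real and \<sigma> :: "'n \<Rightarrow>\<^sub>0 nat"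
    assume asm: "lap h = 0 \<and> \<rho> > 0 \<and> (\<forall>x. norm x \<le> \<rho> \<longrightarrow> \<bar>peval h x\<bar> \<le> A) \<and> mdeg \<sigma> = Suc d"
    then obtain i where "lookup \<sigma> i > 0"
      by (metis bot_nat_0.not_eq_extremum mdeg_def sum.neutral zero_less_Suc)
    then obtain \<tau> where \<tau>: "\<sigma> = \<tau> + expo i" by (rule expo_decompose)
    have "\<bar>lookup (pdiff i h) \<tau>\<bar> \<le> c * (2 * (n + 6) * A / \<rho>) / (\<rho>/2) ^ d"
      by (rule c(2)) (use asm harmonic_gradient_bound_half[of h \<rho> A _ i] in \<open>auto simp: lap_pdiff \<tau> mdeg_add n_def\<close>)
    also have "\<dots> = c * 2 ^ Suc d * (n + 6) * A / \<rho> ^ Suc d"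
      by (simp add: power_divide)
    finally have 1: "\<bar>lookup (pdiff i h) \<tau>\<bar> \<le> c * 2 ^ Suc d * (n + 6) * A / \<rho> ^ Suc d" .
    have "\<bar>lookup h \<sigma>\<bar> \<le> \<bar>lookup (pdiff i h) \<tau>\<bar>"
      by (simp add: lookup_pdiff \<tau> abs_mult mult_le_cancel_right1)
    with 1 show "\<bar>lookup h \<sigma>\<bar> \<le> c * 2 ^ Suc d * (n + 6) * A / \<rho> ^ Suc d" by linarith
  qed
qed

abbreviation trunc_lt :: "nat \<Rightarrow> 'n::finite mpoly \<Rightarrow> 'n mpoly" where
  "trunc_lt m \<equiv> pfilter (\<lambda>\<sigma>. mdeg \<sigma> < m)"

text \<open>The derivatives of a Taylor remainder are the remainders, of one order less, of the
  derivatives; the mean value theorem on the segment from 0 to x then gives one more power of |x|.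
  Each order halves the admissible radius.\<close>

lemma harmonic_taylor_remainder:
  "\<exists>C>0. \<forall>(h :: 'n::finite mpoly) \<rho> A x. lap h = 0 \<and> \<rho> > 0 \<and> (\<forall>x. norm x \<le> \<rho> \<longrightarrow> \<bar>peval h x\<bar> \<le> A)
     \<and> norm x \<le> \<rho> / 2 ^ m \<longrightarrow> \<bar>peval (h - trunc_lt m h) x\<bar> \<le> C * A * (norm x / \<rho>) ^ m"
proof (induction m)
  case 0
  have "trunc_lt 0 h = 0" for h :: "'n mpoly" by (rule poly_mapping_eqI) (simp add: lookup_pfilter)
  then show ?case by (intro exI[of _ 1]) auto
next
  case (Suc m)
  then obtain C where C: "C > 0" "\<And>(h :: 'n mpoly) \<rho> A x. lap h = 0 \<Longrightarrow> \<rho> > 0 \<Longrightarrow>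
      (\<And>x. norm x \<le> \<rho> \<Longrightarrow> \<bar>peval h x\<bar> \<le> A) \<Longrightarrow> norm x \<le> \<rho> / 2 ^ m \<Longrightarrow>
      \<bar>peval (h - trunc_lt m h) x\<bar> \<le> C * A * (norm x / \<rho>) ^ m"
    by metis
  define n where "n = real CARD('n)"
  have n: "n \<ge> 1" by (simp add: n_def Suc_leI)
  show ?case
  proof (intro exI[of _ "n * C * 2 ^ Suc m * (n + 6)"] conjI allI impI)
    show "n * C * 2 ^ Suc m * (n + 6) > 0" using C(1) n by simp
    fix h :: "'n mpoly" and \<rho> A :: real and x :: "real ^ 'n"
    assume asm: "lap h = 0 \<and> \<rho> > 0 \<and> (\<forall>x. norm x \<le> \<rho> \<longrightarrow> \<bar>peval h x\<bar> \<le> A) \<and> norm x \<le> \<rho> / 2 ^ Suc m"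
    then have A0: "A \<ge> 0" using norm_ge_zero[of "0 :: real ^ 'n"] by (metis abs_ge_zero norm_zero order_less_imp_le order_trans)
    define R where "R = h - trunc_lt (Suc m) h"
    have dR: "pdiff i R = pdiff i h - trunc_lt m (pdiff i h)" for i
      by (rule poly_mapping_eqI) (simp add: R_def lookup_pdiff lookup_minus lookup_pfilter mdeg_add)
    have bd: "\<bar>peval (pdiff i R) (z *\<^sub>R x)\<bar> \<le> C * (2 * (n + 6) * A / \<rho>) * (norm x / (\<rho>/2)) ^ m" if "0 < z" "z < 1" for z i
    proof -
      have zx: "norm (z *\<^sub>R x) \<le> norm x" using that by (simp add: mult_left_le_one_le)
      have "norm (z *\<^sub>R x) \<le> \<rho> / 2 / 2 ^ m" using zx asm by simp
      then have "\<bar>peval (pdiff i R) (z *\<^sub>R x)\<bar> \<le> C * (2 * (n + 6) * A / \<rho>) * (norm (z *\<^sub>R x) / (\<rho>/2)) ^ m"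
        unfolding dR by (intro C(2)) (use asm harmonic_gradient_bound_half[of h \<rho> A _ i] in \<open>auto simp: lap_pdiff n_def\<close>)
      also have "\<dots> \<le> C * (2 * (n + 6) * A / \<rho>) * (norm x / (\<rho>/2)) ^ m"
        using zx asm C(1) n A0 by (intro mult_left_mono power_mono divide_right_mono) auto
      finally show ?thesis .
    qed
    obtain z where z: "0 < z" "z < (1::real)" "peval R (0 + 1 *\<^sub>R x) - peval R (0 + 0 *\<^sub>R x) =
        (1 - 0) * (\<Sum>i\<in>UNIV. peval (pdiff i R) (0 + z *\<^sub>R x) * x $ i)"
      using MVT2[OF zero_less_one peval_DERIV_line[of R 0 x]] by blast
    have "peval R 0 = 0" by (simp add: R_def lookup_minus lookup_pfilter flip: lookup_0_eq_peval)
    with z have "\<bar>peval R x\<bar> = \<bar>\<Sum>i\<in>UNIV. peval (pdiff i R) (z *\<^sub>R x) * x $ i\<bar>" by simp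
    also have "\<dots> \<le> (\<Sum>i\<in>UNIV. \<bar>peval (pdiff i R) (z *\<^sub>R x) * x $ i\<bar>)" by (rule sum_abs)
    also have "\<dots> \<le> (\<Sum>i\<in>(UNIV :: 'n set). C * (2 * (n + 6) * A / \<rho>) * (norm x / (\<rho>/2)) ^ m * norm x)"
    proof (rule sum_mono)
      fix i
      show "\<bar>peval (pdiff i R) (z *\<^sub>R x) * x $ i\<bar> \<le> C * (2 * (n + 6) * A / \<rho>) * (norm x / (\<rho>/2)) ^ m * norm x"
        unfolding abs_mult using bd[OF z(1,2), of i] component_le_norm_cart[of x i] C(1) n A0 asm
        by (intro mult_mono) auto
    qed
    also have "\<dots> = n * C * 2 ^ Suc m * (n + 6) * A * (norm x / \<rho>) ^ Suc m"
      by (simp add: n_def power_divide power_mult_distrib)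
    finally show "\<bar>peval (h - trunc_lt (Suc m) h) x\<bar> \<le> n * C * 2 ^ Suc m * (n + 6) * A * (norm x / \<rho>) ^ Suc m"
      unfolding R_def .
  qed
qed

section \<open>Size of polynomials\<close>

text \<open>Without the factorials of \<open>poly_norm\<close> the norm is submultiplicative
  (\<open>cnorm_mult\<close>), which suits substitution; in bounded degree the two norms are
  equivalent.\<close>

definition cnorm :: "'n::finite mpoly \<Rightarrow> real" where
  "cnorm P = (\<Sum>\<sigma>\<in>keys P. \<bar>lookup P \<sigma>\<bar>)"

lemma cnorm_nonneg: "0 \<le> cnorm P"
  by (simp add: cnorm_def sum_nonneg)

lemma lookup_le_cnorm: "\<bar>lookup P \<sigma>\<bar> \<le> cnorm P"
proof (cases "\<sigma> \<in> keys P")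
  case True
  then show ?thesis unfolding cnorm_def by (intro member_le_sum[of \<sigma> "keys P" "\<lambda>\<sigma>. \<bar>lookup P \<sigma>\<bar>"]) auto
qed (simp add: in_keys_iff cnorm_nonneg)

lemma cnorm_superset:
  assumes "finite S" "\<And>\<sigma>. lookup P \<sigma> \<noteq> 0 \<Longrightarrow> \<sigma> \<in> S"
  shows "cnorm P = (\<Sum>\<sigma>\<in>S. \<bar>lookup P \<sigma>\<bar>)"
  unfolding cnorm_def using assms by (intro sum.mono_neutral_left) (auto simp: in_keys_iff)

lemma abs_mon_le: "\<bar>mon \<sigma> x\<bar> \<le> norm x ^ mdeg \<sigma>"
proof -
  have "\<bar>mon \<sigma> x\<bar> = (\<Prod>i\<in>UNIV. \<bar>x $ i\<bar> ^ lookup \<sigma> i)"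
    by (simp add: mon_def abs_prod power_abs)
  also have "\<dots> \<le> (\<Prod>i\<in>UNIV. norm x ^ lookup \<sigma> i)"
    by (intro prod_mono conjI power_mono) (auto simp: component_le_norm_cart)
  also have "\<dots> = norm x ^ mdeg \<sigma>" by (simp add: mdeg_def power_sum)
  finally show ?thesis .
qed

lemma peval_le_cnorm:
  assumes "low_order d P" "norm x \<le> 1"
  shows "\<bar>peval P x\<bar> \<le> cnorm P * norm x ^ d"
proof -
  have "\<bar>peval P x\<bar> \<le> (\<Sum>\<sigma>\<in>keys P. \<bar>lookup P \<sigma>\<bar> * norm x ^ d)"
    unfolding peval_def
  proof (rule order_trans[OF sum_abs sum_mono])
    fix \<sigma> assume "\<sigma> \<in> keys P"
    then have "d \<le> mdeg \<sigma>" using assms(1) by (simp add: low_order_def in_keys_iff)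
    then have "\<bar>mon \<sigma> x\<bar> \<le> norm x ^ d"
      using abs_mon_le[of \<sigma> x] power_decreasing[of d "mdeg \<sigma>" "norm x"] assms(2) by simp
    then show "\<bar>lookup P \<sigma> * mon \<sigma> x\<bar> \<le> \<bar>lookup P \<sigma>\<bar> * norm x ^ d"
      by (simp add: abs_mult mult_left_mono)
  qed
  then show ?thesis by (simp add: cnorm_def sum_distrib_right)
qed

lemma cnorm_add: "cnorm (P + Q) \<le> cnorm P + cnorm Q"
proof -
  let ?S = "keys P \<union> keys Q"
  have "cnorm (P + Q) = (\<Sum>\<sigma>\<in>?S. \<bar>lookup (P + Q) \<sigma>\<bar>)"
    by (rule cnorm_superset) (auto simp: lookup_add in_keys_iff)
  also have "\<dots> \<le> (\<Sum>\<sigma>\<in>?S. \<bar>lookup P \<sigma>\<bar> + \<bar>lookup Q \<sigma>\<bar>)"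
    by (intro sum_mono) (simp add: lookup_add abs_triangle_ineq)
  also have "\<dots> = cnorm P + cnorm Q"
    using cnorm_superset[of ?S P] cnorm_superset[of ?S Q] by (simp add: sum.distrib in_keys_iff)
  finally show ?thesis .
qed

lemma cnorm_uminus: "cnorm (- P) = cnorm P"
  by (simp add: cnorm_def)

lemma cnorm_diff: "cnorm (P - Q) \<le> cnorm P + cnorm Q"
  using cnorm_add[of P "-Q"] by (simp add: cnorm_uminus)

lemma cnorm_0 [simp]: "cnorm 0 = 0" by (simp add: cnorm_def)

lemma cnorm_sum: "cnorm (sum F A) \<le> (\<Sum>a\<in>A. cnorm (F a))"
proof (induction A rule: infinite_finite_induct)
  case (insert a A)
  then show ?case using cnorm_add[of "F a" "sum F A"] by simp
qed auto

lemma cnorm_single: "cnorm (Poly_Mapping.single \<sigma> c) = \<bar>c\<bar>"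
  by (subst cnorm_superset[of "{\<sigma>}"]) (auto simp: lookup_single when_def split: if_splits)

lemma cnorm_pfilter: "cnorm (pfilter S P) \<le> cnorm P"
proof -
  have "cnorm (pfilter S P) = (\<Sum>\<sigma>\<in>keys P. \<bar>lookup (pfilter S P) \<sigma>\<bar>)"
    by (rule cnorm_superset) (auto simp: lookup_pfilter in_keys_iff split: if_splits)
  also have "\<dots> \<le> cnorm P" unfolding cnorm_def by (intro sum_mono) (simp add: lookup_pfilter)
  finally show ?thesis .
qed

lemma cnorm_mult: "cnorm (P * Q) \<le> cnorm P * cnorm Q"
proof -
  have "P * Q = (\<Sum>i\<in>keys P. \<Sum>j\<in>keys Q. Poly_Mapping.single (i+j) (lookup P i * lookup Q j))"
    by (subst (1) mpoly_expand[of P, symmetric], subst (1) mpoly_expand[of Q, symmetric])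
       (simp add: sum_product mult_single)
  then have "cnorm (P * Q) \<le> (\<Sum>i\<in>keys P. \<Sum>j\<in>keys Q. \<bar>lookup P i * lookup Q j\<bar>)"
    by (auto intro!: order_trans[OF cnorm_sum] sum_mono simp: cnorm_single)
  also have "\<dots> = cnorm P * cnorm Q" by (simp add: cnorm_def sum_product abs_mult)
  finally show ?thesis .
qed

lemma cnorm_power: "cnorm (P ^ m) \<le> cnorm P ^ m"
proof (induction m)
  case 0
  show ?case using cnorm_single[of "0 :: 'a \<Rightarrow>\<^sub>0 nat" 1] by simp
next
  case (Suc m)
  then show ?case using cnorm_mult[of P "P ^ m"] mult_left_mono[OF Suc cnorm_nonneg[of P]] by simp
qed

section \<open>Polynomials that are odd in one variable\<close>

text \<open>Oddness forces the value 0 on x_N = 0, the flat model of the boundary. As a condition on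
  coefficients it is inherited by limits.\<close>

definition odd_in :: "'n \<Rightarrow> 'n::finite mpoly \<Rightarrow> bool" where
  "odd_in N P \<longleftrightarrow> (\<forall>\<sigma>. lookup P \<sigma> \<noteq> 0 \<longrightarrow> odd (lookup \<sigma> N))"

definition reflect :: "'n \<Rightarrow> real ^ 'n \<Rightarrow> real ^ 'n" where
  "reflect N x = (\<chi> i. if i = N then - (x $ i) else x $ i)"

lemma reflect_reflect [simp]: "reflect N (reflect N x) = x"
  by (simp add: reflect_def vec_eq_iff)

lemma reflect_nth [simp]: "reflect N x $ N = - (x $ N)"
  by (simp add: reflect_def)

lemma norm_reflect [simp]: "norm (reflect N x) = norm x"
proof -
  have "(norm (reflect N x))\<^sup>2 = (norm x)\<^sup>2"
    unfolding power2_norm_eq_inner inner_vec_def by (rule sum.cong) (auto simp: reflect_def)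
  then show ?thesis by simp
qed

lemma continuous_on_reflect: "continuous_on A (reflect N)"
proof -
  have "continuous_on A (\<lambda>x. if i = N then - (x $ i) else x $ i)" for i
    by (cases "i = N") (auto intro!: continuous_intros)
  then show ?thesis unfolding reflect_def by (rule continuous_on_vec_lambda)
qed

lemma mon_reflect: "mon \<sigma> (reflect N x) = (-1) ^ lookup \<sigma> N * mon \<sigma> x"
proof -
  have "mon \<sigma> (reflect N x) = (\<Prod>i\<in>UNIV. (if i = N then (-1) ^ lookup \<sigma> i else 1) * (x $ i) ^ lookup \<sigma> i)"
    unfolding mon_def by (rule prod.cong) (auto simp: reflect_def power_minus[of "x $ N"])
  then show ?thesis by (simp add: prod.distrib mon_def)
qed

lemma peval_reflect_odd: "odd_in N P \<Longrightarrow> peval P (reflect N x) = - peval P x"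
  unfolding peval_def by (auto simp: mon_reflect odd_in_def in_keys_iff sum_negf[symmetric] intro!: sum.cong)

lemma peval_odd_eq_0: "odd_in N P \<Longrightarrow> x $ N = 0 \<Longrightarrow> peval P x = 0"
proof -
  assume P: "odd_in N P" and x: "x $ N = 0"
  have "reflect N x = x" using x by (auto simp: reflect_def vec_eq_iff)
  then show ?thesis using peval_reflect_odd[OF P, of x] by simp
qed

definition odd_part :: "'n \<Rightarrow> 'n::finite mpoly \<Rightarrow> 'n mpoly" where
  "odd_part N = pfilter (\<lambda>\<sigma>. odd (lookup \<sigma> N))"

lemma odd_in_odd_part: "odd_in N (odd_part N P)"
  by (simp add: odd_in_def odd_part_def lookup_pfilter)

lemma odd_in_diff: "odd_in N P \<Longrightarrow> odd_in N Q \<Longrightarrow> odd_in N (P - Q)"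
  unfolding odd_in_def by (metis diff_0_right lookup_minus)

lemma odd_in_add: "odd_in N P \<Longrightarrow> odd_in N Q \<Longrightarrow> odd_in N (P + Q)"
  unfolding odd_in_def by (metis add_0 lookup_add)

lemma peval_odd_part: "peval (odd_part N P) x = (peval P x - peval P (reflect N x)) / 2"
proof -
  have "peval (odd_part N P) x = (\<Sum>\<sigma>\<in>keys P. lookup (odd_part N P) \<sigma> * mon \<sigma> x)"
    by (rule peval_superset) (auto simp: odd_part_def lookup_pfilter in_keys_iff split: if_splits)
  also have "\<dots> = (\<Sum>\<sigma>\<in>keys P. (lookup P \<sigma> * mon \<sigma> x - lookup P \<sigma> * mon \<sigma> (reflect N x)) / 2)"
    by (rule sum.cong) (auto simp: odd_part_def lookup_pfilter mon_reflect)
  finally show ?thesis by (simp add: peval_def sum_subtractf sum_divide_distrib[symmetric])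
qed

lemma lookup_lap: "lookup (lap P) \<sigma> =
    (\<Sum>i\<in>UNIV. (real (lookup \<sigma> i) + 1) * (real (lookup \<sigma> i) + 2) * lookup P (\<sigma> + expo i + expo i))"
  unfolding lap_def lookup_sum by (rule sum.cong) (auto simp: lookup_pdiff lookup_add)

text \<open>\<Delta> changes the exponent of x_N by an even number.\<close>

lemma lap_odd_part: "lap (odd_part N P) = odd_part N (lap P)"
proof (rule poly_mapping_eqI)
  fix \<sigma>
  have "odd (lookup (\<sigma> + expo i + expo i) N) = odd (lookup \<sigma> N)" for i
    by (auto simp: lookup_add lookup_single when_def)
  then show "lookup (lap (odd_part N P)) \<sigma> = lookup (odd_part N (lap P)) \<sigma>"
    by (simp add: lookup_lap odd_part_def lookup_pfilter)
qed

section \<open>Comparison of viscosity solutions with polynomials\<close>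

text \<open>A maximum of u - P - b inside G would make P + b a test function from above,
  contradicting the strict inequality \<open>int\<close>; likewise for a minimum of u - P + b. So
  both extrema over K lie outside G, where \<open>bdry\<close> applies.\<close>

lemma viscosity_comparison:
  assumes sub: "viscosity_subsolution U f u" and super: "viscosity_supersolution U f u"
    and G: "open G" "G \<subseteq> U" "G \<subseteq> K" and K: "compact K" and cont: "continuous_on K u"
    and int: "\<And>x. x \<in> G \<Longrightarrow> \<bar>f x - peval (lap P) x\<bar> < - peval (lap b) x"
    and bdry: "\<And>x. x \<in> K \<Longrightarrow> x \<notin> G \<Longrightarrow> \<bar>u x - peval P x\<bar> \<le> peval b x"
    and x: "x \<in> K"
  shows "\<bar>u x - peval P x\<bar> \<le> peval b x"
proof -
  have "u x - peval (P + b) x \<le> 0"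
  proof -
    have "continuous_on K (\<lambda>x. u x - peval (P + b) x)" by (intro continuous_intros cont)
    then obtain z where z: "z \<in> K" "\<And>y. y \<in> K \<Longrightarrow> u y - peval (P + b) y \<le> u z - peval (P + b) z"
      using continuous_attains_sup[OF K] x by blast
    have "z \<notin> G"
    proof
      assume "z \<in> G"
      then have "f z \<le> laplacian (peval (P + b)) z"
        by (intro sub[unfolded viscosity_subsolution_def, rule_format, of G] conjI ballI C2_on_peval)
           (use G z(2) in auto)
      then show False using int[OF \<open>z \<in> G\<close>] by (simp add: laplacian_peval lap_add peval_add)
    qed
    then have "u z - peval (P + b) z \<le> 0" using bdry[OF z(1)] by (simp add: peval_add)
    then show ?thesis using z(2)[OF x] by simp
  qed
  moreover have "0 \<le> u x - peval (P - b) x"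
  proof -
    have "continuous_on K (\<lambda>x. u x - peval (P - b) x)" by (intro continuous_intros cont)
    then obtain z where z: "z \<in> K" "\<And>y. y \<in> K \<Longrightarrow> u z - peval (P - b) z \<le> u y - peval (P - b) y"
      using continuous_attains_inf[OF K] x by blast
    have "z \<notin> G"
    proof
      assume "z \<in> G"
      then have "laplacian (peval (P - b)) z \<le> f z"
        by (intro super[unfolded viscosity_supersolution_def, rule_format, of G] conjI ballI C2_on_peval)
           (use G z(2) in auto)
      then show False using int[OF \<open>z \<in> G\<close>] by (simp add: laplacian_peval lap_diff peval_diff)
    qed
    then have "0 \<le> u z - peval (P - b) z" using bdry[OF z(1)] by (simp add: peval_diff)
    then show ?thesis using z(2)[OF x] by simp
  qed
  ultimately show ?thesis by (simp add: peval_add peval_diff)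
qed

text \<open>Makes Stone-Weierstrass approximants available as formal polynomials.\<close>

lemma real_polynomial_function_peval:
  "real_polynomial_function g \<Longrightarrow> \<exists>P :: 'n::finite mpoly. g = peval P"
proof (induction rule: real_polynomial_function.induct)
  case (linear f)
  interpret bounded_linear f by (rule linear)
  have "f x = peval (\<Sum>i\<in>UNIV. pconst (f (axis i 1)) * pvar i) x" for x
  proof -
    have "f x = f (\<Sum>i\<in>UNIV. (x $ i) *\<^sub>R axis i 1)"
      using basis_expansion[of x] by (simp add: scalar_mult_eq_scaleR)
    then show ?thesis by (simp add: sum scaleR peval_sum peval_mult peval_const peval_var mult.commute)
  qed
  then show ?case by blast
next
  case (const c)
  show ?case by (rule exI[of _ "pconst c"]) (simp add: fun_eq_iff peval_const)
next
  case (add f g)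
  then obtain P Q :: "'n mpoly" where "f = peval P" "g = peval Q" by blast
  then show ?case by (intro exI[of _ "P + Q"]) (simp add: fun_eq_iff peval_add)
next
  case (mult f g)
  then obtain P Q :: "'n mpoly" where "f = peval P" "g = peval Q" by blast
  then show ?case by (intro exI[of _ "P * Q"]) (simp add: fun_eq_iff peval_mult)
qed

text \<open>Localised to an open V, since bounds are known only within a ball.\<close>

lemma bound_extends_to_closure:
  fixes u :: "'a::metric_space \<Rightarrow> real"
  assumes cont: "continuous_on (closure \<Omega> \<inter> V) u" and "open V" "x \<in> closure \<Omega>" "x \<in> V"
    and bd: "\<And>y. y \<in> \<Omega> \<inter> V \<Longrightarrow> u y \<le> B"
  shows "u x \<le> B"
proof -
  have "x \<in> closure (\<Omega> \<inter> V)"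
    using open_Int_closure_subset[OF \<open>open V\<close>, of \<Omega>] assms by (auto simp: Int_commute)
  then obtain s where s: "\<And>n. s n \<in> \<Omega> \<inter> V" "s \<longlonglongrightarrow> x" by (auto simp: closure_sequential)
  have "(\<lambda>n. u (s n)) \<longlonglongrightarrow> u x"
    using cont[unfolded continuous_on_sequentially, rule_format, of x s] s assms closure_subset
    by (auto simp: o_def)
  then show ?thesis by (rule LIMSEQ_le_const2) (use bd s in auto)
qed

section \<open>Approximation by odd harmonic polynomials at a fixed scale\<close>

lemma lap_pvar [simp]: "lap (pvar i) = 0"
  by (auto simp: lap_def pdiff_pvar intro!: sum.neutral)

lemma lap_pvar_shift_square: "lap ((pvar N - pconst c) * (pvar N - pconst c)) = pconst 2"
proof -
  have "(\<Sum>i\<in>UNIV. pdiff i (pvar N - pconst c) * pdiff i (pvar N - pconst c)) = (\<Sum>i\<in>UNIV. if i = N then 1 else 0)"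
    by (rule sum.cong) (auto simp: pdiff_diff pdiff_pvar)
  then have "(\<Sum>i\<in>UNIV. pdiff i (pvar N - pconst c) * pdiff i (pvar N - pconst c)) = 1" by simp
  then show ?thesis unfolding lap_mult by (simp add: lap_diff pconst_numeral)
qed

text \<open>A continuous cut-off: it kills values of modulus at most \<tau> and moves the others by
  \<tau> towards 0. It allows boundary data to be glued continuously to 0.\<close>

definition soft_threshold :: "real \<Rightarrow> real \<Rightarrow> real" where
  "soft_threshold \<tau> s = s - max (- \<tau>) (min \<tau> s)"

lemma soft_threshold_le: "0 \<le> \<tau> \<Longrightarrow> \<bar>soft_threshold \<tau> s\<bar> \<le> \<bar>s\<bar>"
  and soft_threshold_diff: "0 \<le> \<tau> \<Longrightarrow> \<bar>s - soft_threshold \<tau> s\<bar> \<le> \<tau>"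
  by (auto simp: soft_threshold_def)

lemma maximum_principle_abs:
  assumes "compact K" "open G" "G \<subseteq> K" "lap h = 0" "lap b = 0"
    and "\<And>x. x \<in> K \<Longrightarrow> x \<notin> G \<Longrightarrow> \<bar>peval h x\<bar> \<le> peval b x" and "x \<in> K"
  shows "\<bar>peval h x\<bar> \<le> peval b x"
  using maximum_principle[of K G "h - b" x] maximum_principle[of K G "- h - b" x] assms
  by (fastforce simp: lap_diff lap_uminus peval_diff peval_uminus abs_le_iff)

text \<open>Boundary values are kept out of the locale; each lemma bounds u - P on the part of the
  frontier that it sees.\<close>

locale viscosity_problem =
  fixes \<Omega> :: "(real ^ 'n::finite) set" and f u :: "real ^ 'n \<Rightarrow> real" and N :: 'n and n :: real
  assumes n_def: "n = real CARD('n)" and open_\<Omega>: "open \<Omega>"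
    and sub: "viscosity_subsolution (\<Omega> \<inter> ball 0 1) f u"
    and super: "viscosity_supersolution (\<Omega> \<inter> ball 0 1) f u"
    and cont: "continuous_on (closure \<Omega> \<inter> ball 0 1) u"
begin

lemma n_ge_1: "n \<ge> 1" by (simp add: n_def Suc_leI)

lemma closure_lower_bound:
  assumes "\<And>x. x \<in> \<Omega> \<Longrightarrow> norm x < r \<Longrightarrow> - \<delta> \<le> x $ N" "x \<in> closure \<Omega>" "norm x < r"
  shows "- \<delta> \<le> x $ N"
  using bound_extends_to_closure[of \<Omega> "ball 0 r" "\<lambda>x. - (x $ N)" x \<delta>] assms
  by (fastforce intro!: continuous_intros)

lemma closure_bound:
  assumes "r \<le> 1" "\<And>x. x \<in> \<Omega> \<Longrightarrow> norm x < r \<Longrightarrow> \<bar>u x - peval P x\<bar> \<le> A" "x \<in> closure \<Omega>" "norm x < r"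
  shows "\<bar>u x - peval P x\<bar> \<le> A"
proof (rule bound_extends_to_closure[of \<Omega> "ball 0 r" "\<lambda>x. \<bar>u x - peval P x\<bar>" x])
  show "continuous_on (closure \<Omega> \<inter> ball 0 r) (\<lambda>x. \<bar>u x - peval P x\<bar>)"
    by (intro continuous_intros continuous_on_subset[OF cont]) (use \<open>r \<le> 1\<close> in auto)
qed (use assms in auto)

text \<open>
  The barrier is \<open>A (16 (|z - y|\<^sup>2 - n t\<^sup>2) / r\<^sup>2 + 4 n t / r)\<close>, where \<open>t = z\<^sub>N + \<delta>\<close> and \<open>y\<close> is the
  projection of \<open>x\<close> to the plane \<open>t = 0\<close>. It is harmonic, nonnegative for \<open>0 \<le> t \<le> r/4\<close> and at
  least \<open>A\<close> on the sphere \<open>|z - y| = r/4\<close>.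
\<close>

lemma boundary_growth:
  assumes r: "0 < r" "r \<le> 1" and \<delta>: "0 \<le> \<delta>" "\<delta> \<le> r / 8" and \<epsilon>: "\<epsilon> > 0"
    and lower: "\<And>x. x \<in> \<Omega> \<Longrightarrow> norm x < r \<Longrightarrow> - \<delta> \<le> x $ N"
    and A: "\<And>x. x \<in> \<Omega> \<Longrightarrow> norm x < r \<Longrightarrow> \<bar>u x - peval P x\<bar> \<le> A"
    and bdry: "\<And>x. x \<in> frontier \<Omega> \<Longrightarrow> norm x < r \<Longrightarrow> \<bar>u x - peval P x\<bar> \<le> \<epsilon>"
    and rhs: "\<And>x. x \<in> \<Omega> \<Longrightarrow> norm x < r \<Longrightarrow> \<bar>f x - peval (lap P) x\<bar> \<le> \<epsilon> / r\<^sup>2"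
    and x: "x \<in> closure \<Omega>" "norm x \<le> r / 2"
  shows "\<bar>u x - peval P x\<bar> \<le> 4 * n * A / r * (x $ N + \<delta>) + 2 * \<epsilon>"
proof -
  define t where "t = x $ N + \<delta>"
  have xr: "norm x < r" using x r by simp
  have t0: "0 \<le> t" using closure_lower_bound[OF lower x(1) xr] by (simp add: t_def)
  have ux: "\<bar>u x - peval P x\<bar> \<le> A" by (rule closure_bound[OF r(2) A x(1) xr])
  then have A0: "0 \<le> A" by linarith
  show ?thesis
  proof (cases "t \<le> r / 4")
    \<comment> \<open>Here the linear term alone exceeds A, because n \<ge> 1.\<close>
    case False
    have "A * 1 \<le> A * (n * (4 * t / r))"
    proof (rule mult_left_mono[OF _ A0])
      have "1 \<le> 4 * t / r" using False r by (simp add: field_simps)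
      then show "1 \<le> n * (4 * t / r)" using n_ge_1 mult_mono[of 1 n 1 "4 * t / r"] by simp
    qed
    then show ?thesis using ux \<epsilon> by (simp add: t_def mult_ac)
  next
    case True
    define y where "y = x - t *\<^sub>R axis N 1"
    have yN: "y $ N = - \<delta>" by (simp add: y_def t_def)
    have "norm y \<le> norm (x - (x $ N) *\<^sub>R axis N 1) + norm (\<delta> *\<^sub>R axis N (1::real))"
      unfolding y_def t_def by (rule order_trans[OF _ norm_triangle_ineq4]) (simp add: algebra_simps)
    also have "norm (x - (x $ N) *\<^sub>R axis N 1) \<le> norm x"
      by (rule norm_le_componentwise_cart) (simp add: axis_def)
    \<comment> \<open>Together with the radius r/4 of the ball around y this stays within
      7r/8.\<close>
    finally have ny: "norm y \<le> r / 2 + r / 8" using x(2) \<delta> by (simp add: norm_axis_1)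
    have inside: "norm z < r" if "z \<in> cball y (r / 4)" for z
    proof -
      have "norm z \<le> norm y + dist y z" by (metis dist_norm norm_triangle_sub norm_minus_commute)
      then show ?thesis using that ny r by simp
    qed
    have inside_ball: "norm z < 1" if "dist y z \<le> r / 4" for z
      using inside[of z] that r by simp
    \<comment> \<open>The last two terms are added to the harmonic barrier: they contribute -2n
      \<epsilon>/r^2 to the Laplacian, which strictly beats the right-hand side, and lie between
      \<epsilon> and 2 \<epsilon> for |z| < r.\<close>
    define b where "b = pconst (16 * A / r\<^sup>2) * (dist_sq y - pconst n * ((pvar N - pconst (- \<delta>)) * (pvar N - pconst (- \<delta>))))
      + pconst (4 * n * A / r) * (pvar N - pconst (- \<delta>)) + pconst (2 * \<epsilon>) - pconst (\<epsilon> / r\<^sup>2) * rsq"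
    have b: "peval b z = 16 * A / r\<^sup>2 * ((norm (z - y))\<^sup>2 - n * (z $ N + \<delta>)\<^sup>2) + 4 * n * A / r * (z $ N + \<delta>)
        + 2 * \<epsilon> - \<epsilon> / r\<^sup>2 * (norm z)\<^sup>2" for z
      by (simp add: b_def peval_add peval_diff peval_mult peval_const peval_var peval_dist_sq peval_rsq power2_eq_square)
    have lb: "peval (lap b) z = - (\<epsilon> / r\<^sup>2 * (2 * n))" for z
      unfolding b_def lap_add lap_diff lap_pconst_mult lap_dist_sq lap_rsq lap_pvar_shift_square
      by (simp add: peval_diff peval_add peval_mult peval_const n_def)
    have "\<bar>u x - peval P x\<bar> \<le> peval b x"
    proof (rule viscosity_comparison[OF sub super, of "\<Omega> \<inter> ball y (r / 4)" "closure \<Omega> \<inter> cball y (r / 4)"])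
      show "open (\<Omega> \<inter> ball y (r / 4))" using open_\<Omega> by auto
      show "\<Omega> \<inter> ball y (r / 4) \<subseteq> \<Omega> \<inter> ball 0 1" using inside_ball by auto
      show "\<Omega> \<inter> ball y (r / 4) \<subseteq> closure \<Omega> \<inter> cball y (r / 4)" using closure_subset by auto
      show "compact (closure \<Omega> \<inter> cball y (r / 4))" by (simp add: closed_Int_compact)
      show "continuous_on (closure \<Omega> \<inter> cball y (r / 4)) u"
        using inside_ball by (intro continuous_on_subset[OF cont]) auto
      show "x \<in> closure \<Omega> \<inter> cball y (r / 4)"
        using x(1) True t0 by (simp add: y_def dist_norm norm_axis_1)
    next
      fix z assume z: "z \<in> \<Omega> \<inter> ball y (r / 4)"
      then have "norm z < r" using inside by auto
      then have "\<bar>f z - peval (lap P) z\<bar> \<le> \<epsilon> / r\<^sup>2" using rhs z by auto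
      also have "\<dots> < \<epsilon> / r\<^sup>2 * (2 * n)" using \<epsilon> r n_ge_1 by (simp add: field_simps)
      finally show "\<bar>f z - peval (lap P) z\<bar> < - peval (lap b) z" by (simp add: lb)
    next
      fix z assume z: "z \<in> closure \<Omega> \<inter> cball y (r / 4)" and zG: "z \<notin> \<Omega> \<inter> ball y (r / 4)"
      have zr: "norm z < r" using z inside by auto
      define s where "s = z $ N + \<delta>"
      have s0: "0 \<le> s" using closure_lower_bound[OF lower _ zr] z by (simp add: s_def)
      have sy: "s \<le> norm (z - y)" using component_le_norm_cart[of "z - y" N] by (simp add: s_def yN)
      also have yr: "norm (z - y) \<le> r / 4" using z by (simp add: dist_norm norm_minus_commute)
      finally have sr: "s \<le> r / 4" .
      have ez: "\<epsilon> / r\<^sup>2 * (norm z)\<^sup>2 \<le> \<epsilon>"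
      proof -
        have "(norm z)\<^sup>2 \<le> r\<^sup>2" using zr by (intro power_mono) auto
        then show ?thesis using \<epsilon> r by (simp add: field_simps)
      qed
      have pos: "0 \<le> A * n * (4 * s / r) * (1 - 4 * s / r)"
        using A0 n_ge_1 s0 sr r by (intro mult_nonneg_nonneg) (auto simp: field_simps)
      \<comment> \<open>The terms in s combine to the product in \<open>pos\<close>, so the barrier
        is at least 16 A/r^2 times the squared distance to y.\<close>
      have expand: "16 * A / r\<^sup>2 * (d - n * s\<^sup>2) + 4 * n * A / r * s =
          16 * A / r\<^sup>2 * d + A * n * (4 * s / r) * (1 - 4 * s / r)" for d
        using r by (simp add: field_simps power2_eq_square)
      show "\<bar>u z - peval P z\<bar> \<le> peval b z"
      proof (cases "z \<in> \<Omega>")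
        case False
        then have "z \<in> frontier \<Omega>" using z open_\<Omega> by (simp add: frontier_def interior_open)
        then have "\<bar>u z - peval P z\<bar> \<le> \<epsilon>" using bdry zr by blast
        moreover have "0 \<le> 16 * A / r\<^sup>2 * (norm (z - y))\<^sup>2" using A0 by simp
        ultimately show ?thesis unfolding b s_def[symmetric] expand using ez pos by linarith
      next
        case True
        then have nz: "norm (z - y) = r / 4" using z zG by (simp add: dist_norm norm_minus_commute)
        have "16 * A / r\<^sup>2 * (norm (z - y))\<^sup>2 = A" unfolding nz using r by (simp add: power2_eq_square)
        moreover have "\<bar>u z - peval P z\<bar> \<le> A" using closure_bound[OF r(2) A _ zr] z by blast
        ultimately show ?thesis unfolding b s_def[symmetric] expand using ez pos \<epsilon> by linarith
      qed
    qed
    also have "\<dots> \<le> 4 * n * A / r * t + 2 * \<epsilon>"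
    proof -
      \<comment> \<open>Since y is the projection of x, |x - y| = t; the quadratic terms then sum to
        a multiple of 1 - n \<le> 0 and only the linear growth survives.\<close>
      have "norm (x - y) = t" using t0 by (simp add: y_def norm_axis_1)
      then have "16 * A / r\<^sup>2 * ((norm (x - y))\<^sup>2 - n * t\<^sup>2) = 16 * A / r\<^sup>2 * t\<^sup>2 * (1 - n)"
        by (simp add: algebra_simps)
      also have "\<dots> \<le> 0" using A0 n_ge_1 by (intro mult_nonneg_nonpos) auto
      finally show ?thesis unfolding b t_def[symmetric] using \<epsilon> by (smt (verit) zero_le_power2 divide_nonneg_nonneg mult_nonneg_nonneg)
    qed
    finally show ?thesis by (simp add: t_def)
  qed
qed

text \<open>h solves the Dirichlet problem on the ball of radius r/2 with polynomial data close to a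
  function that is odd in x_N, equals u - P up to a threshold on the cap x_N > 2\<delta>, and is 0
  near the plane. In the strip along the plane both u - P and h are O(A \<delta>/r + \<epsilon>),
  the former by \<open>boundary_growth\<close>, the latter by its linear bound. So the two are close
  on the whole boundary of the region, and comparison carries this inside.\<close>

lemma harmonic_approximation:
  assumes r: "0 < r" "r \<le> 1" and \<delta>: "0 < \<delta>" "\<delta> \<le> r / 8" and \<epsilon>: "\<epsilon> > 0"
    and lower: "\<And>x. x \<in> \<Omega> \<Longrightarrow> norm x < r \<Longrightarrow> - \<delta> \<le> x $ N"
    and upper: "\<And>x. norm x < r \<Longrightarrow> \<delta> < x $ N \<Longrightarrow> x \<in> \<Omega>"
    and A: "\<And>x. x \<in> \<Omega> \<Longrightarrow> norm x < r \<Longrightarrow> \<bar>u x - peval P x\<bar> \<le> A" "0 \<le> A"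
    and bdry: "\<And>x. x \<in> frontier \<Omega> \<Longrightarrow> norm x < r \<Longrightarrow> \<bar>u x - peval P x\<bar> \<le> \<epsilon>"
    and rhs: "\<And>x. x \<in> \<Omega> \<Longrightarrow> norm x < r \<Longrightarrow> \<bar>f x - peval (lap P) x\<bar> \<le> \<epsilon> / r\<^sup>2"
  obtains h where "lap h = 0" "odd_in N h"
    "\<And>x. norm x \<le> r / 2 \<Longrightarrow> \<bar>peval h x\<bar> \<le> A + \<epsilon>"
    "\<And>x. norm x \<le> r / 2 \<Longrightarrow> \<bar>peval h x\<bar> \<le> 6 * n * A / r * \<bar>x $ N\<bar> + 3 * \<epsilon>"
    "\<And>x. x \<in> \<Omega> \<Longrightarrow> norm x \<le> r / 2 \<Longrightarrow> \<bar>u x - peval P x - peval h x\<bar> \<le> 24 * n * A * \<delta> / r + 6 * \<epsilon>"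
proof -
  define w where "w x = u x - peval P x" for x
  define c where "c = n * A / r"
  \<comment> \<open>The bound from \<open>boundary_growth\<close> at height x_N = 2\<delta>, where
    x_N + \<delta> = 3\<delta>.\<close>
  define \<tau> where "\<tau> = 12 * c * \<delta> + 2 * \<epsilon>"
  let ?S = "sphere (0 :: real ^ 'n) (r / 2)"
  have c: "c \<ge> 0" using A r n_ge_1 by (simp add: c_def)
  then have \<tau>: "\<tau> > 0" using \<delta> \<epsilon> by (simp add: \<tau>_def add_nonneg_pos)
  have growth: "\<bar>w x\<bar> \<le> 4 * c * (x $ N + \<delta>) + 2 * \<epsilon>" if "x \<in> closure \<Omega>" "norm x \<le> r / 2" for x
    using boundary_growth[OF r _ \<delta>(2) \<epsilon> lower A(1) bdry rhs that] \<delta> by (simp add: w_def c_def)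
  have strip: "\<bar>w x\<bar> \<le> \<tau>" if "x \<in> closure \<Omega>" "norm x \<le> r / 2" "x $ N \<le> 2 * \<delta>" for x
  proof -
    have "4 * c * (x $ N + \<delta>) \<le> 4 * c * (3 * \<delta>)" using that c by (intro mult_left_mono) auto
    then show ?thesis using growth[OF that(1,2)] unfolding \<tau>_def by linarith
  qed
  \<comment> \<open>At x_N = 2\<delta> the value of w is at most \<tau> in modulus, so thresholding
    makes the two pieces meet continuously.\<close>
  define \<psi>0 where "\<psi>0 x = (if x $ N \<le> 2 * \<delta> then 0 else soft_threshold \<tau> (w x))" for x
  define \<psi> where "\<psi> x = \<psi>0 x - \<psi>0 (reflect N x)" for x
  have up: "x \<in> \<Omega>" if "norm x \<le> r / 2" "2 * \<delta> \<le> x $ N" for x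
    using upper[of x] that r \<delta> by auto
  have cont0: "continuous_on ?S \<psi>0"
    unfolding \<psi>0_def
  proof (rule continuous_on_cases_le)
    have "continuous_on {t \<in> ?S. 2 * \<delta> \<le> t $ N} w"
      unfolding w_def using up closure_subset r
      by (intro continuous_intros continuous_on_subset[OF cont]) fastforce
    then show "continuous_on {t \<in> ?S. 2 * \<delta> \<le> t $ N} (\<lambda>x. soft_threshold \<tau> (w x))"
      unfolding soft_threshold_def by (intro continuous_intros)
    show "0 = soft_threshold \<tau> (w x)" if "x \<in> ?S" "x $ N = 2 * \<delta>" for x
      using strip[of x] up[of x] that closure_subset[of \<Omega>] by (auto simp: soft_threshold_def)
  qed (auto intro!: continuous_intros)
  have cont\<psi>: "continuous_on ?S \<psi>"
  proof -
    have "continuous_on ?S (\<lambda>x. \<psi>0 (reflect N x))"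
      by (rule continuous_on_compose2[OF cont0 continuous_on_reflect]) auto
    then show ?thesis unfolding \<psi>_def by (intro continuous_intros cont0)
  qed
  have \<psi>_odd: "\<psi> (reflect N x) = - \<psi> x" for x by (simp add: \<psi>_def)
  have \<psi>_up: "\<psi> x = soft_threshold \<tau> (w x)" if "2 * \<delta> < x $ N" for x using that \<delta> by (simp add: \<psi>_def \<psi>0_def)
  have \<psi>_mid: "\<psi> x = 0" if "\<bar>x $ N\<bar> \<le> 2 * \<delta>" for x using that by (auto simp: \<psi>_def \<psi>0_def)
  have \<psi>_bd_up: "\<bar>\<psi> x\<bar> \<le> A \<and> \<bar>\<psi> x\<bar> \<le> 6 * c * (x $ N) + 2 * \<epsilon>" if "x \<in> ?S" "0 \<le> x $ N" for x
  proof (cases "x $ N \<le> 2 * \<delta>")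
    case True
    then show ?thesis using \<psi>_mid[of x] that c \<epsilon> A(2) by simp
  next
    case False
    then have x\<Omega>: "x \<in> \<Omega>" using up[of x] that by simp
    have "\<bar>\<psi> x\<bar> \<le> \<bar>w x\<bar>" using \<psi>_up[of x] False soft_threshold_le[of \<tau> "w x"] \<tau> by simp
    \<comment> \<open>Above the strip, \<delta> is at most half of x_N; this is the origin of the
      constant 6.\<close>
    moreover have "4 * c * (x $ N + \<delta>) \<le> 4 * c * (3 / 2 * x $ N)" using False c by (intro mult_left_mono) auto
    ultimately show ?thesis using growth[of x] A(1)[OF x\<Omega>] x\<Omega> closure_subset[of \<Omega>] that r by (auto simp: w_def)
  qed
  have \<psi>_bd: "\<bar>\<psi> x\<bar> \<le> A" if "x \<in> ?S" for x
    using \<psi>_bd_up[of x] \<psi>_bd_up[of "reflect N x"] that \<psi>_odd[of x] by (cases "0 \<le> x $ N") auto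
  obtain g where g: "real_polynomial_function g" "\<And>x. x \<in> ?S \<Longrightarrow> \<bar>\<psi> x - g x\<bar> < \<epsilon>"
    by (rule Stone_Weierstrass_real_polynomial_function[OF compact_sphere cont\<psi> \<epsilon>]) auto
  obtain p :: "'n mpoly" where p: "g = peval p" using real_polynomial_function_peval[OF g(1)] by blast
  obtain h0 :: "'n mpoly" where h0: "lap h0 = 0" "\<And>x. norm x = r / 2 \<Longrightarrow> peval h0 x = peval p x"
    using harmonic_polynomial_sphere[of "r / 2" p] by blast
  define h where "h = odd_part N h0"
  have lap_h: "lap h = 0"
    unfolding h_def lap_odd_part h0 by (auto intro!: poly_mapping_eqI simp: odd_part_def lookup_pfilter)
  have odd_h: "odd_in N h" by (simp add: h_def odd_in_odd_part)
  \<comment> \<open>Since \<psi> is odd, passing to the odd part averages two errors and does not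
    enlarge them.\<close>
  have h\<psi>: "\<bar>peval h x - \<psi> x\<bar> \<le> \<epsilon>" if "x \<in> ?S" for x
  proof -
    have "peval h x - \<psi> x = ((g x - \<psi> x) - (g (reflect N x) - \<psi> (reflect N x))) / 2"
      using that by (simp add: h_def peval_odd_part h0 \<psi>_odd p)
    then show ?thesis using g(2)[OF that] g(2)[of "reflect N x"] that by (simp add: abs_le_iff) argo
  qed
  have h_A: "\<bar>peval h x\<bar> \<le> A + \<epsilon>" if "norm x \<le> r / 2" for x
  proof -
    have "\<bar>peval h x\<bar> \<le> peval (pconst (A + \<epsilon>)) x"
    proof (rule maximum_principle_abs[of "cball 0 (r / 2)" "ball 0 (r / 2)"])
      fix z :: "real ^ 'n" assume "z \<in> cball 0 (r / 2)" "z \<notin> ball 0 (r / 2)"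
      then have z: "z \<in> ?S" by auto
      show "\<bar>peval h z\<bar> \<le> peval (pconst (A + \<epsilon>)) z" using h\<psi>[OF z] \<psi>_bd[OF z] by (simp add: peval_const)
    qed (use that lap_h in auto)
    then show ?thesis by (simp add: peval_const)
  qed
  \<comment> \<open>Comparison on the upper half ball, where oddness supplies the value 0 on the
    flat side.\<close>
  have h_up: "\<bar>peval h x\<bar> \<le> 6 * c * (x $ N) + 3 * \<epsilon>" if "norm x \<le> r / 2" "0 \<le> x $ N" for x
  proof -
    let ?b = "pconst (6 * c) * pvar N + pconst (3 * \<epsilon>)"
    have "\<bar>peval h x\<bar> \<le> peval ?b x"
    proof (rule maximum_principle_abs[of "cball 0 (r / 2) \<inter> {x. 0 \<le> x $ N}" "ball 0 (r / 2) \<inter> {x. 0 < x $ N}"])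
      show "compact (cball (0 :: real ^ 'n) (r / 2) \<inter> {x. 0 \<le> x $ N})"
        by (intro compact_Int_closed compact_cball closed_Collect_le continuous_intros)
      show "open (ball (0 :: real ^ 'n) (r / 2) \<inter> {x. 0 < x $ N})"
        by (intro open_Int open_ball open_Collect_less continuous_intros)
      fix z :: "real ^ 'n"
      assume z: "z \<in> cball 0 (r / 2) \<inter> {x. 0 \<le> x $ N}" "z \<notin> ball 0 (r / 2) \<inter> {x. 0 < x $ N}"
      show "\<bar>peval h z\<bar> \<le> peval ?b z"
      proof (cases "z $ N = 0")
        case True
        then show ?thesis using peval_odd_eq_0[OF odd_h, of z] \<epsilon> by (simp add: peval_add peval_mult peval_const peval_var)
      next
        case False
        then have "z \<in> ?S" using z by auto
        then have "\<bar>peval h z\<bar> \<le> 6 * c * (z $ N) + 3 * \<epsilon>" using h\<psi>[of z] \<psi>_bd_up[of z] z by auto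
        then show ?thesis by (simp add: peval_add peval_mult peval_const peval_var)
      qed
    qed (use that lap_h in \<open>auto simp: lap_add lap_pconst_mult\<close>)
    then show ?thesis by (simp add: peval_add peval_mult peval_const peval_var)
  qed
  have h_lin: "\<bar>peval h x\<bar> \<le> 6 * c * \<bar>x $ N\<bar> + 3 * \<epsilon>" if "norm x \<le> r / 2" for x
    using h_up[of x] h_up[of "reflect N x"] that peval_reflect_odd[OF odd_h, of x] by (cases "0 \<le> x $ N") auto
  \<comment> \<open>In the strip, \<tau> plus the bound 12 c \<delta> + 3 \<epsilon> for h; on the
    cap the error \<tau> + \<epsilon> is smaller.\<close>
  define E where "E = 24 * c * \<delta> + 5 * \<epsilon>"
  have approx: "\<bar>u x - peval P x - peval h x\<bar> \<le> E + \<epsilon>" if x: "x \<in> \<Omega>" "norm x \<le> r / 2" for x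
  proof -
    let ?b = "pconst (E + \<epsilon>) - pconst (\<epsilon> / r\<^sup>2) * rsq"
    have b: "peval ?b z = E + \<epsilon> - \<epsilon> / r\<^sup>2 * (norm z)\<^sup>2" for z :: "real ^ 'n"
      by (simp add: peval_diff peval_mult peval_const peval_rsq)
    have "\<bar>u x - peval (P + h) x\<bar> \<le> peval ?b x"
    proof (rule viscosity_comparison[OF sub super, of "\<Omega> \<inter> ball 0 (r / 2)" "closure \<Omega> \<inter> cball 0 (r / 2)"])
      show "open (\<Omega> \<inter> ball 0 (r / 2))" using open_\<Omega> by auto
      show "\<Omega> \<inter> ball 0 (r / 2) \<subseteq> \<Omega> \<inter> ball 0 1" using r by auto
      show "\<Omega> \<inter> ball 0 (r / 2) \<subseteq> closure \<Omega> \<inter> cball 0 (r / 2)" using closure_subset by auto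
      show "compact (closure \<Omega> \<inter> cball 0 (r / 2))" by (simp add: closed_Int_compact)
      show "continuous_on (closure \<Omega> \<inter> cball 0 (r / 2)) u"
        using r by (intro continuous_on_subset[OF cont]) auto
      show "x \<in> closure \<Omega> \<inter> cball 0 (r / 2)" using x closure_subset by auto
    next
      fix z assume z: "z \<in> \<Omega> \<inter> ball 0 (r / 2)"
      then have "\<bar>f z - peval (lap P) z\<bar> \<le> \<epsilon> / r\<^sup>2" using r by (intro rhs) auto
      also have "\<dots> < \<epsilon> / r\<^sup>2 * (2 * n)" using \<epsilon> r n_ge_1 by (simp add: field_simps)
      also have "\<dots> = - peval (lap ?b) z"
        by (simp add: lap_diff lap_pconst_mult lap_rsq peval_mult peval_const peval_uminus n_def)
      finally show "\<bar>f z - peval (lap (P + h)) z\<bar> < - peval (lap ?b) z" by (simp add: lap_add lap_h)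
    next
      fix z assume z: "z \<in> closure \<Omega> \<inter> cball 0 (r / 2)" and zG: "z \<notin> \<Omega> \<inter> ball 0 (r / 2)"
      have zr: "norm z \<le> r / 2" "norm z < r" using z r by auto
      have low: "- \<delta> \<le> z $ N" using closure_lower_bound[OF lower _ zr(2)] z by blast
      have "\<bar>w z - peval h z\<bar> \<le> E"
      proof (cases "z $ N \<le> 2 * \<delta>")
        case True
        then have "6 * c * \<bar>z $ N\<bar> \<le> 6 * c * (2 * \<delta>)" using low \<delta> c by (intro mult_left_mono) auto
        moreover have "\<bar>w z\<bar> \<le> \<tau>" using strip z zr True by blast
        ultimately show ?thesis using h_lin[OF zr(1)] unfolding \<tau>_def E_def by linarith
      next
        case False
        then have "z \<in> ?S" using up[of z] z zG by auto
        then have "\<bar>w z - peval h z\<bar> \<le> \<tau> + \<epsilon>"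
          using h\<psi>[of z] \<psi>_up[of z] False soft_threshold_diff[of \<tau> "w z"] \<tau> by auto
        moreover have "0 \<le> c * \<delta>" using c \<delta> by simp
        ultimately show ?thesis using \<epsilon> unfolding \<tau>_def E_def by linarith
      qed
      moreover have "\<epsilon> / r\<^sup>2 * (norm z)\<^sup>2 \<le> \<epsilon>"
      proof -
        have "(norm z)\<^sup>2 \<le> r\<^sup>2" using zr by (intro power_mono) auto
        then show ?thesis using \<epsilon> r by (simp add: field_simps)
      qed
      ultimately show "\<bar>u z - peval (P + h) z\<bar> \<le> peval ?b z" unfolding b by (simp add: peval_add w_def)
    qed
    also have "\<dots> \<le> E + \<epsilon>" unfolding b using \<epsilon> by simp
    finally show ?thesis by (simp add: peval_add)
  qed
  show ?thesis
    by (rule that[of h]) (use lap_h odd_h h_A h_lin approx in \<open>auto simp: E_def c_def ac_simps\<close>)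
qed

end

section \<open>Summation over dyadic scales\<close>

lemma geometric_increments_limit:
  fixes a :: "nat \<Rightarrow> real"
  assumes inc: "\<And>i. \<bar>a (Suc i) - a i\<bar> \<le> D * q ^ i" and q: "0 \<le> q" "q < 1"
  shows "\<exists>L. a \<longlonglongrightarrow> L \<and> (\<forall>i. \<bar>L - a i\<bar> \<le> D * q ^ i / (1 - q))"
proof -
  define e where "e j = a (Suc j) - a j" for j
  have geo: "(\<lambda>j. D * q ^ (j + i)) sums (D * q ^ i / (1 - q))" for i
    using sums_mult[OF geometric_sums, of q "D * q ^ i"] q by (simp add: power_add mult_ac)
  have sm: "summable (\<lambda>j. \<bar>e (j + i)\<bar>)" for i
    by (rule summable_comparison_test'[OF sums_summable[OF geo[of i]]]) (use inc in \<open>auto simp: e_def\<close>)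
  have lim: "(\<lambda>k. a (k + i)) \<longlonglongrightarrow> a i + suminf (\<lambda>j. e (j + i))" for i
  proof -
    have "(\<Sum>j<k. e (j + i)) = a (k + i) - a i" for k
      using sum_lessThan_telescope[of "\<lambda>j. a (j + i)" k] by (simp add: e_def)
    then have "(\<lambda>k. a (k + i) - a i) \<longlonglongrightarrow> suminf (\<lambda>j. e (j + i))"
      using summable_LIMSEQ[OF summable_rabs_cancel[OF sm[of i]]] by simp
    from tendsto_add[OF tendsto_const this, of "a i"] show ?thesis by simp
  qed
  define L where "L = a 0 + suminf e"
  have L: "a \<longlonglongrightarrow> L" using lim[of 0] by (simp add: L_def)
  moreover have "\<bar>L - a i\<bar> \<le> D * q ^ i / (1 - q)" for i
  proof -
    have "L = a i + suminf (\<lambda>j. e (j + i))"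
      by (rule LIMSEQ_unique[OF LIMSEQ_ignore_initial_segment[OF L, of i] lim])
    moreover have "\<bar>suminf (\<lambda>j. e (j + i))\<bar> \<le> suminf (\<lambda>j. \<bar>e (j + i)\<bar>)" by (rule summable_rabs[OF sm])
    moreover have "suminf (\<lambda>j. \<bar>e (j + i)\<bar>) \<le> suminf (\<lambda>j. D * q ^ (j + i))"
      by (rule suminf_le[OF _ sm sums_summable[OF geo]]) (use inc in \<open>simp add: e_def\<close>)
    ultimately show ?thesis using sums_unique[OF geo[of i]] by simp
  qed
  ultimately show ?thesis by blast
qed

lemma dyadic_scale:
  fixes y s :: real
  assumes "0 < y" "y \<le> s"
  obtains i :: nat where "s / 2 ^ Suc i < y" "y \<le> s / 2 ^ i"
proof -
  have ex: "\<exists>k. s / 2 ^ k < y"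
  proof -
    obtain k where "(1/2::real) ^ k < y / s" using real_arch_pow_inv[of "y / s" "1/2"] assms by auto
    then show ?thesis using assms by (auto simp: field_simps power_divide)
  qed
  define k where "k = (LEAST k. s / 2 ^ k < y)"
  have k: "s / 2 ^ k < y" unfolding k_def by (rule LeastI_ex[OF ex])
  then obtain i where i: "k = Suc i" using assms by (cases k) auto
  have "\<not> s / 2 ^ i < y" using not_less_Least[of i "\<lambda>k. s / 2 ^ k < y"] i k_def by simp
  then show ?thesis using that[of i] k i by simp
qed

definition monomials_upto :: "nat \<Rightarrow> ('n::finite \<Rightarrow>\<^sub>0 nat) set" where
  "monomials_upto m = {\<sigma>. mdeg \<sigma> \<le> m}"

lemma cnorm_polys_le:
  fixes P :: "'n::finite mpoly" and c :: real
  assumes "P \<in> polys m" "\<And>\<sigma>. \<bar>lookup P \<sigma>\<bar> \<le> c"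
  shows "cnorm P \<le> card (monomials_upto m :: ('n \<Rightarrow>\<^sub>0 nat) set) * c"
proof -
  have "cnorm P = (\<Sum>\<sigma>\<in>monomials_upto m. \<bar>lookup P \<sigma>\<bar>)"
    by (rule cnorm_superset) (use assms in \<open>auto simp: polys_iff monomials_upto_def finite_mdeg_le\<close>)
  also have "\<dots> \<le> card (monomials_upto m :: ('n \<Rightarrow>\<^sub>0 nat) set) * c"
    using sum_bounded_above[of "monomials_upto m" "\<lambda>\<sigma>. \<bar>lookup P \<sigma>\<bar>" c] assms by simp
  finally show ?thesis .
qed

lemma harmonic_coefficient_bound_upto:
  "\<exists>c>0. \<forall>(h :: 'n::finite mpoly) \<rho> A \<sigma>. lap h = 0 \<and> \<rho> > 0 \<and> (\<forall>x. norm x \<le> \<rho> \<longrightarrow> \<bar>peval h x\<bar> \<le> A)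
     \<and> mdeg \<sigma> \<le> m \<longrightarrow> \<bar>lookup h \<sigma>\<bar> \<le> c * A / \<rho> ^ mdeg \<sigma>"
proof -
  obtain c where c: "\<And>d. c d > (0::real)" "\<And>d (h :: 'n mpoly) \<rho> A \<sigma>. lap h = 0 \<Longrightarrow> \<rho> > 0 \<Longrightarrow>
      (\<And>x. norm x \<le> \<rho> \<Longrightarrow> \<bar>peval h x\<bar> \<le> A) \<Longrightarrow> mdeg \<sigma> = d \<Longrightarrow> \<bar>lookup h \<sigma>\<bar> \<le> c d * A / \<rho> ^ d"
    using harmonic_coefficient_bound[where 'n = 'n] by metis
  have mono: "c d \<le> (\<Sum>d\<le>m. c d)" if "d \<le> m" for d
    using member_le_sum[of d "{..m}" c] c(1) that by (simp add: less_imp_le)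
  moreover have "0 < (\<Sum>d\<le>m. c d)" using c(1) by (intro sum_pos) auto
  moreover have "\<bar>lookup h \<sigma>\<bar> \<le> (\<Sum>d\<le>m. c d) * A / \<rho> ^ mdeg \<sigma>"
    if "lap h = 0" "\<rho> > 0" "\<forall>x. norm x \<le> \<rho> \<longrightarrow> \<bar>peval h x\<bar> \<le> A" "mdeg \<sigma> \<le> m" for h :: "'n mpoly" and \<rho> A \<sigma>
  proof -
    have A: "0 \<le> A" using that(2,3) by (metis abs_ge_zero norm_zero order_less_imp_le order_trans)
    have "\<bar>lookup h \<sigma>\<bar> \<le> c (mdeg \<sigma>) * A / \<rho> ^ mdeg \<sigma>" using c(2) that by blast
    also have "\<dots> \<le> (\<Sum>d\<le>m. c d) * A / \<rho> ^ mdeg \<sigma>"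
      using mono[OF that(4)] A that(2) by (intro divide_right_mono mult_right_mono) auto
    finally show ?thesis .
  qed
  ultimately show ?thesis by blast
qed

text \<open>On the radii R_i = \<rho>/2^i, coefficients of degree d \<le> m have increments of size
  R_i^(\<gamma>-d) and converge geometrically, since d < \<gamma>; their limits form H. Coefficients
  of higher degree need not converge, but they are collected in the Taylor remainders of order m +
  1, whose sizes R_i^(\<gamma>-m-1) |x|^(m+1) form a geometric sum dominated by its last term
  because \<gamma> < m + 1.\<close>

lemma harmonic_dyadic_limit:
  fixes m :: nat and \<gamma> :: real
  assumes \<gamma>: "real m < \<gamma>" "\<gamma> < real m + 1"
  shows "\<exists>C>0. \<forall>(h :: nat \<Rightarrow> 'n::finite mpoly) N B \<rho>.
    0 < \<rho> \<and> \<rho> \<le> 1 \<and> 0 \<le> B \<and> (\<forall>i. lap (h i) = 0) \<and> (\<forall>i. odd_in N (h i)) \<and>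
    (\<forall>x. norm x \<le> \<rho> \<longrightarrow> \<bar>peval (h 0) x\<bar> \<le> B * \<rho> powr \<gamma>) \<and>
    (\<forall>i x. norm x \<le> \<rho> / 2 ^ i \<longrightarrow> \<bar>peval (h (Suc i) - h i) x\<bar> \<le> B * (\<rho> / 2 ^ i) powr \<gamma>)
    \<longrightarrow> (\<exists>H. lap H = 0 \<and> odd_in N H \<and> H \<in> polys m \<and> (\<forall>\<sigma>. \<bar>lookup H \<sigma>\<bar> \<le> C * B) \<and>
        (\<forall>i x. norm x \<le> \<rho> / 2 ^ i / 2 ^ Suc m \<longrightarrow> \<bar>peval (h i) x - peval H x\<bar> \<le> C * B * (\<rho> / 2 ^ i) powr \<gamma>))"
proof -
  obtain c where c: "c > 0" "\<And>(h :: 'n mpoly) \<rho> A \<sigma>. lap h = 0 \<Longrightarrow> \<rho> > 0 \<Longrightarrow>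
      (\<And>x. norm x \<le> \<rho> \<Longrightarrow> \<bar>peval h x\<bar> \<le> A) \<Longrightarrow> mdeg \<sigma> \<le> m \<Longrightarrow> \<bar>lookup h \<sigma>\<bar> \<le> c * A / \<rho> ^ mdeg \<sigma>"
    using harmonic_coefficient_bound_upto[where 'n = 'n, of m] by metis
  obtain CT where CT: "CT > 0" "\<And>(h :: 'n mpoly) \<rho> A x. lap h = 0 \<Longrightarrow> \<rho> > 0 \<Longrightarrow>
      (\<And>x. norm x \<le> \<rho> \<Longrightarrow> \<bar>peval h x\<bar> \<le> A) \<Longrightarrow> norm x \<le> \<rho> / 2 ^ Suc m \<Longrightarrow>
      \<bar>peval (h - trunc_lt (Suc m) h) x\<bar> \<le> CT * A * (norm x / \<rho>) ^ Suc m"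
    using harmonic_taylor_remainder[where 'n = 'n, of "Suc m"] by metis
  \<comment> \<open>The factor by which R^(\<gamma>-m-1) grows when R is halved.\<close>
  define p where "p = 2 powr (real m + 1 - \<gamma>)"
  have p: "p > 1" using \<gamma> by (simp add: p_def)
  \<comment> \<open>The slowest decay ratio among the degrees d \<le> m, attained at d = m.\<close>
  define q0 where "q0 = 2 powr (real m - \<gamma>)"
  have q0: "0 < q0" "q0 < 1" using \<gamma> by (simp_all add: q0_def powr_less_one)
  define \<kappa> where "\<kappa> = c / (1 - q0)"
  have \<kappa>: "\<kappa> > 0" using q0 c by (simp add: \<kappa>_def)
  \<comment> \<open>Chosen so that C3 + CT \<le> C3 p, which closes the induction on the scale in
    \<open>remainder\<close>.\<close>
  define C3 where "C3 = CT + CT / (p - 1)"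
  have C3: "C3 \<ge> CT" "C3 + CT \<le> C3 * p"
  proof -
    show "C3 \<ge> CT" using p CT by (simp add: C3_def)
    have "CT / (p - 1) * (p - 1) = CT" using p by simp
    then have "C3 * p = CT * p + CT / (p - 1) + CT" unfolding C3_def by (simp only: algebra_simps)
    moreover have "CT \<le> CT * p" using p CT by simp
    ultimately show "C3 + CT \<le> C3 * p" by (simp add: C3_def)
  qed
  define M where "M = real (card (monomials_upto m :: ('n \<Rightarrow>\<^sub>0 nat) set))"
  define C where "C = M * \<kappa> + C3 + \<kappa> + c"
  have C: "C > 0" "\<kappa> + c \<le> C" "M * \<kappa> + C3 \<le> C" using C3 CT \<kappa> c by (auto simp: C_def M_def add_nonneg_pos)
  show ?thesis
  proof (intro exI[of _ C] conjI allI impI C(1))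
    fix h :: "nat \<Rightarrow> 'n mpoly" and N B \<rho>
    assume asm: "0 < \<rho> \<and> \<rho> \<le> 1 \<and> 0 \<le> B \<and> (\<forall>i. lap (h i) = 0) \<and> (\<forall>i. odd_in N (h i)) \<and>
      (\<forall>x. norm x \<le> \<rho> \<longrightarrow> \<bar>peval (h 0) x\<bar> \<le> B * \<rho> powr \<gamma>) \<and>
      (\<forall>i x. norm x \<le> \<rho> / 2 ^ i \<longrightarrow> \<bar>peval (h (Suc i) - h i) x\<bar> \<le> B * (\<rho> / 2 ^ i) powr \<gamma>)"
    then have \<rho>: "0 < \<rho>" "\<rho> \<le> 1" and B: "0 \<le> B" and lh: "\<And>i. lap (h i) = 0" and oh: "\<And>i. odd_in N (h i)"
      and h0: "\<And>x. norm x \<le> \<rho> \<Longrightarrow> \<bar>peval (h 0) x\<bar> \<le> B * \<rho> powr \<gamma>"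
      and hd: "\<And>i x. norm x \<le> \<rho> / 2 ^ i \<Longrightarrow> \<bar>peval (h (Suc i) - h i) x\<bar> \<le> B * (\<rho> / 2 ^ i) powr \<gamma>" by blast+
    define R where "R i = \<rho> / 2 ^ i" for i :: nat
    have R: "R i > 0" "R (Suc i) = R i / 2" for i using \<rho> by (simp_all add: R_def)
    have R_powr: "R i powr \<gamma> / R i ^ j = R i powr (\<gamma> - real j)" for i j
      using R(1)[of i] by (simp add: powr_diff powr_realpow)
    have R_geo: "R i powr s = \<rho> powr s * (2 powr (- s)) ^ i" for i s
    proof -
      have "(2 ^ i) powr s = (2 powr s) ^ i"
        by (simp add: powr_realpow[symmetric] powr_powr powr_power mult.commute)
      moreover have "R i powr s = \<rho> powr s / (2 ^ i) powr s" using \<rho> by (simp add: R_def powr_divide)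
      ultimately show ?thesis by (simp add: powr_minus power_inverse divide_inverse)
    qed
    have ld: "lap (h (Suc i) - h i) = 0" for i by (simp add: lap_diff lh)
    have "\<exists>L. (\<lambda>i. lookup (h i) \<sigma>) \<longlonglongrightarrow> L \<and> (\<forall>i. \<bar>L - lookup (h i) \<sigma>\<bar> \<le> \<kappa> * B * R i powr (\<gamma> - real (mdeg \<sigma>)))"
      if \<sigma>: "mdeg \<sigma> \<le> m" for \<sigma>
    proof -
      define s where "s = \<gamma> - real (mdeg \<sigma>)"
      define q where "q = 2 powr (- s)"
      have q: "0 < q" "q \<le> q0" using \<sigma> by (simp_all add: q_def q0_def s_def)
      have "\<bar>lookup (h (Suc i)) \<sigma> - lookup (h i) \<sigma>\<bar> \<le> (c * B * \<rho> powr s) * q ^ i" for i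
      proof -
        have "\<bar>lookup (h (Suc i) - h i) \<sigma>\<bar> \<le> c * (B * R i powr \<gamma>) / R i ^ mdeg \<sigma>"
          by (rule c(2)[OF ld R(1) _ \<sigma>]) (use hd in \<open>simp add: R_def\<close>)
        also have "\<dots> = c * B * (R i powr \<gamma> / R i ^ mdeg \<sigma>)" by simp
        also have "\<dots> = (c * B * \<rho> powr s) * q ^ i"
          by (subst R_powr) (simp add: s_def[symmetric] R_geo q_def)
        finally show ?thesis by (simp add: lookup_minus)
      qed
      from geometric_increments_limit[OF this] q q0 obtain L where
        L: "(\<lambda>i. lookup (h i) \<sigma>) \<longlonglongrightarrow> L" "\<And>i. \<bar>L - lookup (h i) \<sigma>\<bar> \<le> (c * B * \<rho> powr s) * q ^ i / (1 - q)" by fastforce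
      have "(c * B * \<rho> powr s) * q ^ i / (1 - q) \<le> \<kappa> * B * R i powr s" for i
      proof -
        have "(c * B * \<rho> powr s) * q ^ i / (1 - q) \<le> (c * B * \<rho> powr s) * q ^ i / (1 - q0)"
          using q q0 c B by (intro divide_left_mono) auto
        also have "\<dots> = \<kappa> * B * R i powr s" by (simp add: \<kappa>_def R_geo q_def)
        finally show ?thesis .
      qed
      then show ?thesis using L s_def order_trans by blast
    qed
    then obtain a where a: "\<And>\<sigma>. mdeg \<sigma> \<le> m \<Longrightarrow> (\<lambda>i. lookup (h i) \<sigma>) \<longlonglongrightarrow> a \<sigma>"
      "\<And>\<sigma> i. mdeg \<sigma> \<le> m \<Longrightarrow> \<bar>a \<sigma> - lookup (h i) \<sigma>\<bar> \<le> \<kappa> * B * R i powr (\<gamma> - real (mdeg \<sigma>))" by metis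
    define H where "H = (\<Sum>\<sigma>\<in>monomials_upto m. Poly_Mapping.single \<sigma> (a \<sigma>))"
    have H: "lookup H \<sigma> = (if mdeg \<sigma> \<le> m then a \<sigma> else 0)" for \<sigma>
      using finite_mdeg_le[of m, where 'n = 'n]
      by (simp add: H_def lookup_sum lookup_single when_def monomials_upto_def)
    have Hm: "H \<in> polys m" by (auto simp: polys_iff H)
    have lH: "lap H = 0"
    proof (rule poly_mapping_eqI)
      fix \<sigma>
      show "lookup (lap H) \<sigma> = lookup 0 \<sigma>"
      proof (cases "mdeg \<sigma> + 2 \<le> m")
        case True
        have "(\<lambda>i. lookup (lap (h i)) \<sigma>) \<longlonglongrightarrow> lookup (lap H) \<sigma>"
          unfolding lookup_lap
          by (intro tendsto_intros) (use True a(1) in \<open>simp add: H mdeg_add\<close>)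
        then show ?thesis by (simp add: lh LIMSEQ_const_iff)
      next
        case False
        then show ?thesis by (simp add: lookup_lap H mdeg_add)
      qed
    qed
    have oH: "odd_in N H"
      unfolding odd_in_def
    proof (intro allI impI, rule ccontr)
      fix \<sigma> assume \<sigma>: "lookup H \<sigma> \<noteq> 0" "\<not> odd (lookup \<sigma> N)"
      then have m: "mdeg \<sigma> \<le> m" by (auto simp: H split: if_splits)
      have "lookup (h i) \<sigma> = 0" for i using oh \<sigma>(2) by (auto simp: odd_in_def)
      then have "a \<sigma> = 0" using a(1)[OF m] by (simp add: LIMSEQ_const_iff)
      then show False using \<sigma>(1) by (simp add: H split: if_splits)
    qed
    have Hb: "\<bar>lookup H \<sigma>\<bar> \<le> C * B" for \<sigma>
    proof (cases "mdeg \<sigma> \<le> m")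
      case True
      have "R 0 powr (\<gamma> - real (mdeg \<sigma>)) \<le> 1"
        using \<rho> True \<gamma> by (intro powr_le1) (auto simp: R_def)
      then have e: "x * R 0 powr (\<gamma> - real (mdeg \<sigma>)) \<le> x" if "0 \<le> x" for x
        using mult_left_mono[OF _ that] by fastforce
      have "\<bar>lookup (h 0) \<sigma>\<bar> \<le> c * (B * R 0 powr \<gamma>) / R 0 ^ mdeg \<sigma>"
        by (rule c(2)[OF lh R(1) _ True]) (use h0 in \<open>simp add: R_def\<close>)
      also have "\<dots> = c * B * (R 0 powr \<gamma> / R 0 ^ mdeg \<sigma>)" by simp
      also have "\<dots> \<le> c * B" unfolding R_powr using e[of "c * B"] c B by simp
      finally have "\<bar>lookup (h 0) \<sigma>\<bar> \<le> c * B" .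
      moreover have "\<bar>a \<sigma> - lookup (h 0) \<sigma>\<bar> \<le> \<kappa> * B"
        by (rule order_trans[OF a(2)[OF True, of 0] e]) (use \<kappa> B in simp)
      ultimately have "\<bar>a \<sigma>\<bar> \<le> (\<kappa> + c) * B" by (simp add: algebra_simps)
      also have "\<dots> \<le> C * B" using C B by (intro mult_right_mono) auto
      finally show ?thesis by (simp add: H True)
    qed (use C B in \<open>simp add: H\<close>)
    have trunc: "\<bar>peval (trunc_lt (Suc m) (h i) - H) x\<bar> \<le> M * \<kappa> * B * R i powr \<gamma>" if x: "norm x \<le> R i" for i x
    proof -
      have "peval (trunc_lt (Suc m) (h i) - H) x =
          (\<Sum>\<sigma>\<in>monomials_upto m. lookup (trunc_lt (Suc m) (h i) - H) \<sigma> * mon \<sigma> x)"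
        using finite_mdeg_le[of m, where 'n = 'n]
        by (intro peval_superset) (auto simp: monomials_upto_def in_keys_iff lookup_minus lookup_pfilter H split: if_splits)
      also have "\<bar>\<dots>\<bar> \<le> (\<Sum>\<sigma>\<in>(monomials_upto m :: ('n \<Rightarrow>\<^sub>0 nat) set). \<kappa> * B * R i powr \<gamma>)"
      proof (rule order_trans[OF sum_abs sum_mono])
        fix \<sigma> :: "'n \<Rightarrow>\<^sub>0 nat" assume "\<sigma> \<in> monomials_upto m"
        then have \<sigma>: "mdeg \<sigma> \<le> m" by (simp add: monomials_upto_def)
        have "\<bar>lookup (trunc_lt (Suc m) (h i) - H) \<sigma> * mon \<sigma> x\<bar> = \<bar>a \<sigma> - lookup (h i) \<sigma>\<bar> * \<bar>mon \<sigma> x\<bar>"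
          using \<sigma> by (simp add: lookup_minus lookup_pfilter H abs_mult abs_minus_commute)
        also have "\<dots> \<le> (\<kappa> * B * R i powr (\<gamma> - real (mdeg \<sigma>))) * R i ^ mdeg \<sigma>"
        proof (rule mult_mono[OF a(2)[OF \<sigma>]])
          show "\<bar>mon \<sigma> x\<bar> \<le> R i ^ mdeg \<sigma>"
            using abs_mon_le[of \<sigma> x] power_mono[OF x norm_ge_zero, of "mdeg \<sigma>"] by linarith
        qed (use \<kappa> B in auto)
        also have "\<dots> = \<kappa> * B * R i powr \<gamma>" using R(1)[of i] by (simp add: R_powr[symmetric])
        finally show "\<bar>lookup (trunc_lt (Suc m) (h i) - H) \<sigma> * mon \<sigma> x\<bar> \<le> \<kappa> * B * R i powr \<gamma>" .
      qed
      finally show ?thesis by (simp add: M_def mult.assoc)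
    qed
    have remainder: "\<bar>peval (h i - trunc_lt (Suc m) (h i)) x\<bar> \<le> C3 * B * (R i powr (\<gamma> - real (Suc m)) * norm x ^ Suc m)"
      if "norm x \<le> R i / 2 ^ Suc m" for i x
      using that
    proof (induction i)
      case 0
      have "\<bar>peval (h 0 - trunc_lt (Suc m) (h 0)) x\<bar> \<le> CT * (B * R 0 powr \<gamma>) * (norm x / R 0) ^ Suc m"
        by (rule CT(2)[OF lh R(1) _ 0]) (use h0 in \<open>simp add: R_def\<close>)
      also have "\<dots> = CT * B * (R 0 powr \<gamma> / R 0 ^ Suc m * norm x ^ Suc m)"
        by (simp add: power_divide)
      also have "\<dots> \<le> C3 * B * (R 0 powr \<gamma> / R 0 ^ Suc m * norm x ^ Suc m)"
        using C3 B R(1)[of 0] by (intro mult_right_mono) auto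
      finally show ?case unfolding R_powr .
    next
      case (Suc i)
      have x: "norm x \<le> R i / 2 ^ Suc m" using Suc.prems R[of i] by (simp add: field_simps)
      let ?Y = "R i powr (\<gamma> - real (Suc m)) * norm x ^ Suc m"
      have "\<bar>peval ((h (Suc i) - h i) - trunc_lt (Suc m) (h (Suc i) - h i)) x\<bar> \<le> CT * (B * R i powr \<gamma>) * (norm x / R i) ^ Suc m"
        by (rule CT(2)[OF ld R(1) _ x]) (use hd in \<open>simp add: R_def\<close>)
      also have "\<dots> = CT * B * (R i powr \<gamma> / R i ^ Suc m * norm x ^ Suc m)"
        by (simp add: power_divide)
      finally have 1: "\<bar>peval ((h (Suc i) - h i) - trunc_lt (Suc m) (h (Suc i) - h i)) x\<bar> \<le> CT * B * ?Y"
        unfolding R_powr .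
      have split: "h (Suc i) - trunc_lt (Suc m) (h (Suc i)) =
          (h i - trunc_lt (Suc m) (h i)) + ((h (Suc i) - h i) - trunc_lt (Suc m) (h (Suc i) - h i))"
        by (rule poly_mapping_eqI) (simp add: lookup_add lookup_minus lookup_pfilter)
      have Y: "R (Suc i) powr (\<gamma> - real (Suc m)) = p * R i powr (\<gamma> - real (Suc m))"
      proof -
        have "2 powr (\<gamma> - real (Suc m)) * p = 1"
          unfolding p_def powr_add[symmetric] by simp
        then have "p = 1 / 2 powr (\<gamma> - real (Suc m))" by (simp add: field_simps)
        moreover have "R (Suc i) powr (\<gamma> - real (Suc m)) = R i powr (\<gamma> - real (Suc m)) / 2 powr (\<gamma> - real (Suc m))"
          unfolding R(2) by (rule powr_divide)
        ultimately show ?thesis by simp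
      qed
      have "\<bar>peval (h (Suc i) - trunc_lt (Suc m) (h (Suc i))) x\<bar> \<le> C3 * B * ?Y + CT * B * ?Y"
        unfolding split peval_add using Suc.IH[OF x] 1 by linarith
      also have "\<dots> = (C3 + CT) * (B * ?Y)" by (simp add: algebra_simps)
      also have "\<dots> \<le> (C3 * p) * (B * ?Y)" using C3 B R(1)[of i] by (intro mult_right_mono) auto
      finally show ?case unfolding Y by (simp add: mult_ac)
    qed
    have "\<bar>peval (h i) x - peval H x\<bar> \<le> C * B * R i powr \<gamma>" if x: "norm x \<le> R i / 2 ^ Suc m" for i x
    proof -
      have "R i / 2 ^ Suc m \<le> R i / 1"
        using R(1)[of i] one_le_power[of "2 :: real" "Suc m"] by (intro divide_left_mono) auto
      then have x': "norm x \<le> R i" using x by simp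
      have "R i powr (\<gamma> - real (Suc m)) * norm x ^ Suc m \<le> R i powr (\<gamma> - real (Suc m)) * R i ^ Suc m"
        using x' by (intro mult_left_mono power_mono) auto
      also have "\<dots> = R i powr \<gamma>" unfolding R_powr[symmetric] using R(1)[of i] by simp
      finally have "C3 * B * (R i powr (\<gamma> - real (Suc m)) * norm x ^ Suc m) \<le> C3 * B * R i powr \<gamma>"
        using C3 CT B by (intro mult_left_mono) auto
      then have "\<bar>peval (h i - trunc_lt (Suc m) (h i)) x\<bar> \<le> C3 * B * R i powr \<gamma>"
        using remainder[OF x] by linarith
      moreover have "peval (h i) x - peval H x = peval (h i - trunc_lt (Suc m) (h i)) x + peval (trunc_lt (Suc m) (h i) - H) x"
        by (simp add: peval_diff)
      ultimately have "\<bar>peval (h i) x - peval H x\<bar> \<le> C3 * B * R i powr \<gamma> + M * \<kappa> * B * R i powr \<gamma>"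
        using trunc[OF x'] by linarith
      also have "\<dots> = (M * \<kappa> + C3) * (B * R i powr \<gamma>)" by (simp add: algebra_simps)
      also have "\<dots> \<le> C * (B * R i powr \<gamma>)" using C B by (intro mult_right_mono) auto
      finally show ?thesis by (simp add: mult.assoc)
    qed
    then show "\<exists>H. lap H = 0 \<and> odd_in N H \<and> H \<in> polys m \<and> (\<forall>\<sigma>. \<bar>lookup H \<sigma>\<bar> \<le> C * B) \<and>
        (\<forall>i x. norm x \<le> \<rho> / 2 ^ i / 2 ^ Suc m \<longrightarrow> \<bar>peval (h i) x - peval H x\<bar> \<le> C * B * (\<rho> / 2 ^ i) powr \<gamma>)"
      using lH oH Hm Hb unfolding R_def by blast
  qed
qed

section \<open>Improving the order of approximation\<close>

text \<open>The consequence of C^(l,\<alpha>) regularity with l \<ge> 1 that the harmonic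
  approximation uses. Keeping 0 outside \<Omega> makes |x| positive there, as
  \<open>norm x powr 0\<close> is 0 at the origin.\<close>

definition flat_boundary :: "real \<Rightarrow> real \<Rightarrow> 'n::finite \<Rightarrow> (real ^ 'n) set \<Rightarrow> bool" where
  "flat_boundary K \<alpha> N \<Omega> \<longleftrightarrow> 0 \<notin> \<Omega> \<and> (\<forall>x. norm x < 1 \<longrightarrow>
     (x \<in> \<Omega> \<longrightarrow> - (K * norm x powr (1 + \<alpha>)) \<le> x $ N) \<and> (K * norm x powr (1 + \<alpha>) < x $ N \<longrightarrow> x \<in> \<Omega>))"

text \<open>At each radius r these are hypotheses of \<open>harmonic_approximation\<close> with
  \<epsilon> = B r^\<gamma>; the exponent \<gamma> - 2 comes from \<epsilon>/r^2.\<close>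

definition data_controlled ::
    "(real ^ 'n::finite) set \<Rightarrow> (real ^ 'n \<Rightarrow> real) \<Rightarrow> (real ^ 'n \<Rightarrow> real) \<Rightarrow> 'n mpoly \<Rightarrow> real \<Rightarrow> real \<Rightarrow> bool" where
  "data_controlled \<Omega> f u P B \<gamma> \<longleftrightarrow> (\<forall>r. 0 < r \<and> r \<le> 1 \<longrightarrow>
     (\<forall>x\<in>frontier \<Omega>. norm x < r \<longrightarrow> \<bar>u x - peval P x\<bar> \<le> B * r powr \<gamma>) \<and>
     (\<forall>x\<in>\<Omega>. norm x < r \<longrightarrow> \<bar>f x - peval (lap P) x\<bar> \<le> B * r powr (\<gamma> - 2)))"

text \<open>At radius r one has A = B r^\<beta>, \<epsilon> = B r^\<gamma> and \<delta> = K
  r^(1+\<alpha>), so the error A \<delta>/r = K B r^(\<beta>+\<alpha>) is absorbed thanks to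
  \<gamma> \<le> \<beta> + \<alpha>. Consecutive h are both close to u - P on \<Omega>; below the
  plane they are compared by reflection, and near it each is small by its linear bound.\<close>

lemma improvement_step:
  fixes m :: nat and \<alpha> K \<beta> \<gamma> :: real
  assumes \<alpha>: "0 < \<alpha>" and K: "0 < K" and \<beta>: "0 \<le> \<beta>" "\<gamma> \<le> \<beta> + \<alpha>"
    and \<gamma>: "real m < \<gamma>" "\<gamma> < real m + 1"
  shows "\<exists>C>0. \<forall>\<Omega> f u (N :: 'n::finite) P B.
    viscosity_problem \<Omega> f u (real CARD('n)) \<and> flat_boundary K \<alpha> N \<Omega> \<and> 0 < B \<and>
    (\<forall>x\<in>\<Omega>. norm x < 1 \<longrightarrow> \<bar>u x - peval P x\<bar> \<le> B * norm x powr \<beta>) \<and>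
    data_controlled \<Omega> f u P B \<gamma>
    \<longrightarrow> (\<exists>H. lap H = 0 \<and> odd_in N H \<and> H \<in> polys m \<and> (\<forall>\<sigma>. \<bar>lookup H \<sigma>\<bar> \<le> C * B) \<and>
          (\<forall>x\<in>\<Omega>. norm x < 1 \<longrightarrow> \<bar>u x - peval P x - peval H x\<bar> \<le> C * B * norm x powr \<gamma>))"
proof -
  define n where "n = real CARD('n)"
  have n: "n \<ge> 1" by (simp add: n_def Suc_leI)
  obtain C0 where C0: "C0 > 0" "\<And>(h :: nat \<Rightarrow> 'n mpoly) N B \<rho>. 0 < \<rho> \<Longrightarrow> \<rho> \<le> 1 \<Longrightarrow> 0 \<le> B \<Longrightarrow>
      (\<And>i. lap (h i) = 0) \<Longrightarrow> (\<And>i. odd_in N (h i)) \<Longrightarrow>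
      (\<And>x. norm x \<le> \<rho> \<Longrightarrow> \<bar>peval (h 0) x\<bar> \<le> B * \<rho> powr \<gamma>) \<Longrightarrow>
      (\<And>i x. norm x \<le> \<rho> / 2 ^ i \<Longrightarrow> \<bar>peval (h (Suc i) - h i) x\<bar> \<le> B * (\<rho> / 2 ^ i) powr \<gamma>) \<Longrightarrow>
      \<exists>H. lap H = 0 \<and> odd_in N H \<and> H \<in> polys m \<and> (\<forall>\<sigma>. \<bar>lookup H \<sigma>\<bar> \<le> C0 * B) \<and>
        (\<forall>i x. norm x \<le> \<rho> / 2 ^ i / 2 ^ Suc m \<longrightarrow> \<bar>peval (h i) x - peval H x\<bar> \<le> C0 * B * (\<rho> / 2 ^ i) powr \<gamma>)"
    using harmonic_dyadic_limit[OF \<gamma>, where 'n = 'n] by (elim exE conjE) metis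
  \<comment> \<open>Small enough for K r^\<alpha> \<le> 1/8, that is \<delta> \<le> r/8.\<close>
  define r0 where "r0 = min 1 ((1 / (8 * K)) powr (1 / \<alpha>))"
  have r0: "0 < r0" "r0 \<le> 1" using K by (simp_all add: r0_def)
  have r0K: "K * r0 powr \<alpha> \<le> 1 / 8"
  proof -
    have "r0 powr \<alpha> \<le> ((1 / (8 * K)) powr (1 / \<alpha>)) powr \<alpha>"
      using \<alpha> r0 by (intro powr_mono2) (auto simp: r0_def)
    also have "\<dots> = 1 / (8 * K)" using \<alpha> K by (simp add: powr_powr)
    finally have "K * r0 powr \<alpha> \<le> K * (1 / (8 * K))" using K by (intro mult_left_mono) auto
    then show ?thesis using K by simp
  qed
  \<comment> \<open>Both \<open>h i\<close> and \<open>h (Suc i)\<close> are controlled up to the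
    radius r (Suc i) / 2 = \<rho> / 2^i.\<close>
  define \<rho> where "\<rho> = r0 / 4"
  have \<rho>: "0 < \<rho>" "\<rho> \<le> 1" using r0 by (simp_all add: \<rho>_def)
  define C1 where "C1 = 24 * n * K + 6"
  have C1: "C1 > 0" using n K by (simp add: C1_def add_nonneg_pos)
  \<comment> \<open>The first summand bounds the increments after rescaling r i = 4 \<rho>/2^i, the
    second the initial h, whose size is at most 2B.\<close>
  define C2 where "C2 = 2 * C1 * 4 powr \<gamma> + 2 / \<rho> powr \<gamma>"
  have C2: "C2 > 0" using C1 \<rho> by (simp add: C2_def add_pos_pos)
  define s0 where "s0 = \<rho> / 2 ^ Suc m"
  have s0: "0 < s0" using \<rho> by (simp add: s0_def)
  define M where "M = real (card (monomials_upto m :: ('n \<Rightarrow>\<^sub>0 nat) set))"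
  \<comment> \<open>The summands serve the coefficients of H, the points with |x| \<le> s0, and the
    remaining points.\<close>
  define C where "C = C0 * C2 + (C1 * 4 powr \<gamma> + C0 * C2) * (2 * 2 ^ Suc m) powr \<gamma> + (1 + M * (C0 * C2)) / s0 powr \<gamma>"
  have C: "C > 0" "C0 * C2 \<le> C" "(C1 * 4 powr \<gamma> + C0 * C2) * (2 * 2 ^ Suc m) powr \<gamma> \<le> C" "(1 + M * (C0 * C2)) / s0 powr \<gamma> \<le> C"
    using C0 C1 C2 s0 by (auto simp: C_def M_def intro!: add_pos_nonneg)
  show ?thesis
  proof (intro exI[of _ C] conjI allI impI C(1))
    fix \<Omega> f u and N :: 'n and P B
    assume asm: "viscosity_problem \<Omega> f u (real CARD('n)) \<and> flat_boundary K \<alpha> N \<Omega> \<and> 0 < B \<and>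
      (\<forall>x\<in>\<Omega>. norm x < 1 \<longrightarrow> \<bar>u x - peval P x\<bar> \<le> B * norm x powr \<beta>) \<and> data_controlled \<Omega> f u P B \<gamma>"
    then have flat: "flat_boundary K \<alpha> N \<Omega>" and B: "0 < B" and uP: "\<And>x. x \<in> \<Omega> \<Longrightarrow> norm x < 1 \<Longrightarrow> \<bar>u x - peval P x\<bar> \<le> B * norm x powr \<beta>"
      and data: "data_controlled \<Omega> f u P B \<gamma>" by blast+
    interpret viscosity_problem \<Omega> f u N n using asm by (simp add: n_def)
    define r where "r i = r0 / 2 ^ i" for i :: nat
    have r: "0 < r i" "r i \<le> r0" "r i \<le> 1" "r (Suc i) = r i / 2" for i
    proof -
      show "0 < r i" "r (Suc i) = r i / 2" using r0 by (simp_all add: r_def)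
      have "r0 / 2 ^ i \<le> r0 / 1" using r0 by (intro divide_left_mono) auto
      then show "r i \<le> r0" by (simp add: r_def)
      then show "r i \<le> 1" using r0 by simp
    qed
    define \<delta> where "\<delta> i = K * r i powr (1 + \<alpha>)" for i
    have \<delta>: "0 < \<delta> i" "\<delta> i = K * r i powr \<alpha> * r i" "\<delta> i \<le> r i / 8" for i
    proof -
      show "0 < \<delta> i" using K r(1)[of i] by (simp add: \<delta>_def)
      show e: "\<delta> i = K * r i powr \<alpha> * r i" using r(1)[of i] by (simp add: \<delta>_def powr_add)
      have "K * r i powr \<alpha> \<le> K * r0 powr \<alpha>" using K \<alpha> r[of i] by (intro mult_left_mono powr_mono2) auto
      then have "K * r i powr \<alpha> * r i \<le> 1 / 8 * r i" using r0K r(1)[of i] by (intro mult_right_mono) auto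
      then show "\<delta> i \<le> r i / 8" by (simp add: e)
    qed
    have lower: "- \<delta> i \<le> x $ N" if "x \<in> \<Omega>" "norm x < r i" for x i
    proof -
      have "K * norm x powr (1 + \<alpha>) \<le> \<delta> i"
        unfolding \<delta>_def using that K \<alpha> by (intro mult_left_mono powr_mono2) auto
      moreover have "- (K * norm x powr (1 + \<alpha>)) \<le> x $ N"
        using flat that r(3)[of i] by (auto simp: flat_boundary_def)
      ultimately show ?thesis by linarith
    qed
    have upper: "x \<in> \<Omega>" if "norm x < r i" "\<delta> i < x $ N" for x i
    proof -
      have "K * norm x powr (1 + \<alpha>) \<le> \<delta> i"
        unfolding \<delta>_def using that K \<alpha> by (intro mult_left_mono powr_mono2) auto
      then show ?thesis using flat that r(3)[of i] by (auto simp: flat_boundary_def)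
    qed
    have A\<delta>: "B * r i powr \<beta> * \<delta> i / r i \<le> K * (B * r i powr \<gamma>)" for i
    proof -
      have "B * r i powr \<beta> * \<delta> i / r i = K * (B * r i powr (\<beta> + \<alpha>))"
        using r(1)[of i] by (simp add: \<delta>(2) powr_add)
      also have "\<dots> \<le> K * (B * r i powr \<gamma>)"
        using K B \<beta> r[of i] by (intro mult_left_mono powr_mono') auto
      finally show ?thesis .
    qed
    have "\<exists>h. lap h = 0 \<and> odd_in N h \<and>
      (\<forall>x. norm x \<le> r i / 2 \<longrightarrow> \<bar>peval h x\<bar> \<le> B * r i powr \<beta> + B * r i powr \<gamma>) \<and>
      (\<forall>x. norm x \<le> r i / 2 \<longrightarrow> \<bar>peval h x\<bar> \<le> 6 * n * (B * r i powr \<beta>) / r i * \<bar>x $ N\<bar> + 3 * (B * r i powr \<gamma>)) \<and>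
      (\<forall>x\<in>\<Omega>. norm x \<le> r i / 2 \<longrightarrow>
        \<bar>u x - peval P x - peval h x\<bar> \<le> 24 * n * (B * r i powr \<beta>) * \<delta> i / r i + 6 * (B * r i powr \<gamma>))" for i
    proof (rule harmonic_approximation[of "r i" "\<delta> i" "B * r i powr \<gamma>" P "B * r i powr \<beta>"])
      show "\<bar>u x - peval P x\<bar> \<le> B * r i powr \<beta>" if x: "x \<in> \<Omega>" "norm x < r i" for x
      proof -
        have "\<bar>u x - peval P x\<bar> \<le> B * norm x powr \<beta>" using uP x r(3)[of i] by simp
        also have "\<dots> \<le> B * r i powr \<beta>" using B \<beta> x by (intro mult_left_mono powr_mono2) auto
        finally show ?thesis .
      qed
      show "\<bar>u x - peval P x\<bar> \<le> B * r i powr \<gamma>" if "x \<in> frontier \<Omega>" "norm x < r i" for x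
        using data r[of i] that by (simp add: data_controlled_def)
      have "B * r i powr \<gamma> / (r i)\<^sup>2 = B * r i powr (\<gamma> - 2)"
        using r(1)[of i] by (simp add: powr_diff)
      then show "\<bar>f x - peval (lap P) x\<bar> \<le> B * r i powr \<gamma> / (r i)\<^sup>2" if "x \<in> \<Omega>" "norm x < r i" for x
        using data r[of i] that by (simp add: data_controlled_def)
      show "\<exists>h. lap h = 0 \<and> odd_in N h \<and>
        (\<forall>x. norm x \<le> r i / 2 \<longrightarrow> \<bar>peval h x\<bar> \<le> B * r i powr \<beta> + B * r i powr \<gamma>) \<and>
        (\<forall>x. norm x \<le> r i / 2 \<longrightarrow> \<bar>peval h x\<bar> \<le> 6 * n * (B * r i powr \<beta>) / r i * \<bar>x $ N\<bar> + 3 * (B * r i powr \<gamma>)) \<and>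
        (\<forall>x\<in>\<Omega>. norm x \<le> r i / 2 \<longrightarrow>
          \<bar>u x - peval P x - peval h x\<bar> \<le> 24 * n * (B * r i powr \<beta>) * \<delta> i / r i + 6 * (B * r i powr \<gamma>))"
        if "lap h = 0" "odd_in N h"
          "\<And>x. norm x \<le> r i / 2 \<Longrightarrow> \<bar>peval h x\<bar> \<le> B * r i powr \<beta> + B * r i powr \<gamma>"
          "\<And>x. norm x \<le> r i / 2 \<Longrightarrow> \<bar>peval h x\<bar> \<le> 6 * n * (B * r i powr \<beta>) / r i * \<bar>x $ N\<bar> + 3 * (B * r i powr \<gamma>)"
          "\<And>x. x \<in> \<Omega> \<Longrightarrow> norm x \<le> r i / 2 \<Longrightarrow>
            \<bar>u x - peval P x - peval h x\<bar> \<le> 24 * n * (B * r i powr \<beta>) * \<delta> i / r i + 6 * (B * r i powr \<gamma>)" for h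
        using that by blast
      show "0 < B * r i powr \<gamma>" using B r(1)[of i] by simp
    qed (use r \<delta> lower upper B in auto)
    then obtain h where h: "\<And>i. lap (h i) = 0" "\<And>i. odd_in N (h i)"
      "\<And>i x. norm x \<le> r i / 2 \<Longrightarrow> \<bar>peval (h i) x\<bar> \<le> B * r i powr \<beta> + B * r i powr \<gamma>"
      "\<And>i x. norm x \<le> r i / 2 \<Longrightarrow> \<bar>peval (h i) x\<bar> \<le> 6 * n * (B * r i powr \<beta>) / r i * \<bar>x $ N\<bar> + 3 * (B * r i powr \<gamma>)"
      "\<And>i x. x \<in> \<Omega> \<Longrightarrow> norm x \<le> r i / 2 \<Longrightarrow>
            \<bar>u x - peval P x - peval (h i) x\<bar> \<le> 24 * n * (B * r i powr \<beta>) * \<delta> i / r i + 6 * (B * r i powr \<gamma>)"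
      by metis
    have approx: "\<bar>u x - peval P x - peval (h i) x\<bar> \<le> C1 * (B * r i powr \<gamma>)" if "x \<in> \<Omega>" "norm x \<le> r i / 2" for i x
    proof -
      have "24 * n * (B * r i powr \<beta> * \<delta> i / r i) \<le> 24 * n * (K * (B * r i powr \<gamma>))"
        using A\<delta>[of i] n by (intro mult_left_mono) auto
      then show ?thesis using h(5)[OF that] by (simp add: C1_def algebra_simps)
    qed
    have mono_r: "B * r (Suc i) powr \<gamma> \<le> B * r i powr \<gamma>" for i
      using B r(1)[of i] \<gamma> by (intro mult_left_mono powr_mono2) (auto simp: r(4))
    have strip: "\<bar>peval (h i) x\<bar> \<le> (6 * n * K + 3) * (B * r i powr \<gamma>)" if "norm x \<le> r i / 2" "\<bar>x $ N\<bar> \<le> \<delta> i" for i x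
    proof -
      have "6 * n * (B * r i powr \<beta>) / r i * \<bar>x $ N\<bar> \<le> 6 * n * (B * r i powr \<beta>) / r i * \<delta> i"
        using that n B r(1)[of i] by (intro mult_left_mono) auto
      also have "\<dots> = 6 * n * (B * r i powr \<beta> * \<delta> i / r i)" by simp
      also have "\<dots> \<le> 6 * n * (K * (B * r i powr \<gamma>))" using A\<delta>[of i] n by (intro mult_left_mono) auto
      finally show ?thesis using h(4)[OF that(1)] by (simp add: algebra_simps)
    qed
    have strip': "\<bar>peval (h (Suc i)) x\<bar> \<le> (12 * n * K + 3) * (B * r i powr \<gamma>)"
      if x: "norm x \<le> r (Suc i) / 2" "\<bar>x $ N\<bar> \<le> \<delta> i" for i x
    proof -
      have "r (Suc i) powr \<beta> \<le> r i powr \<beta>" using r(1)[of i] \<beta> by (intro powr_mono2) (auto simp: r(4))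
      then have "6 * n * (B * r (Suc i) powr \<beta>) / r (Suc i) * \<bar>x $ N\<bar> \<le> 6 * n * (B * r i powr \<beta>) / r (Suc i) * \<delta> i"
        using x n B r(1)[of "Suc i"] by (intro mult_mono divide_right_mono mult_left_mono) auto
      also have "\<dots> = 12 * n * (B * r i powr \<beta> * \<delta> i / r i)" by (simp add: r(4))
      also have "\<dots> \<le> 12 * n * (K * (B * r i powr \<gamma>))" using A\<delta>[of i] n by (intro mult_left_mono) auto
      finally show ?thesis using h(4)[OF x(1)] mono_r[of i] by (simp add: algebra_simps)
    qed
    have Y: "0 \<le> B * r i powr \<gamma>" for i using B by simp
    have diff: "\<bar>peval (h (Suc i) - h i) x\<bar> \<le> 2 * C1 * (B * r i powr \<gamma>)" if x: "norm x \<le> r (Suc i) / 2" for i x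
    proof -
      have x': "norm x \<le> r i / 2" "norm x < r i" using x r[of i] by simp_all
      have above: "\<bar>peval (h (Suc i) - h i) y\<bar> \<le> 2 * C1 * (B * r i powr \<gamma>)" if "norm y = norm x" "\<delta> i < y $ N" for y
      proof -
        have y: "y \<in> \<Omega>" by (rule upper[of y i]) (use that x' in auto)
        have "C1 * (B * r (Suc i) powr \<gamma>) \<le> C1 * (B * r i powr \<gamma>)" using mult_left_mono[OF mono_r, of C1 i] C1 by simp
        then show ?thesis using approx[OF y, of i] approx[OF y, of "Suc i"] that x x' by (simp add: peval_diff)
      qed
      consider "\<delta> i < x $ N" | "\<delta> i < - (x $ N)" | "\<bar>x $ N\<bar> \<le> \<delta> i" by linarith
      then show ?thesis
      proof cases
        case 1 then show ?thesis using above by blast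
      next
        case 2
        then show ?thesis
          using above[of "reflect N x"] peval_reflect_odd[OF odd_in_diff[OF h(2) h(2)], of "Suc i" i x] by simp
      next
        case 3
        have "\<bar>peval (h (Suc i) - h i) x\<bar> \<le> (12 * n * K + 3) * (B * r i powr \<gamma>) + (6 * n * K + 3) * (B * r i powr \<gamma>)"
          using strip[OF x'(1) 3] strip'[OF x 3] by (simp add: peval_diff)
        also have "\<dots> = (18 * n * K + 6) * (B * r i powr \<gamma>)" by (simp add: algebra_simps)
        also have "\<dots> \<le> 2 * C1 * (B * r i powr \<gamma>)"
        proof (rule mult_right_mono[OF _ Y])
          have "0 \<le> n * K" using n K by simp
          then show "18 * n * K + 6 \<le> 2 * C1" by (simp add: C1_def mult.commute[of n K])
        qed
        finally show ?thesis .
      qed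
    qed
    have r\<rho>: "r i = 4 * (\<rho> / 2 ^ i)" for i by (simp add: r_def \<rho>_def)
    have r_powr: "r i powr \<gamma> = 4 powr \<gamma> * (\<rho> / 2 ^ i) powr \<gamma>" for i
      unfolding r\<rho> by (rule powr_mult)
    have "\<exists>H. lap H = 0 \<and> odd_in N H \<and> H \<in> polys m \<and> (\<forall>\<sigma>. \<bar>lookup H \<sigma>\<bar> \<le> C0 * (C2 * B)) \<and>
        (\<forall>i x. norm x \<le> \<rho> / 2 ^ i / 2 ^ Suc m \<longrightarrow> \<bar>peval (h i) x - peval H x\<bar> \<le> C0 * (C2 * B) * (\<rho> / 2 ^ i) powr \<gamma>)"
    proof (rule C0(2)[OF \<rho> _ h(1,2)])
      show "0 \<le> C2 * B" using C2 B by simp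
      fix x :: "real ^ 'n" assume "norm x \<le> \<rho>"
      then have "\<bar>peval (h 0) x\<bar> \<le> B * r 0 powr \<beta> + B * r 0 powr \<gamma>" using r0 by (intro h(3)) (simp add: r_def \<rho>_def)
      also have "\<dots> \<le> B * 1 + B * 1"
        using B r[of 0] \<beta> \<gamma> by (intro add_mono mult_left_mono powr_le1) auto
      also have "\<dots> = (2 / \<rho> powr \<gamma>) * B * \<rho> powr \<gamma>" using \<rho> by simp
      also have "\<dots> \<le> C2 * B * \<rho> powr \<gamma>"
        using C1 B by (intro mult_right_mono) (auto simp: C2_def)
      finally show "\<bar>peval (h 0) x\<bar> \<le> C2 * B * \<rho> powr \<gamma>" .
    next
      fix i and x :: "real ^ 'n" assume "norm x \<le> \<rho> / 2 ^ i"
      then have "\<bar>peval (h (Suc i) - h i) x\<bar> \<le> 2 * C1 * (B * r i powr \<gamma>)"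
        by (intro diff) (simp add: r_def \<rho>_def)
      also have "\<dots> = (2 * C1 * 4 powr \<gamma>) * B * (\<rho> / 2 ^ i) powr \<gamma>" by (simp add: r_powr)
      also have "\<dots> \<le> C2 * B * (\<rho> / 2 ^ i) powr \<gamma>"
        using B by (intro mult_right_mono) (auto simp: C2_def)
      finally show "\<bar>peval (h (Suc i) - h i) x\<bar> \<le> C2 * B * (\<rho> / 2 ^ i) powr \<gamma>" .
    qed
    then obtain H where H: "lap H = 0" "odd_in N H" "H \<in> polys m" "\<And>\<sigma>. \<bar>lookup H \<sigma>\<bar> \<le> C0 * (C2 * B)"
      "\<And>i x. norm x \<le> \<rho> / 2 ^ i / 2 ^ Suc m \<Longrightarrow> \<bar>peval (h i) x - peval H x\<bar> \<le> C0 * (C2 * B) * (\<rho> / 2 ^ i) powr \<gamma>" by blast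
    have "\<bar>lookup H \<sigma>\<bar> \<le> C * B" for \<sigma>
    proof -
      have "C0 * C2 * B \<le> C * B" using C B by (intro mult_right_mono) auto
      then show ?thesis using H(4)[of \<sigma>] by simp
    qed
    moreover have "\<bar>u x - peval P x - peval H x\<bar> \<le> C * B * norm x powr \<gamma>" if x: "x \<in> \<Omega>" "norm x < 1" for x
    proof -
      have "x \<noteq> 0" using flat x by (auto simp: flat_boundary_def)
      then have x0: "0 < norm x" by simp
      show ?thesis
      proof (cases "norm x \<le> s0")
        case True
        \<comment> \<open>The scale is measured from s0, so that x lies in the smaller ball on which
          H is known to approximate \<open>h i\<close>.\<close>
        obtain i where i: "s0 / 2 ^ Suc i < norm x" "norm x \<le> s0 / 2 ^ i" using dyadic_scale[OF x0 True] .
        have le1: "norm x \<le> \<rho> / 2 ^ i / 2 ^ Suc m" using i by (simp add: s0_def field_simps)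
        also have "\<dots> \<le> \<rho> / 2 ^ i / 1" using \<rho> one_le_power[of "2 :: real" "Suc m"] by (intro divide_left_mono) auto
        also have "\<dots> \<le> r i / 2"
        proof -
          have "z / 1 \<le> 4 * z / 2" if "0 \<le> z" for z :: real using that by simp
          then show ?thesis unfolding r\<rho> using \<rho> by (meson divide_nonneg_nonneg less_imp_le zero_le_power zero_le_numeral)
        qed
        finally have le2: "norm x \<le> r i / 2" .
        have "\<rho> / 2 ^ i \<le> 2 * 2 ^ Suc m * norm x" using i by (simp add: s0_def field_simps)
        then have pw: "(\<rho> / 2 ^ i) powr \<gamma> \<le> (2 * 2 ^ Suc m) powr \<gamma> * norm x powr \<gamma>"
          using \<rho> \<gamma> powr_mono2[of \<gamma> "\<rho> / 2 ^ i" "2 * 2 ^ Suc m * norm x"] by (simp add: powr_mult)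
        have "\<bar>u x - peval P x - peval H x\<bar> \<le> C1 * (B * r i powr \<gamma>) + C0 * (C2 * B) * (\<rho> / 2 ^ i) powr \<gamma>"
          using approx[OF x(1) le2] H(5)[OF le1] by linarith
        also have "\<dots> = (C1 * 4 powr \<gamma> + C0 * C2) * B * (\<rho> / 2 ^ i) powr \<gamma>"
          by (simp add: r_powr algebra_simps)
        also have "\<dots> \<le> (C1 * 4 powr \<gamma> + C0 * C2) * B * ((2 * 2 ^ Suc m) powr \<gamma> * norm x powr \<gamma>)"
          using C0 C1 C2 B pw by (intro mult_left_mono) auto
        also have "\<dots> = ((C1 * 4 powr \<gamma> + C0 * C2) * (2 * 2 ^ Suc m) powr \<gamma>) * (B * norm x powr \<gamma>)"
          by (simp only: mult_ac)
        also have "\<dots> \<le> C * (B * norm x powr \<gamma>)" using C(3) B by (intro mult_right_mono) auto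
        finally show ?thesis by (simp only: mult_ac)
      next
        \<comment> \<open>Away from the origin a crude bound is enough, as |x|^\<gamma> \<ge>
          s0^\<gamma>.\<close>
        case False
        have "\<bar>u x - peval P x\<bar> \<le> B * norm x powr \<beta>" by (rule uP[OF x])
        also have "\<dots> \<le> B * 1" using B \<beta> x by (intro mult_left_mono powr_le1) auto
        finally have 1: "\<bar>u x - peval P x\<bar> \<le> B" by simp
        have "\<bar>peval H x\<bar> \<le> cnorm H * norm x ^ 0"
          by (rule peval_le_cnorm) (use x in \<open>auto simp: low_order_def\<close>)
        also have "\<dots> \<le> M * (C0 * (C2 * B))" using cnorm_polys_le[OF H(3,4)] by (simp add: M_def)
        finally have "\<bar>u x - peval P x - peval H x\<bar> \<le> (1 + M * (C0 * C2)) * B * 1" using 1 by (simp add: algebra_simps)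
        also have "\<dots> \<le> (1 + M * (C0 * C2)) * B * (norm x powr \<gamma> / s0 powr \<gamma>)"
        proof (rule mult_left_mono)
          have "s0 powr \<gamma> \<le> norm x powr \<gamma>" using False s0 \<gamma> by (intro powr_mono2) auto
          then show "1 \<le> norm x powr \<gamma> / s0 powr \<gamma>" using s0 by simp
        qed (use C0 C2 B in \<open>auto simp: M_def\<close>)
        also have "\<dots> = (1 + M * (C0 * C2)) / s0 powr \<gamma> * (B * norm x powr \<gamma>)" by simp
        also have "\<dots> \<le> C * (B * norm x powr \<gamma>)" using C(4) B by (intro mult_right_mono) auto
        finally show ?thesis by (simp only: mult_ac)
      qed
    qed
    ultimately show "\<exists>H. lap H = 0 \<and> odd_in N H \<and> H \<in> polys m \<and> (\<forall>\<sigma>. \<bar>lookup H \<sigma>\<bar> \<le> C * B) \<and>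
          (\<forall>x\<in>\<Omega>. norm x < 1 \<longrightarrow> \<bar>u x - peval P x - peval H x\<bar> \<le> C * B * norm x powr \<gamma>)"
      using H(1-3) by blast
  qed
qed

section \<open>Polynomials of high order along the domain\<close>

lemma peval_homogeneous_scale: "homogeneous d P \<Longrightarrow> peval P (t *\<^sub>R x) = t ^ d * peval P x"
proof -
  assume P: "homogeneous d P"
  have "mon \<sigma> (t *\<^sub>R x) = t ^ mdeg \<sigma> * mon \<sigma> x" for \<sigma>
    by (simp add: mon_def mdeg_def power_sum power_mult_distrib prod.distrib)
  then show ?thesis
    using P by (auto simp: peval_def sum_distrib_left homogeneous_def in_keys_iff intro!: sum.cong)
qed

text \<open>All derivatives vanish on the open half space too; their values at 0, approached along
  the N-th axis, are the coefficients up to a factor.\<close>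

lemma half_space_vanishing:
  fixes P :: "'n::finite mpoly"
  assumes "\<And>x. 0 < x $ N \<Longrightarrow> peval P x = 0"
  shows "P = 0"
proof -
  have "\<forall>R :: 'n mpoly. (\<forall>x. 0 < x $ N \<longrightarrow> peval R x = 0) \<longrightarrow> lookup R \<sigma> = 0" for \<sigma>
  proof (induction \<sigma> rule: expo_induct)
    case zero
    show ?case
    proof (intro allI impI)
      fix R :: "'n mpoly" assume R: "\<forall>x. 0 < x $ N \<longrightarrow> peval R x = 0"
      have "isCont (\<lambda>t. peval R (0 + t *\<^sub>R axis N 1)) 0"
        by (rule DERIV_isCont[OF peval_DERIV_line])
      then have "((\<lambda>t. peval R (t *\<^sub>R axis N 1)) \<longlongrightarrow> peval R 0) (at_right 0)"
        by (simp add: isCont_def filterlim_at_split)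
      moreover have "eventually (\<lambda>t. peval R (t *\<^sub>R axis N 1) = 0) (at_right 0)"
        using R by (auto simp: eventually_at_filter)
      ultimately have "((\<lambda>t::real. 0::real) \<longlongrightarrow> peval R 0) (at_right 0)"
        using tendsto_cong by fast
      then show "lookup R 0 = 0" by (simp add: lookup_0_eq_peval tendsto_const_iff)
    qed
  next
    case (add \<sigma> i)
    show ?case
    proof (intro allI impI)
      fix R :: "'n mpoly" assume R: "\<forall>x. 0 < x $ N \<longrightarrow> peval R x = 0"
      have "peval (pdiff i R) x = 0" if x: "0 < x $ N" for x
      proof (rule DERIV_local_const)
        show "((\<lambda>t. peval R (x + t *\<^sub>R axis i 1)) has_real_derivative peval (pdiff i R) x) (at 0)"
          using peval_DERIV_line[of R x "axis i 1" 0] by (simp add: sum_mult_axis)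
        show "0 < x $ N" by (rule x)
        have "0 < (x + t *\<^sub>R axis i 1) $ N" if "\<bar>0 - t\<bar> < x $ N" for t
          using that x by (cases "i = N") (simp_all add: axis_def)
        then show "\<forall>t. \<bar>0 - t\<bar> < x $ N \<longrightarrow> peval R (x + 0 *\<^sub>R axis i 1) = peval R (x + t *\<^sub>R axis i 1)"
          using R x by simp
      qed
      with add have "lookup (pdiff i R) \<sigma> = 0" by blast
      then show "lookup R (\<sigma> + expo i) = 0"
        by (simp add: lookup_pdiff add_nonneg_eq_0_iff)
    qed
  qed
  then show ?thesis using assms by (intro poly_mapping_eqI) auto
qed

text \<open>Once the lower coefficients are zero, dividing by t^j and letting t tend to 0 isolates
  \<open>c j\<close>.\<close>

lemma polynomial_leading_coefficient_0:
  fixes c :: "nat \<Rightarrow> real"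
  assumes bd: "eventually (\<lambda>t. \<bar>\<Sum>i\<le>m. t ^ i * c i\<bar> \<le> C * t powr \<beta>) (at_right 0)"
  shows "j \<le> m \<Longrightarrow> real j < \<beta> \<Longrightarrow> c j = 0"
proof (induction j rule: less_induct)
  case (less j)
  have low: "c i = 0" if "i < j" for i using less that by auto
  let ?g = "\<lambda>t. \<Sum>i\<in>{j..m}. t ^ (i - j) * c i"
  have split: "(\<Sum>i\<le>m. t ^ i * c i) = t ^ j * ?g t" for t
  proof -
    have "(\<Sum>i\<le>m. t ^ i * c i) = (\<Sum>i\<in>{j..m}. t ^ i * c i)"
      by (rule sum.mono_neutral_right) (use low in auto)
    then show ?thesis by (auto simp: sum_distrib_left mult.assoc[symmetric] power_add[symmetric] intro!: sum.cong)
  qed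
  have "eventually (\<lambda>t. \<bar>?g t\<bar> \<le> C * t powr (\<beta> - real j)) (at_right 0)"
    using bd eventually_at_right_less
  proof eventually_elim
    case (elim t)
    then have "t ^ j * \<bar>?g t\<bar> \<le> C * t powr \<beta>" by (simp add: split abs_mult)
    then show ?case using elim(2) by (simp add: powr_diff powr_realpow field_simps)
  qed
  moreover have "((\<lambda>t. C * t powr (\<beta> - real j)) \<longlongrightarrow> C * 0) (at_right 0)"
    using less.prems by (intro tendsto_intros tendsto_zero_powrI[where b = "\<beta> - real j"]) (auto simp: eventually_at_filter)
  ultimately have "((\<lambda>t. ?g t) \<longlongrightarrow> 0) (at_right 0)"
    by (intro Lim_null_comparison[of ?g "\<lambda>t. C * t powr (\<beta> - real j)"]) auto
  moreover have "(?g \<longlongrightarrow> ?g 0) (at_right 0)" by (intro tendsto_intros)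
  ultimately have "?g 0 = 0" using tendsto_unique[OF trivial_limit_at_right_real] by blast
  moreover have "?g 0 = (\<Sum>i\<in>{j..m}. if i = j then c j else 0)" by (rule sum.cong) auto
  ultimately show ?case using less.prems by simp
qed

text \<open>A ray with x_N > 0 starts inside \<Omega>, because the boundary leaves the plane only by
  O(t^(1+\<alpha>)). Along it the homogeneous parts are the coefficients of a polynomial in t, so
  those of degree below \<beta> vanish on a half space. Thus polynomials can be identified by their
  decay on \<Omega> alone.\<close>

lemma vanishing_low_order:
  fixes H :: "'n::finite mpoly"
  assumes flat: "flat_boundary K \<alpha> N \<Omega>" and K: "0 < K" and \<alpha>: "0 < \<alpha>"
    and bd: "\<And>x. x \<in> \<Omega> \<Longrightarrow> norm x < 1 \<Longrightarrow> \<bar>peval H x\<bar> \<le> C * norm x powr \<beta>"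
    and \<sigma>: "real (mdeg \<sigma>) < \<beta>"
  shows "lookup H \<sigma> = 0"
proof -
  define part where "part j = pfilter (\<lambda>\<sigma>. mdeg \<sigma> = j) H" for j
  have hom: "homogeneous j (part j)" for j by (auto simp: part_def homogeneous_def lookup_pfilter)
  obtain m where m: "\<And>\<tau>. lookup H \<tau> \<noteq> 0 \<Longrightarrow> mdeg \<tau> < m" using mpoly_degree_bound[of H] by blast
  have H: "H = (\<Sum>j\<le>m. part j)"
  proof (rule poly_mapping_eqI)
    fix \<tau>
    have "lookup (\<Sum>j\<le>m. part j) \<tau> = (\<Sum>j\<le>m. if j = mdeg \<tau> then lookup H \<tau> else 0)"
      unfolding lookup_sum by (rule sum.cong) (auto simp: part_def lookup_pfilter)
    moreover have "lookup H \<tau> = 0 \<or> mdeg \<tau> \<le> m" using m[of \<tau>] less_imp_le by blast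
    ultimately show "lookup H \<tau> = lookup (\<Sum>j\<le>m. part j) \<tau>" by auto
  qed
  have "peval (part (mdeg \<sigma>)) x = 0" if x: "0 < x $ N" for x
  proof (cases "mdeg \<sigma> \<le> m")
    case False
    then have "lookup H \<tau> = 0" if "mdeg \<tau> = mdeg \<sigma>" for \<tau>
      using m[of \<tau>] that by linarith
    then have "part (mdeg \<sigma>) = 0"
      by (intro poly_mapping_eqI) (simp add: part_def lookup_pfilter)
    then show ?thesis by simp
  next
    case True
    have x0: "norm x > 0" using x by auto
    have in_\<Omega>: "eventually (\<lambda>t. t *\<^sub>R x \<in> \<Omega> \<and> norm (t *\<^sub>R x) < 1) (at_right 0)"
    proof -
      have "((\<lambda>t. K * norm x powr (1 + \<alpha>) * t powr \<alpha>) \<longlongrightarrow> K * norm x powr (1 + \<alpha>) * 0) (at_right 0)"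
        using \<alpha> by (intro tendsto_intros tendsto_zero_powrI[where b = \<alpha>]) (auto simp: eventually_at_filter)
      then have "eventually (\<lambda>t. K * norm x powr (1 + \<alpha>) * t powr \<alpha> < x $ N) (at_right 0)"
        using x by (intro order_tendstoD) auto
      moreover have "((\<lambda>t. t * norm x) \<longlongrightarrow> 0 * norm x) (at_right (0::real))" by (intro tendsto_intros)
      then have "eventually (\<lambda>t. t * norm x < 1) (at_right (0::real))" by (intro order_tendstoD) auto
      ultimately show ?thesis using eventually_at_right_less
      proof eventually_elim
        case (elim t)
        have "K * norm (t *\<^sub>R x) powr (1 + \<alpha>) = t * (K * norm x powr (1 + \<alpha>) * t powr \<alpha>)"
          using elim(3) by (simp add: powr_mult powr_add)
        also have "\<dots> < t * x $ N" using elim by simp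
        finally have "K * norm (t *\<^sub>R x) powr (1 + \<alpha>) < (t *\<^sub>R x) $ N" by simp
        moreover have "norm (t *\<^sub>R x) < 1" using elim by simp
        ultimately show ?case using flat by (auto simp: flat_boundary_def)
      qed
    qed
    have "eventually (\<lambda>t. \<bar>\<Sum>i\<le>m. t ^ i * peval (part i) x\<bar> \<le> (C * norm x powr \<beta>) * t powr \<beta>) (at_right 0)"
      using in_\<Omega> eventually_at_right_less
    proof eventually_elim
      case (elim t)
      have "peval H (t *\<^sub>R x) = (\<Sum>i\<le>m. t ^ i * peval (part i) x)"
        by (subst H) (simp add: peval_sum peval_homogeneous_scale[OF hom])
      then show ?case using bd[of "t *\<^sub>R x"] elim by (simp add: powr_mult mult_ac)
    qed
    from polynomial_leading_coefficient_0[OF this True \<sigma>] show ?thesis .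
  qed
  then have "part (mdeg \<sigma>) = 0" by (rule half_space_vanishing)
  then have "lookup (part (mdeg \<sigma>)) \<sigma> = 0" by simp
  then show ?thesis by (simp add: part_def lookup_pfilter)
qed

section \<open>Gaining one order of approximation\<close>

lemma frontier_flat:
  assumes "open \<Omega>" "flat_boundary K \<alpha> N \<Omega>" "0 < K" "0 < \<alpha>" "x \<in> frontier \<Omega>" "norm x < 1"
  shows "\<bar>x $ N\<bar> \<le> K * norm x powr (1 + \<alpha>)"
proof -
  have "x \<notin> \<Omega>" "x \<in> closure \<Omega>" using assms by (auto simp: frontier_def interior_open)
  then have "x $ N \<le> K * norm x powr (1 + \<alpha>)" using assms by (force simp: flat_boundary_def)
  moreover have "- (x $ N) - K * norm x powr (1 + \<alpha>) \<le> 0"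
  proof (rule bound_extends_to_closure[of \<Omega> "ball 0 1" "\<lambda>x. - (x $ N) - K * norm x powr (1 + \<alpha>)"])
    show "continuous_on (closure \<Omega> \<inter> ball 0 1) (\<lambda>x. - (x $ N) - K * norm x powr (1 + \<alpha>))"
      using \<open>0 < \<alpha>\<close> by (intro continuous_intros continuous_on_powr') auto
    show "- (y $ N) - K * norm y powr (1 + \<alpha>) \<le> 0" if "y \<in> \<Omega> \<inter> ball 0 1" for y
      using assms(2) that by (force simp: flat_boundary_def)
  qed (use \<open>x \<in> closure \<Omega>\<close> assms in auto)
  ultimately show ?thesis by linarith
qed

text \<open>Every monomial contains x_N. On the boundary, where x_N = O(|x|^(1+\<alpha>)), H is
  therefore O(|x|^(m+1+\<alpha>)).\<close>

lemma peval_odd_homogeneous_le: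
  assumes "odd_in N H" "homogeneous (Suc m) H"
  shows "\<bar>peval H x\<bar> \<le> cnorm H * (norm x ^ m * \<bar>x $ N\<bar>)"
proof -
  have "\<bar>mon \<sigma> x\<bar> \<le> norm x ^ m * \<bar>x $ N\<bar>" if "\<sigma> \<in> keys H" for \<sigma>
  proof -
    have \<sigma>: "odd (lookup \<sigma> N)" "mdeg \<sigma> = Suc m"
      using assms that by (auto simp: odd_in_def homogeneous_def in_keys_iff)
    then obtain \<tau> where \<tau>: "\<sigma> = \<tau> + expo N" using expo_decompose[of \<sigma> N] by (metis even_zero gr0I)
    then have "mdeg \<tau> = m" using \<sigma> by (simp add: mdeg_add)
    moreover have "mon (expo N) x = x $ N"
      using peval_var[of N x] by (simp add: pvar_def peval_single)
    ultimately show ?thesis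
      using abs_mon_le[of \<tau> x] by (simp add: \<tau> mon_add abs_mult mult_right_mono)
  qed
  then have "\<bar>peval H x\<bar> \<le> (\<Sum>\<sigma>\<in>keys H. \<bar>lookup H \<sigma>\<bar> * (norm x ^ m * \<bar>x $ N\<bar>))"
    unfolding peval_def by (intro order_trans[OF sum_abs sum_mono]) (simp add: abs_mult mult_left_mono)
  then show ?thesis by (simp add: cnorm_def sum_distrib_right)
qed

text \<open>\<open>improvement_step\<close> is iterated along exponents from m + \<alpha> to m + 1 +
  \<alpha> that cross the integer m + 1 without hitting it. No correction has terms of degree at
  most m, since the error was already o(|x|^m); so everything accumulates in degree m + 1.\<close>

lemma order_gain:
  fixes m :: nat and \<alpha> K :: real
  assumes \<alpha>: "0 < \<alpha>" "\<alpha> < 1" and K: "0 < K"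
  shows "\<exists>C>0. \<forall>\<Omega> f u (N :: 'n::finite) P B.
    viscosity_problem \<Omega> f u (real CARD('n)) \<and> flat_boundary K \<alpha> N \<Omega> \<and> 0 < B \<and>
    (\<forall>x\<in>\<Omega>. norm x < 1 \<longrightarrow> \<bar>u x - peval P x\<bar> \<le> B * norm x powr (real m + \<alpha>)) \<and>
    data_controlled \<Omega> f u P B (real m + 1 + \<alpha>)
    \<longrightarrow> (\<exists>H. lap H = 0 \<and> odd_in N H \<and> homogeneous (Suc m) H \<and> cnorm H \<le> C * B \<and>
          (\<forall>x\<in>\<Omega>. norm x < 1 \<longrightarrow> \<bar>u x - peval P x - peval H x\<bar> \<le> C * B * norm x powr (real m + 1 + \<alpha>)))"
proof -
  obtain p :: nat where p: "(1 - \<alpha>) / \<alpha> < real p" using reals_Archimedean2 by blast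
  \<comment> \<open>The half-integer p + 1/2 keeps i s different from 1 - \<alpha> for every i, and
    p is large enough for s \<le> \<alpha>.\<close>
  define s where "s = (1 - \<alpha>) / (real p + 1 / 2)"
  have s: "0 < s" "s \<le> \<alpha>"
  proof -
    show "0 < s" using \<alpha> by (simp add: s_def add_nonneg_pos)
    have "1 - \<alpha> \<le> \<alpha> * (real p + 1 / 2)" using p \<alpha> by (simp add: field_simps)
    then show "s \<le> \<alpha>" unfolding s_def by (subst divide_le_eq) (auto simp: mult.commute)
  qed
  define b where "b i = min (real m + 1 + \<alpha>) (real m + \<alpha> + real i * s)" for i :: nat
  have b: "real m + \<alpha> \<le> b i" "b i \<le> real m + 1 + \<alpha>" "b (Suc i) \<le> b i + \<alpha>" for i
    using s \<alpha> by (auto simp: b_def algebra_simps min_def)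
  have b_ne: "b i \<noteq> real m + 1" for i
  proof
    assume "b i = real m + 1"
    then have "real i * s = 1 - \<alpha>" using \<alpha> by (auto simp: b_def min_def split: if_splits)
    then have "real i * (1 - \<alpha>) = (1 - \<alpha>) * (real p + 1 / 2)" by (simp add: s_def field_simps)
    then have "2 * real i = real (2 * p + 1)" using \<alpha> by simp
    then have "2 * i = 2 * p + 1" by linarith
    then show False by presburger
  qed
  let ?concl = "\<lambda>C \<beta>. \<forall>\<Omega> f u (N :: 'n) P B.
    viscosity_problem \<Omega> f u (real CARD('n)) \<and> flat_boundary K \<alpha> N \<Omega> \<and> 0 < B \<and>
    (\<forall>x\<in>\<Omega>. norm x < 1 \<longrightarrow> \<bar>u x - peval P x\<bar> \<le> B * norm x powr (real m + \<alpha>)) \<and>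
    data_controlled \<Omega> f u P B (real m + 1 + \<alpha>)
    \<longrightarrow> (\<exists>H. lap H = 0 \<and> odd_in N H \<and> homogeneous (Suc m) H \<and> cnorm H \<le> C * B \<and>
          (\<forall>x\<in>\<Omega>. norm x < 1 \<longrightarrow> \<bar>u x - peval P x - peval H x\<bar> \<le> C * B * norm x powr \<beta>))"
  have chain: "\<exists>C>0. ?concl C (b i)" for i
  proof (induction i)
    case 0
    have "b 0 = real m + \<alpha>" using \<alpha> by (simp add: b_def)
    then show ?case
      by (intro exI[of _ 1]) (auto intro!: exI[of _ 0] simp: odd_in_def)
  next
    case (Suc i)
    then obtain C1 where C1: "C1 > 0" "?concl C1 (b i)" by blast
    define m' where "m' = (if b (Suc i) < real m + 1 then m else Suc m)"
    have m': "real m' < b (Suc i)" "b (Suc i) < real m' + 1"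
      using b[of "Suc i"] b_ne[of "Suc i"] \<alpha> by (auto simp: m'_def)
    have "0 \<le> b i" using b(1)[of i] \<alpha> by linarith
    from improvement_step[OF \<alpha>(1) K this b(3) m', where 'n = 'n] obtain C2 where C2: "C2 > 0"
      "\<And>\<Omega> f u (N :: 'n) P B. viscosity_problem \<Omega> f u (real CARD('n)) \<Longrightarrow> flat_boundary K \<alpha> N \<Omega> \<Longrightarrow> 0 < B \<Longrightarrow>
        (\<forall>x\<in>\<Omega>. norm x < 1 \<longrightarrow> \<bar>u x - peval P x\<bar> \<le> B * norm x powr b i) \<Longrightarrow>
        data_controlled \<Omega> f u P B (b (Suc i)) \<Longrightarrow>
        \<exists>H. lap H = 0 \<and> odd_in N H \<and> H \<in> polys m' \<and> (\<forall>\<sigma>. \<bar>lookup H \<sigma>\<bar> \<le> C2 * B) \<and>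
          (\<forall>x\<in>\<Omega>. norm x < 1 \<longrightarrow> \<bar>u x - peval P x - peval H x\<bar> \<le> C2 * B * norm x powr b (Suc i))" by metis
    \<comment> \<open>1 + C1 K covers the boundary data after subtracting H, and C1 the error
      carried over.\<close>
    define D where "D = 1 + C1 * K + C1"
    have D: "D > 0" "C1 \<le> D" using C1 K by (auto simp: D_def add_pos_nonneg)
    define M where "M = real (card (monomials_upto m' :: ('n \<Rightarrow>\<^sub>0 nat) set))"
    define C where "C = C1 + M * (C2 * D) + C2 * D"
    have C: "C > 0" "C2 * D \<le> C" using C1 C2 D by (auto simp: C_def M_def add_pos_nonneg)
    show ?case
    proof (intro exI[of _ C] conjI allI impI C(1))
      fix \<Omega> f u and N :: 'n and P B
      assume asm: "viscosity_problem \<Omega> f u (real CARD('n)) \<and> flat_boundary K \<alpha> N \<Omega> \<and> 0 < B \<and>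
        (\<forall>x\<in>\<Omega>. norm x < 1 \<longrightarrow> \<bar>u x - peval P x\<bar> \<le> B * norm x powr (real m + \<alpha>)) \<and>
        data_controlled \<Omega> f u P B (real m + 1 + \<alpha>)"
      then obtain H where H: "lap H = 0" "odd_in N H" "homogeneous (Suc m) H" "cnorm H \<le> C1 * B"
        "\<And>x. x \<in> \<Omega> \<Longrightarrow> norm x < 1 \<Longrightarrow> \<bar>u x - peval P x - peval H x\<bar> \<le> C1 * B * norm x powr b i"
        using C1(2) by metis
      have B: "0 < B" and flat: "flat_boundary K \<alpha> N \<Omega>" and vp: "viscosity_problem \<Omega> f u (real CARD('n))"
        and data: "data_controlled \<Omega> f u P B (real m + 1 + \<alpha>)" using asm by blast+
      have op: "open \<Omega>" using vp by (simp add: viscosity_problem_def)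
      have DB: "0 < D * B" "C1 * B \<le> D * B" using D B by (auto intro: mult_right_mono)
      have near: "\<bar>u x - peval (P + H) x\<bar> \<le> D * B * norm x powr b i" if "x \<in> \<Omega>" "norm x < 1" for x
      proof -
        have "C1 * B * norm x powr b i \<le> D * B * norm x powr b i" by (rule mult_right_mono[OF DB(2)]) simp
        then show ?thesis using H(5)[OF that] by (simp add: peval_add)
      qed
      have ctrl: "data_controlled \<Omega> f u (P + H) (D * B) (b (Suc i))"
        unfolding data_controlled_def
      proof (intro allI impI conjI ballI)
        fix r :: real and x assume r: "0 < r \<and> r \<le> 1" and x: "x \<in> frontier \<Omega>" "norm x < r"
        have "\<bar>peval H x\<bar> \<le> cnorm H * (norm x ^ m * \<bar>x $ N\<bar>)"
          by (rule peval_odd_homogeneous_le[OF H(2,3)])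
        also have "\<dots> \<le> (C1 * B) * (r ^ m * (K * r powr (1 + \<alpha>)))"
        proof -
          have "\<bar>x $ N\<bar> \<le> K * norm x powr (1 + \<alpha>)"
            using frontier_flat[OF op flat K \<alpha>(1) x(1)] x r by simp
          also have "\<dots> \<le> K * r powr (1 + \<alpha>)" using x K \<alpha> by (intro mult_left_mono powr_mono2) auto
          finally show ?thesis using H(4) C1 B x r by (intro mult_mono power_mono) auto
        qed
        also have "\<dots> = C1 * K * B * r powr (real m + 1 + \<alpha>)"
          using r by (simp add: powr_add powr_realpow mult_ac)
        finally have "\<bar>peval H x\<bar> \<le> C1 * K * B * r powr (real m + 1 + \<alpha>)" .
        moreover have "\<bar>u x - peval P x\<bar> \<le> B * r powr (real m + 1 + \<alpha>)"
          using data r x by (auto simp: data_controlled_def)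
        ultimately have "\<bar>u x - peval (P + H) x\<bar> \<le> (1 + C1 * K) * B * r powr (real m + 1 + \<alpha>)"
          by (simp add: peval_add algebra_simps)
        also have "\<dots> \<le> D * B * r powr b (Suc i)"
          using r C1 K B D b[of "Suc i"] by (intro mult_mono powr_mono' mult_nonneg_nonneg) (auto simp: D_def)
        finally show "\<bar>u x - peval (P + H) x\<bar> \<le> D * B * r powr b (Suc i)" .
      next
        fix r :: real and x assume r: "0 < r \<and> r \<le> 1" and x: "x \<in> \<Omega>" "norm x < r"
        have "\<bar>f x - peval (lap (P + H)) x\<bar> \<le> B * r powr (real m + 1 + \<alpha> - 2)"
          using data r x by (auto simp: data_controlled_def lap_add H)
        also have "\<dots> \<le> D * B * r powr (b (Suc i) - 2)"
          using r C1 K B D b[of "Suc i"] by (intro mult_mono powr_mono') (auto simp: D_def)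
        finally show "\<bar>f x - peval (lap (P + H)) x\<bar> \<le> D * B * r powr (b (Suc i) - 2)" .
      qed
      obtain H' where H': "lap H' = 0" "odd_in N H'" "H' \<in> polys m'" "\<And>\<sigma>. \<bar>lookup H' \<sigma>\<bar> \<le> C2 * (D * B)"
          "\<And>x. x \<in> \<Omega> \<Longrightarrow> norm x < 1 \<Longrightarrow> \<bar>u x - peval (P + H) x - peval H' x\<bar> \<le> C2 * (D * B) * norm x powr b (Suc i)"
        using C2(2)[OF vp flat DB(1) _ ctrl] near by blast
      have low: "lookup H' \<sigma> = 0" if "mdeg \<sigma> \<le> m" for \<sigma>
      proof (rule vanishing_low_order[OF flat K \<alpha>(1)])
        show "real (mdeg \<sigma>) < b i" using that b(1)[of i] \<alpha> by linarith
        fix x assume x: "x \<in> \<Omega>" "norm x < 1"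
        have "b i \<le> b (Suc i)" using s by (auto simp: b_def min_def algebra_simps)
        then have "C2 * (D * B) * norm x powr b (Suc i) \<le> C2 * (D * B) * norm x powr b i"
          using x C2 DB by (intro mult_left_mono powr_mono') auto
        then show "\<bar>peval H' x\<bar> \<le> (C2 * (D * B) + D * B) * norm x powr b i"
          using H'(5)[OF x] near[OF x] by (simp add: algebra_simps)
      qed
      have hom': "homogeneous (Suc m) H'"
        unfolding homogeneous_def
      proof (intro allI impI)
        fix \<sigma> assume "lookup H' \<sigma> \<noteq> 0"
        then have "mdeg \<sigma> \<le> m'" "\<not> mdeg \<sigma> \<le> m" using H'(3) low by (auto simp: polys_iff)
        moreover have "m' \<le> Suc m" by (simp add: m'_def)
        ultimately show "mdeg \<sigma> = Suc m" by simp
      qed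
      have "cnorm (H + H') \<le> cnorm H + cnorm H'" by (rule cnorm_add)
      also have "\<dots> \<le> C1 * B + M * (C2 * (D * B))"
        using H(4) cnorm_polys_le[OF H'(3,4)] by (simp add: M_def)
      also have "\<dots> \<le> C * B" using C2 DB D B by (simp add: C_def algebra_simps)
      finally have "cnorm (H + H') \<le> C * B" .
      moreover have "\<bar>u x - peval P x - peval (H + H') x\<bar> \<le> C * B * norm x powr b (Suc i)"
        if x: "x \<in> \<Omega>" "norm x < 1" for x
      proof -
        have "\<bar>u x - peval P x - peval (H + H') x\<bar> \<le> C2 * D * (B * norm x powr b (Suc i))"
          using H'(5)[OF x] by (simp add: peval_add algebra_simps)
        also have "\<dots> \<le> C * (B * norm x powr b (Suc i))" using C(2) B by (intro mult_right_mono) auto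
        finally show ?thesis by (simp add: mult.assoc)
      qed
      ultimately show "\<exists>H. lap H = 0 \<and> odd_in N H \<and> homogeneous (Suc m) H \<and> cnorm H \<le> C * B \<and>
          (\<forall>x\<in>\<Omega>. norm x < 1 \<longrightarrow> \<bar>u x - peval P x - peval H x\<bar> \<le> C * B * norm x powr b (Suc i))"
        using H H' hom' by (intro exI[of _ "H + H'"]) (auto simp: lap_add odd_in_add homogeneous_add)
    qed
  qed
  obtain i :: nat where "1 / s < real i" using reals_Archimedean2 by blast
  then have "b i = real m + 1 + \<alpha>" using s by (simp add: b_def field_simps)
  with chain[of i] show ?thesis by simp
qed

section \<open>Polynomial Cauchy data on a hyperplane\<close>

lemma cnorm_pconst_mult: "cnorm (pconst c * P) \<le> \<bar>c\<bar> * cnorm P"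
  using cnorm_mult[of "pconst c" P] by (simp add: pconst_def cnorm_single)

lemma mpoly_expand_pconst:
  "(P :: 'n::finite mpoly) = (\<Sum>\<sigma>\<in>keys P. pconst (lookup P \<sigma>) * Poly_Mapping.single \<sigma> 1)"
proof -
  have "pconst c * Poly_Mapping.single \<sigma> 1 = Poly_Mapping.single \<sigma> c" for c and \<sigma> :: "'n \<Rightarrow>\<^sub>0 nat"
    by (simp add: pconst_def mult_single)
  then show ?thesis using mpoly_expand[of P] by simp
qed

lemma cnorm_monomial_combination:
  fixes p :: "'n::finite mpoly"
  assumes "finite S" "keys p \<subseteq> S"
  shows "cnorm (\<Sum>\<sigma>\<in>keys p. pconst (lookup p \<sigma>) * F \<sigma>) \<le> cnorm p * (\<Sum>\<sigma>\<in>S. cnorm (F \<sigma>))"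
proof -
  have "cnorm (\<Sum>\<sigma>\<in>keys p. pconst (lookup p \<sigma>) * F \<sigma>) \<le> (\<Sum>\<sigma>\<in>keys p. \<bar>lookup p \<sigma>\<bar> * (\<Sum>\<sigma>\<in>S. cnorm (F \<sigma>)))"
  proof (rule order_trans[OF cnorm_sum sum_mono])
    fix \<sigma> assume "\<sigma> \<in> keys p"
    then have "cnorm (F \<sigma>) \<le> (\<Sum>\<sigma>\<in>S. cnorm (F \<sigma>))"
      using assms by (intro member_le_sum) (auto simp: cnorm_nonneg)
    then show "cnorm (pconst (lookup p \<sigma>) * F \<sigma>) \<le> \<bar>lookup p \<sigma>\<bar> * (\<Sum>\<sigma>\<in>S. cnorm (F \<sigma>))"
      using cnorm_pconst_mult[of "lookup p \<sigma>" "F \<sigma>"] mult_left_mono[of "cnorm (F \<sigma>)" _ "\<bar>lookup p \<sigma>\<bar>"]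
      by (meson abs_ge_zero order_trans)
  qed
  then show ?thesis by (simp add: cnorm_def sum_distrib_right)
qed

text \<open>Value and normal derivative vanish on x_N = 0: zero Cauchy data.\<close>

definition divisible_sq :: "'n \<Rightarrow> 'n::finite mpoly \<Rightarrow> bool" where
  "divisible_sq N P \<longleftrightarrow> (\<forall>\<sigma>. lookup P \<sigma> \<noteq> 0 \<longrightarrow> 2 \<le> lookup \<sigma> N)"

lemma divisible_sq_add: "divisible_sq N P \<Longrightarrow> divisible_sq N Q \<Longrightarrow> divisible_sq N (P + Q)"
  unfolding divisible_sq_def by (metis add_0 lookup_add)

lemma divisible_sq_diff: "divisible_sq N P \<Longrightarrow> divisible_sq N Q \<Longrightarrow> divisible_sq N (P - Q)"
  unfolding divisible_sq_def by (metis diff_0_right lookup_minus)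

lemma divisible_sq_pconst_mult: "divisible_sq N P \<Longrightarrow> divisible_sq N (pconst c * P)"
  by (simp add: divisible_sq_def lookup_pconst_mult)

lemma divisible_sq_0 [simp]: "divisible_sq N 0"
  by (simp add: divisible_sq_def)

lemma divisible_sq_sum: "(\<And>a. a \<in> A \<Longrightarrow> divisible_sq N (F a)) \<Longrightarrow> divisible_sq N (sum F A)"
  by (induction A rule: infinite_finite_induct) (auto intro: divisible_sq_add)

text \<open>
  The leading contribution to \<open>\<Delta>(x\<^sub>N\<^sup>2 x\<^sup>\<sigma>)\<close> is a multiple of \<open>x\<^sup>\<sigma>\<close>; the other terms have the same
  degree but a smaller degree in the remaining variables, whence an induction.
\<close>

lemma lap_right_inverse_monomial:
  fixes \<sigma> :: "'n::finite \<Rightarrow>\<^sub>0 nat"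
  shows "\<exists>Q. lap Q = Poly_Mapping.single \<sigma> 1 \<and> homogeneous (mdeg \<sigma> + 2) Q \<and> divisible_sq N Q"
proof (induction "mdeg \<sigma> - lookup \<sigma> N" arbitrary: \<sigma> rule: less_induct)
  case less
  define a where "a = (real (lookup \<sigma> N) + 1) * (real (lookup \<sigma> N) + 2)"
  have a: "a > 0" by (simp add: a_def add_nonneg_pos)
  \<comment> \<open>a is the factor produced by differentiating twice in x_N, so this derivative of
    Q1 is exactly the wanted monomial and E collects the second derivatives in the other
    directions.\<close>
  define Q1 where "Q1 = Poly_Mapping.single (\<sigma> + expo N + expo N) (1 / a)"
  define E where "E = lap Q1 - Poly_Mapping.single \<sigma> 1"
  have E: "lookup E \<tau> = (\<Sum>i\<in>UNIV - {N}. (real (lookup \<tau> i) + 1) * (real (lookup \<tau> i) + 2) * lookup Q1 (\<tau> + expo i + expo i))" for \<tau>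
  proof -
    have "(real (lookup \<tau> N) + 1) * (real (lookup \<tau> N) + 2) * lookup Q1 (\<tau> + expo N + expo N) = lookup (Poly_Mapping.single \<sigma> 1) \<tau>"
      using a by (auto simp: Q1_def lookup_single when_def a_def)
    then show ?thesis unfolding E_def lookup_minus lookup_lap
      by (subst sum.remove[of UNIV N]) auto
  qed
  \<comment> \<open>The exponent of x_N rises by 2 in fixed degree, which decreases the induction
    measure.\<close>
  have keyE: "mdeg \<tau> = mdeg \<sigma> \<and> lookup \<tau> N = lookup \<sigma> N + 2" if "lookup E \<tau> \<noteq> 0" for \<tau>
  proof -
    have "\<exists>i. i \<noteq> N \<and> lookup Q1 (\<tau> + expo i + expo i) \<noteq> 0"
    proof (rule ccontr)
      assume "\<not> ?thesis"
      then have "lookup E \<tau> = 0" unfolding E by (intro sum.neutral) auto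
      with that show False by simp
    qed
    then obtain i where i: "i \<noteq> N" "lookup Q1 (\<tau> + expo i + expo i) \<noteq> 0" by blast
    then have eq: "\<sigma> + expo N + expo N = \<tau> + expo i + expo i"
      by (auto simp: Q1_def lookup_single when_def split: if_splits)
    have "mdeg \<tau> = mdeg \<sigma>" using arg_cong[OF eq, of mdeg] by (simp add: mdeg_add)
    moreover have "lookup \<tau> N = lookup \<sigma> N + 2"
      using arg_cong[OF eq, of "\<lambda>\<tau>. lookup \<tau> N"] i by (simp add: lookup_add lookup_single)
    ultimately show ?thesis by blast
  qed
  have "\<exists>Q. lap Q = Poly_Mapping.single \<tau> 1 \<and> homogeneous (mdeg \<sigma> + 2) Q \<and> divisible_sq N Q" if "lookup E \<tau> \<noteq> 0" for \<tau>
  proof -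
    have "mdeg \<tau> - lookup \<tau> N < mdeg \<sigma> - lookup \<sigma> N"
      using keyE[OF that] lookup_le_mdeg[of \<tau> N] by simp
    from less[OF this] show ?thesis using keyE[OF that] by simp
  qed
  then obtain F where F: "\<And>\<tau>. lookup E \<tau> \<noteq> 0 \<Longrightarrow> lap (F \<tau>) = Poly_Mapping.single \<tau> 1"
    "\<And>\<tau>. lookup E \<tau> \<noteq> 0 \<Longrightarrow> homogeneous (mdeg \<sigma> + 2) (F \<tau>)" "\<And>\<tau>. lookup E \<tau> \<noteq> 0 \<Longrightarrow> divisible_sq N (F \<tau>)" by metis
  define Q2 where "Q2 = (\<Sum>\<tau>\<in>keys E. pconst (lookup E \<tau>) * F \<tau>)"
  have "lap Q2 = (\<Sum>\<tau>\<in>keys E. pconst (lookup E \<tau>) * Poly_Mapping.single \<tau> 1)"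
    unfolding Q2_def lap_sum by (rule sum.cong) (auto simp: lap_pconst_mult F in_keys_iff)
  then have "lap (Q1 - Q2) = Poly_Mapping.single \<sigma> 1"
    using mpoly_expand_pconst[of E] by (simp add: lap_diff E_def)
  moreover have "homogeneous (mdeg \<sigma> + 2) (Q1 - Q2)"
    unfolding Q2_def
    by (intro homogeneous_diff homogeneous_sum homogeneous_pconst_mult F)
       (auto simp: homogeneous_def Q1_def lookup_single when_def mdeg_add in_keys_iff split: if_splits)
  moreover have "divisible_sq N (Q1 - Q2)"
    unfolding Q2_def
    by (intro divisible_sq_diff divisible_sq_sum divisible_sq_pconst_mult F)
       (auto simp: divisible_sq_def Q1_def lookup_single when_def lookup_add in_keys_iff split: if_splits)
  ultimately show ?case by blast
qed

text \<open>Solutions for single monomials are fixed once and combined linearly; finiteness of the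
  monomials of degree d and of the indices N yields a uniform constant.\<close>

lemma lap_right_inverse:
  "\<exists>c>0. \<forall>(N :: 'n::finite) p. homogeneous d p \<longrightarrow>
     (\<exists>Q. lap Q = p \<and> homogeneous (d + 2) Q \<and> divisible_sq N Q \<and> cnorm Q \<le> c * cnorm p)"
proof -
  obtain F :: "'n \<Rightarrow> ('n \<Rightarrow>\<^sub>0 nat) \<Rightarrow> 'n mpoly" where F: "\<And>N \<sigma>. lap (F N \<sigma>) = Poly_Mapping.single \<sigma> 1"
    "\<And>N \<sigma>. homogeneous (mdeg \<sigma> + 2) (F N \<sigma>)" "\<And>N \<sigma>. divisible_sq N (F N \<sigma>)"
    using lap_right_inverse_monomial by metis
  let ?S = "{\<sigma> :: 'n \<Rightarrow>\<^sub>0 nat. mdeg \<sigma> = d}"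
  let ?c = "1 + (\<Sum>N\<in>UNIV. \<Sum>\<sigma>\<in>?S. cnorm (F N \<sigma>))"
  show ?thesis
  proof (intro exI[of _ ?c] conjI allI impI)
    show "0 < ?c" by (intro add_pos_nonneg sum_nonneg) (auto simp: cnorm_nonneg)
    fix N :: 'n and p :: "'n mpoly" assume p: "homogeneous d p"
    then have S: "keys p \<subseteq> ?S" by (auto simp: homogeneous_def in_keys_iff)
    define Q where "Q = (\<Sum>\<sigma>\<in>keys p. pconst (lookup p \<sigma>) * F N \<sigma>)"
    have "lap Q = p"
      unfolding Q_def lap_sum lap_pconst_mult F by (rule mpoly_expand_pconst[symmetric])
    moreover have "homogeneous (d + 2) Q"
      unfolding Q_def using F(2)[of _ N] p
      by (intro homogeneous_sum homogeneous_pconst_mult) (metis homogeneous_def in_keys_iff)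
    moreover have "divisible_sq N Q"
      unfolding Q_def by (intro divisible_sq_sum divisible_sq_pconst_mult F)
    moreover have "cnorm Q \<le> ?c * cnorm p"
    proof -
      have "cnorm Q \<le> cnorm p * (\<Sum>\<sigma>\<in>?S. cnorm (F N \<sigma>))"
        unfolding Q_def by (rule cnorm_monomial_combination[OF finite_mdeg_eq S])
      also have "\<dots> \<le> cnorm p * ?c"
      proof (rule mult_left_mono[OF _ cnorm_nonneg])
        have "(\<Sum>\<sigma>\<in>?S. cnorm (F N \<sigma>)) \<le> (\<Sum>N\<in>UNIV. \<Sum>\<sigma>\<in>?S. cnorm (F N \<sigma>))"
          by (rule member_le_sum[of N UNIV "\<lambda>N. \<Sum>\<sigma>\<in>?S. cnorm (F N \<sigma>)"])
             (auto intro: sum_nonneg simp: cnorm_nonneg)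
        then show "(\<Sum>\<sigma>\<in>?S. cnorm (F N \<sigma>)) \<le> ?c" by simp
      qed
      finally show ?thesis by (simp add: mult.commute)
    qed
    ultimately show "\<exists>Q. lap Q = p \<and> homogeneous (d + 2) Q \<and> divisible_sq N Q \<and> cnorm Q \<le> ?c * cnorm p" by blast
  qed
qed

lemma cnorm_lap_le:
  "\<exists>c>0. \<forall>P :: 'n::finite mpoly. homogeneous d P \<longrightarrow> cnorm (lap P) \<le> c * cnorm P"
proof -
  let ?S = "{\<sigma> :: 'n \<Rightarrow>\<^sub>0 nat. mdeg \<sigma> = d}"
  let ?c = "1 + (\<Sum>\<sigma>\<in>?S. cnorm (lap (Poly_Mapping.single \<sigma> 1 :: 'n mpoly)))"
  show ?thesis
  proof (intro exI[of _ ?c] conjI allI impI)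
    show "0 < ?c" by (intro add_pos_nonneg sum_nonneg) (auto simp: cnorm_nonneg)
    fix P :: "'n mpoly" assume "homogeneous d P"
    then have S: "keys P \<subseteq> ?S" by (auto simp: homogeneous_def in_keys_iff)
    have "lap P = (\<Sum>\<sigma>\<in>keys P. pconst (lookup P \<sigma>) * lap (Poly_Mapping.single \<sigma> 1))"
      by (subst (1) mpoly_expand_pconst[of P]) (simp add: lap_sum lap_pconst_mult)
    then have "cnorm (lap P) \<le> cnorm P * (\<Sum>\<sigma>\<in>?S. cnorm (lap (Poly_Mapping.single \<sigma> 1 :: 'n mpoly)))"
      using cnorm_monomial_combination[OF finite_mdeg_eq S, of "\<lambda>\<sigma>. lap (Poly_Mapping.single \<sigma> 1)"] by simp
    also have "\<dots> \<le> cnorm P * ?c" by (intro mult_left_mono) (auto simp: cnorm_nonneg)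
    finally show "cnorm (lap P) \<le> ?c * cnorm P" by (simp add: mult.commute)
  qed
qed

text \<open>Q = q + Q0, where Q0 has zero Cauchy data and Laplacian p - \<Delta>q. The condition
  \<open>mdeg \<sigma> + 2 = d\<close> forces p = 0 when d < 2, which homogeneity of degree d - 2
  with truncated subtraction would not.\<close>

lemma cauchy_data:
  "\<exists>c>0. \<forall>(N :: 'n::finite) p q. (\<forall>\<sigma>. lookup p \<sigma> \<noteq> 0 \<longrightarrow> mdeg \<sigma> + 2 = d) \<and> homogeneous d q \<longrightarrow>
     (\<exists>Q. lap Q = p \<and> homogeneous d Q \<and> divisible_sq N (Q - q) \<and> cnorm Q \<le> c * (cnorm p + cnorm q))"
proof -
  obtain c1 where c1: "c1 > 0" "\<And>(N :: 'n) p. homogeneous (d - 2) p \<Longrightarrow>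
     \<exists>Q. lap Q = p \<and> homogeneous (d - 2 + 2) Q \<and> divisible_sq N Q \<and> cnorm Q \<le> c1 * cnorm p"
    using lap_right_inverse[where 'n = 'n, of "d - 2"] by blast
  obtain c2 where c2: "c2 > 0" "\<And>P :: 'n mpoly. homogeneous d P \<Longrightarrow> cnorm (lap P) \<le> c2 * cnorm P"
    using cnorm_lap_le[where 'n = 'n, of d] by blast
  show ?thesis
  proof (intro exI[of _ "1 + c1 + c1 * c2"] conjI allI impI)
    show "0 < 1 + c1 + c1 * c2" using c1 c2 by (simp add: add_pos_pos)
    fix N :: 'n and p q :: "'n mpoly"
    assume asm: "(\<forall>\<sigma>. lookup p \<sigma> \<noteq> 0 \<longrightarrow> mdeg \<sigma> + 2 = d) \<and> homogeneous d q"
    obtain Q0 where Q0: "lap Q0 = p - lap q" "homogeneous d Q0" "divisible_sq N Q0" "cnorm Q0 \<le> c1 * cnorm (p - lap q)"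
    proof (cases "d < 2")
      case True
      have "p = 0" using asm True by (intro poly_mapping_eqI) (metis add_2_eq_Suc' lookup_zero not_add_less2)
      moreover have "lap q = 0" using lap_homogeneous_lt_2 True asm by blast
      ultimately show ?thesis using that[of 0] by (simp add: divisible_sq_def)
    next
      case False
      have "homogeneous (d - 2) p" using asm by (auto simp: homogeneous_def)
      then have "homogeneous (d - 2) (p - lap q)" using homogeneous_lap asm by (intro homogeneous_diff) auto
      moreover have "d - 2 + 2 = d" using False by simp
      ultimately show ?thesis using c1(2)[of "p - lap q" N] that by auto
    qed
    have "cnorm (q + Q0) \<le> cnorm q + cnorm Q0" by (rule cnorm_add)
    also have "cnorm Q0 \<le> c1 * (cnorm p + c2 * cnorm q)"
      using Q0(4) c1(1) cnorm_diff[of p "lap q"] c2(2)[of q] asm by (smt (verit) mult_left_mono)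
    also have "cnorm q + c1 * (cnorm p + c2 * cnorm q) \<le> (1 + c1 + c1 * c2) * (cnorm p + cnorm q)"
      using c1(1) c2(1) cnorm_nonneg[of p] cnorm_nonneg[of q] by (simp add: algebra_simps add_nonneg_nonneg)
    finally have "cnorm (q + Q0) \<le> (1 + c1 + c1 * c2) * (cnorm p + cnorm q)" by simp
    then show "\<exists>Q. lap Q = p \<and> homogeneous d Q \<and> divisible_sq N (Q - q) \<and>
        cnorm Q \<le> (1 + c1 + c1 * c2) * (cnorm p + cnorm q)"
      using Q0 asm by (intro exI[of _ "q + Q0"]) (auto simp: lap_add homogeneous_add)
  qed
qed

section \<open>Substitution of the boundary polynomial\<close>

lemma psubst_add: "psubst N (P + R) Q = psubst N P Q + psubst N R Q"
  and psubst_diff: "psubst N (P - R) Q = psubst N P Q - psubst N R Q"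
  by (rule peval_inject, simp add: peval_psubst peval_add peval_diff)+

definition free_of :: "'n \<Rightarrow> 'n::finite mpoly \<Rightarrow> bool" where
  "free_of N P \<longleftrightarrow> (\<forall>\<sigma>. lookup P \<sigma> \<noteq> 0 \<longrightarrow> lookup \<sigma> N = 0)"

lemma peval_free_of: "free_of N P \<Longrightarrow> (\<And>i. i \<noteq> N \<Longrightarrow> x $ i = y $ i) \<Longrightarrow> peval P x = peval P y"
  unfolding peval_def mon_def
proof (intro sum.cong refl arg_cong[where f = "(*) _"] prod.cong)
  fix \<sigma> i assume "free_of N P" "\<And>i. i \<noteq> N \<Longrightarrow> x $ i = y $ i" "\<sigma> \<in> keys P"
  then show "x $ i ^ lookup \<sigma> i = y $ i ^ lookup \<sigma> i" by (cases "i = N") (auto simp: free_of_def in_keys_iff)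
qed

lemma psubst_free_of: "free_of N P \<Longrightarrow> psubst N P Q = P"
  by (rule peval_inject) (auto simp: peval_psubst intro!: peval_free_of[of N])

lemma free_of_mult: "free_of N P \<Longrightarrow> free_of N Q \<Longrightarrow> free_of N (P * Q)"
  unfolding free_of_def by (metis lookup_mult_nonzero lookup_add add_is_0)

lemma free_of_sum: "(\<And>a. a \<in> A \<Longrightarrow> free_of N (F a)) \<Longrightarrow> free_of N (sum F A)"
proof (induction A rule: infinite_finite_induct)
  case (insert a A)
  then show ?case unfolding free_of_def by (simp add: lookup_add) (metis add_0)
qed (auto simp: free_of_def)

lemma free_of_pconst [simp]: "free_of N (pconst c)"
  by (auto simp: free_of_def pconst_def lookup_single when_def)

lemma free_of_1 [simp]: "free_of N 1"
  using free_of_pconst[of N 1] by (simp only: pconst_1)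

lemma free_of_power: "free_of N P \<Longrightarrow> free_of N (P ^ j)"
  by (induction j) (auto intro: free_of_mult)

lemma free_of_prod: "(\<And>a. a \<in> A \<Longrightarrow> free_of N (F a)) \<Longrightarrow> free_of N (prod F A)"
  by (induction A rule: infinite_finite_induct) (auto intro: free_of_mult)

lemma free_of_psubst: "free_of N Q \<Longrightarrow> free_of N (psubst N P Q)"
  unfolding psubst_def
  by (intro free_of_sum free_of_mult free_of_prod free_of_power)
     (auto simp: free_of_def pvar_def pconst_def lookup_single when_def split: if_splits)

lemma low_order_0 [simp]: "low_order 0 P"
  by (simp add: low_order_def)

lemma low_order_power: "low_order d P \<Longrightarrow> low_order (j * d) (P ^ j)"
proof (induction j)
  case (Suc j)
  then show ?case using low_order_mult[of d P "j * d" "P ^ j"] by simp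
qed simp

lemma low_order_prod: "finite A \<Longrightarrow> (\<And>a. a \<in> A \<Longrightarrow> low_order (d a) (F a)) \<Longrightarrow> low_order (\<Sum>a\<in>A. d a) (prod F A)"
  by (induction A rule: finite_induct) (auto intro: low_order_mult)

lemma low_order_add: "low_order d P \<Longrightarrow> low_order d Q \<Longrightarrow> low_order d (P + Q)"
  unfolding low_order_def by (metis add_0 lookup_add)

lemma low_order_diff: "low_order d P \<Longrightarrow> low_order d Q \<Longrightarrow> low_order d (P - Q)"
  unfolding low_order_def by (metis diff_0_right lookup_minus)

lemma low_order_sum: "(\<And>a. a \<in> A \<Longrightarrow> low_order d (F a)) \<Longrightarrow> low_order d (sum F A)"
  by (induction A rule: infinite_finite_induct) (auto intro: low_order_add simp: low_order_def[of _ 0])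

lemma low_order_mono: "low_order d P \<Longrightarrow> e \<le> d \<Longrightarrow> low_order e P"
  unfolding low_order_def by (meson order_trans)

text \<open>Q vanishes to second order, so each factor x_N counts twice. A monomial containing x_N
  therefore rises by at least one degree: this is why odd polynomials and multiples of x_N^2 do not
  affect the boundary values in their own degree.\<close>

lemma low_order_psubst:
  assumes Q: "low_order 2 Q" and P: "\<And>\<sigma>. lookup P \<sigma> \<noteq> 0 \<Longrightarrow> e \<le> mdeg \<sigma> + lookup \<sigma> N"
  shows "low_order e (psubst N P Q)"
  unfolding psubst_def
proof (rule low_order_sum)
  fix \<sigma> assume "\<sigma> \<in> keys P"
  then have e: "e \<le> mdeg \<sigma> + lookup \<sigma> N" using P by (simp add: in_keys_iff)
  have v: "low_order 1 (pvar i)" for i :: 'a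
    using homogeneous_pvar[of i] by (simp add: low_order_def homogeneous_def)
  have "low_order (\<Sum>i\<in>UNIV. lookup \<sigma> i * (if i = N then 2 else 1)) (\<Prod>i\<in>UNIV. (if i = N then Q else pvar i) ^ lookup \<sigma> i)"
    by (rule low_order_prod) (use low_order_power[OF Q] low_order_power[OF v] in auto)
  moreover have "(\<Sum>i\<in>UNIV. lookup \<sigma> i * (if i = N then 2 else 1)) = mdeg \<sigma> + lookup \<sigma> N"
  proof -
    have "(\<Sum>i\<in>UNIV. lookup \<sigma> i * (if i = N then 2 else 1)) = (\<Sum>i\<in>UNIV. lookup \<sigma> i + (if i = N then lookup \<sigma> i else 0))"
      by (rule sum.cong) auto
    then show ?thesis by (simp add: sum.distrib mdeg_def)
  qed
  ultimately have "low_order (0 + (mdeg \<sigma> + lookup \<sigma> N)) (pconst (lookup P \<sigma>) * (\<Prod>i\<in>UNIV. (if i = N then Q else pvar i) ^ lookup \<sigma> i))"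
    by (intro low_order_mult) auto
  then show "low_order e (pconst (lookup P \<sigma>) * (\<Prod>i\<in>UNIV. (if i = N then Q else pvar i) ^ lookup \<sigma> i))"
    using e low_order_mono by fastforce
qed

lemma cnorm_prod:
  fixes F :: "'a \<Rightarrow> 'n::finite mpoly"
  shows "cnorm (prod F A) \<le> (\<Prod>a\<in>A. cnorm (F a))"
proof (induction A rule: infinite_finite_induct)
  case (insert a A)
  then show ?case
    using cnorm_mult[of "F a" "prod F A"] mult_left_mono[OF insert.IH cnorm_nonneg[of "F a"]] by simp
qed (use cnorm_single[of "0 :: 'n \<Rightarrow>\<^sub>0 nat" 1] in auto)

lemma cnorm_psubst:
  assumes P: "P \<in> polys d" and Q: "cnorm Q \<le> M" "1 \<le> M"
  shows "cnorm (psubst N P Q) \<le> M ^ d * cnorm (P :: 'n::finite mpoly)"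
proof -
  have "cnorm (psubst N P Q) \<le> (\<Sum>\<sigma>\<in>keys P. \<bar>lookup P \<sigma>\<bar> * M ^ d)"
    unfolding psubst_def
  proof (rule order_trans[OF cnorm_sum sum_mono])
    fix \<sigma> assume "\<sigma> \<in> keys P"
    then have d: "mdeg \<sigma> \<le> d" using P by (simp add: polys_def)
    have f: "cnorm (if i = N then Q else pvar i) \<le> M" for i
      using Q cnorm_single[of "Poly_Mapping.single i 1 :: 'n \<Rightarrow>\<^sub>0 nat" 1] by (simp add: pvar_def)
    have "cnorm (\<Prod>i\<in>UNIV. (if i = N then Q else pvar i) ^ lookup \<sigma> i) \<le> (\<Prod>i\<in>UNIV. cnorm ((if i = N then Q else pvar i) ^ lookup \<sigma> i))"
      by (rule cnorm_prod)
    also have "\<dots> \<le> (\<Prod>i\<in>UNIV. M ^ lookup \<sigma> i)"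
    proof (intro prod_mono conjI cnorm_nonneg)
      fix i
      show "cnorm ((if i = N then Q else pvar i) ^ lookup \<sigma> i) \<le> M ^ lookup \<sigma> i"
        by (rule order_trans[OF cnorm_power power_mono[OF f cnorm_nonneg]])
    qed
    also have "\<dots> = M ^ mdeg \<sigma>" by (simp add: power_sum mdeg_def)
    also have "\<dots> \<le> M ^ d" using d Q by (intro power_increasing) auto
    finally show "cnorm (pconst (lookup P \<sigma>) * (\<Prod>i\<in>UNIV. (if i = N then Q else pvar i) ^ lookup \<sigma> i)) \<le> \<bar>lookup P \<sigma>\<bar> * M ^ d"
      by (intro order_trans[OF cnorm_pconst_mult mult_left_mono]) auto
  qed
  then show ?thesis by (simp add: cnorm_def sum_distrib_left mult.commute)
qed

text \<open>In each monomial the difference of the powers of x_N and Q contains one factor x_N - Q;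
  the remaining factors, at least e in number, are each O(|x|). So vanishing of P to order e + 1
  becomes the gain |x|^e.\<close>

lemma peval_psubst_diff:
  assumes P: "P \<in> polys d" "low_order (Suc e) P" and x: "norm x \<le> 1" "\<bar>peval Q x\<bar> \<le> L * norm x" and L: "1 \<le> L"
  shows "\<bar>peval P x - peval (psubst N P Q) x\<bar> \<le> real d * L ^ d * cnorm P * (norm x ^ e * \<bar>x $ N - peval Q x\<bar>)"
proof -
  define z where "z = (\<chi> i. if i = N then peval Q x else x $ i)"
  have "\<bar>mon \<sigma> x - mon \<sigma> z\<bar> \<le> real d * L ^ d * (norm x ^ e * \<bar>x $ N - peval Q x\<bar>)" if "\<sigma> \<in> keys P" for \<sigma>
  proof -
    have \<sigma>: "Suc e \<le> mdeg \<sigma>" "mdeg \<sigma> \<le> d" using P that by (auto simp: low_order_def polys_iff in_keys_iff)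
    define R where "R = (\<Prod>i\<in>UNIV - {N}. x $ i ^ lookup \<sigma> i)"
    define j where "j = lookup \<sigma> N"
    have mx: "mon \<sigma> x = x $ N ^ j * R"
      unfolding mon_def R_def j_def by (rule prod.remove) auto
    have mz: "mon \<sigma> z = peval Q x ^ j * R"
    proof -
      have "(\<Prod>i\<in>UNIV - {N}. z $ i ^ lookup \<sigma> i) = R" unfolding R_def by (rule prod.cong) (auto simp: z_def)
      then show ?thesis unfolding mon_def j_def by (subst prod.remove[of UNIV N]) (auto simp: z_def)
    qed
    have degR: "mdeg \<sigma> = j + (\<Sum>i\<in>UNIV - {N}. lookup \<sigma> i)"
      unfolding mdeg_def j_def by (rule sum.remove) auto
    have R: "\<bar>R\<bar> \<le> norm x ^ (mdeg \<sigma> - j)"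
    proof -
      have "\<bar>R\<bar> = (\<Prod>i\<in>UNIV - {N}. \<bar>x $ i\<bar> ^ lookup \<sigma> i)" by (simp add: R_def abs_prod power_abs)
      also have "\<dots> \<le> (\<Prod>i\<in>UNIV - {N}. norm x ^ lookup \<sigma> i)"
        by (intro prod_mono conjI power_mono) (auto simp: component_le_norm_cart)
      finally show ?thesis by (simp add: power_sum[symmetric] degR)
    qed
    show ?thesis
    proof (cases j)
      case 0
      then show ?thesis using L by (auto simp: mx mz intro!: mult_nonneg_nonneg)
    next
      case (Suc j')
      have "x $ N ^ j - peval Q x ^ j = (x $ N - peval Q x) * (\<Sum>i<j. x $ N ^ i * peval Q x ^ (j' - i))"
        unfolding Suc by (rule diff_power_eq_sum)
      also have "\<bar>\<dots>\<bar> \<le> \<bar>x $ N - peval Q x\<bar> * (real j * (L ^ d * norm x ^ j'))"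
        unfolding abs_mult
      proof (rule mult_left_mono)
        have "\<bar>x $ N ^ i * peval Q x ^ (j' - i)\<bar> \<le> L ^ d * norm x ^ j'" if "i \<in> {..<j}" for i
        proof -
          have "\<bar>x $ N ^ i * peval Q x ^ (j' - i)\<bar> \<le> norm x ^ i * (L * norm x) ^ (j' - i)"
            unfolding abs_mult power_abs
            by (intro mult_mono power_mono) (use L x in \<open>auto simp: component_le_norm_cart\<close>)
          also have "\<dots> = L ^ (j' - i) * norm x ^ (i + (j' - i))" by (simp add: power_mult_distrib power_add)
          also have "\<dots> = L ^ (j' - i) * norm x ^ j'" using that Suc by simp
          also have "\<dots> \<le> L ^ d * norm x ^ j'"
            using \<sigma> degR Suc L by (intro mult_right_mono power_increasing) auto
          finally show ?thesis .
        qed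
        then show "\<bar>\<Sum>i<j. x $ N ^ i * peval Q x ^ (j' - i)\<bar> \<le> real j * (L ^ d * norm x ^ j')"
          by (intro order_trans[OF sum_abs order_trans[OF sum_bounded_above]]) auto
      qed auto
      finally have "\<bar>x $ N ^ j - peval Q x ^ j\<bar> \<le> \<bar>x $ N - peval Q x\<bar> * (real j * (L ^ d * norm x ^ j'))" .
      then have "\<bar>mon \<sigma> x - mon \<sigma> z\<bar> \<le> (\<bar>x $ N - peval Q x\<bar> * (real j * (L ^ d * norm x ^ j'))) * norm x ^ (mdeg \<sigma> - j)"
        unfolding mx mz left_diff_distrib[symmetric] abs_mult using R L by (intro mult_mono) auto
      also have "\<dots> = \<bar>x $ N - peval Q x\<bar> * L ^ d * (real j * norm x ^ (mdeg \<sigma> - 1))"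
        using degR Suc by (simp add: power_add[symmetric])
      also have "\<dots> \<le> \<bar>x $ N - peval Q x\<bar> * L ^ d * (real d * norm x ^ e)"
        using \<sigma> degR x L by (intro mult_left_mono mult_mono power_decreasing) auto
      finally show ?thesis by (simp add: mult_ac)
    qed
  qed
  then have "\<bar>\<Sum>\<sigma>\<in>keys P. lookup P \<sigma> * mon \<sigma> x - lookup P \<sigma> * mon \<sigma> z\<bar> \<le>
      (\<Sum>\<sigma>\<in>keys P. \<bar>lookup P \<sigma>\<bar> * (real d * L ^ d * (norm x ^ e * \<bar>x $ N - peval Q x\<bar>)))"
    by (intro order_trans[OF sum_abs sum_mono])
       (auto simp: right_diff_distrib[symmetric] abs_mult intro!: mult_left_mono)
  moreover have "peval (psubst N P Q) x = peval P z" by (simp add: peval_psubst z_def)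
  ultimately show ?thesis
    by (simp add: peval_def[of P] sum_subtractf cnorm_def sum_distrib_right sum_distrib_left mult_ac)
qed

section \<open>The boundary expansion\<close>

lemma power_mult_powr: "0 \<le> y \<Longrightarrow> y ^ e * y powr s = y powr (real e + s)" for y s :: real
  by (cases "y = 0") (auto simp: powr_add powr_realpow)

text \<open>At y = 0 the right side is 0 while the zeroth power would be 1; hence 0 < j.\<close>

lemma power_le_powr:
  fixes y s :: real
  assumes "0 \<le> y" "y \<le> 1" "s \<le> real j" "0 < j"
  shows "y ^ j \<le> y powr s"
proof (cases "y = 0")
  case False
  then have "y ^ j = y powr real j" using assms by (simp add: powr_realpow)
  also have "\<dots> \<le> y powr s" using assms by (intro powr_mono') auto
  finally show ?thesis .
qed (use assms in \<open>auto simp: zero_power\<close>)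

text \<open>S dominates the data. The decay of u of order k + \<alpha> carries an unspecified B,
  because the constants derived from this predicate must not depend on it.\<close>

definition dirichlet_data ::
    "nat \<Rightarrow> nat \<Rightarrow> real \<Rightarrow> real \<Rightarrow> real \<Rightarrow> 'n::finite \<Rightarrow> (real ^ 'n) set \<Rightarrow> (real ^ 'n \<Rightarrow> real) \<Rightarrow> (real ^ 'n \<Rightarrow> real) \<Rightarrow>
     'n mpoly \<Rightarrow> 'n mpoly \<Rightarrow> 'n mpoly \<Rightarrow> real \<Rightarrow> bool" where
  "dirichlet_data k l \<alpha> K M N \<Omega> f u Pf Pg Pb S \<longleftrightarrow>
     viscosity_problem \<Omega> f u (real CARD('n)) \<and> flat_boundary K \<alpha> N \<Omega> \<and> 0 < S \<and>
     (\<forall>x\<in>\<Omega>. norm x < 1 \<longrightarrow> \<bar>u x\<bar> \<le> S) \<and>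
     (\<exists>B. \<forall>x\<in>\<Omega>. norm x < 1 \<longrightarrow> \<bar>u x\<bar> \<le> B * norm x powr (real k + \<alpha>)) \<and>
     (\<forall>x\<in>frontier \<Omega>. norm x < 1 \<longrightarrow> \<bar>u x - peval Pg x\<bar> \<le> S * norm x powr (real (k + l) + \<alpha>)) \<and>
     (\<forall>x\<in>\<Omega>. norm x < 1 \<longrightarrow> \<bar>f x - peval Pf x\<bar> \<le> S * norm x powr (real (k + l - 2) + \<alpha>)) \<and>
     cnorm Pf \<le> S \<and> Pg \<in> polys (k + l) \<and> low_order (Suc k) Pg \<and> cnorm Pg \<le> S \<and>
     low_order 2 Pb \<and> free_of N Pb \<and> cnorm Pb \<le> M \<and>
     (\<forall>x\<in>frontier \<Omega>. norm x < 1 \<longrightarrow> \<bar>x $ N - peval Pb x\<bar> \<le> K * norm x powr (real l + \<alpha>))"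

text \<open>\<open>improvement_step\<close> from \<beta> = 0 to \<gamma> = \<alpha>: the correction
  is a constant that is odd in x_N, hence 0.\<close>

lemma expansion_start:
  fixes k l :: nat and \<alpha> K M :: real
  assumes \<alpha>: "0 < \<alpha>" "\<alpha> < 1" and K: "0 < K" and kl: "1 \<le> k" "1 \<le> l"
  shows "\<exists>C>0. \<forall>(N :: 'n::finite) \<Omega> f u Pf Pg Pb S. dirichlet_data k l \<alpha> K M N \<Omega> f u Pf Pg Pb S \<longrightarrow>
    (\<forall>x\<in>\<Omega>. norm x < 1 \<longrightarrow> \<bar>u x\<bar> \<le> C * S * norm x powr \<alpha>)"
proof -
  obtain C where C: "C > 0" "\<And>\<Omega> f u (N :: 'n) P B. viscosity_problem \<Omega> f u (real CARD('n)) \<Longrightarrow> flat_boundary K \<alpha> N \<Omega> \<Longrightarrow> 0 < B \<Longrightarrow>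
        (\<forall>x\<in>\<Omega>. norm x < 1 \<longrightarrow> \<bar>u x - peval P x\<bar> \<le> B * norm x powr 0) \<Longrightarrow>
        data_controlled \<Omega> f u P B \<alpha> \<Longrightarrow>
        \<exists>H. lap H = 0 \<and> odd_in N H \<and> H \<in> polys 0 \<and> (\<forall>\<sigma>. \<bar>lookup H \<sigma>\<bar> \<le> C * B) \<and>
          (\<forall>x\<in>\<Omega>. norm x < 1 \<longrightarrow> \<bar>u x - peval P x - peval H x\<bar> \<le> C * B * norm x powr \<alpha>)"
    using improvement_step[where 'n = 'n, OF \<alpha>(1) K, of 0 \<alpha> 0] \<alpha> by auto
  show ?thesis
  proof (intro exI[of _ "2 * C"] conjI allI impI ballI)
    show "0 < 2 * C" using C by simp
    fix N :: 'n and \<Omega> f u Pf Pg Pb S x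
    assume data: "dirichlet_data k l \<alpha> K M N \<Omega> f u Pf Pg Pb S" and x: "x \<in> \<Omega>" "norm x < 1"
    then have S: "0 < S" and flat: "flat_boundary K \<alpha> N \<Omega>" and vp: "viscosity_problem \<Omega> f u (real CARD('n))"
      by (auto simp: dirichlet_data_def)
    have "data_controlled \<Omega> f u 0 (2 * S) \<alpha>"
      unfolding data_controlled_def
    proof (intro allI impI conjI ballI)
      fix r :: real and y assume r: "0 < r \<and> r \<le> 1" and y: "y \<in> frontier \<Omega>" "norm y < r"
      have yr: "norm y powr \<alpha> \<le> r powr \<alpha>" using y \<alpha> by (intro powr_mono2) auto
      have "\<bar>u y - peval Pg y\<bar> \<le> S * norm y powr (real (k + l) + \<alpha>)"
        using data y r by (auto simp: dirichlet_data_def)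
      also have "norm y powr (real (k + l) + \<alpha>) \<le> norm y powr \<alpha>" using y r by (intro powr_mono') auto
      also note yr
      finally have 1: "\<bar>u y - peval Pg y\<bar> \<le> S * r powr \<alpha>" using S by simp
      have "\<bar>peval Pg y\<bar> \<le> cnorm Pg * norm y ^ Suc k"
        using data y r by (intro peval_le_cnorm) (auto simp: dirichlet_data_def)
      also have "\<dots> \<le> S * r powr \<alpha>"
      proof (rule mult_mono)
        have "norm y ^ Suc k \<le> norm y powr \<alpha>" using y r \<alpha> by (intro power_le_powr) auto
        then show "norm y ^ Suc k \<le> r powr \<alpha>" using yr by linarith
        show "cnorm Pg \<le> S" using data by (simp add: dirichlet_data_def)
      qed (use S in auto)
      finally show "\<bar>u y - peval 0 y\<bar> \<le> 2 * S * r powr \<alpha>" using 1 by simp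
    next
      fix r :: real and y assume r: "0 < r \<and> r \<le> 1" and y: "y \<in> \<Omega>" "norm y < r"
      have "\<bar>f y - peval Pf y\<bar> \<le> S * norm y powr (real (k + l - 2) + \<alpha>)"
        using data y r by (auto simp: dirichlet_data_def)
      also have "norm y powr (real (k + l - 2) + \<alpha>) \<le> 1" using y r \<alpha> by (intro powr_le1) auto
      finally have 1: "\<bar>f y - peval Pf y\<bar> \<le> S" using S by simp
      have "\<bar>peval Pf y\<bar> \<le> cnorm Pf * norm y ^ 0" using y r by (intro peval_le_cnorm) auto
      then have "\<bar>peval Pf y\<bar> \<le> S" using data by (simp add: dirichlet_data_def)
      then have "\<bar>f y\<bar> \<le> 2 * S * 1" using 1 by simp
      also have "\<dots> \<le> 2 * S * r powr (\<alpha> - 2)"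
        using S r \<alpha> powr_mono'[of "\<alpha> - 2" 0 r] by (intro mult_left_mono) auto
      finally show "\<bar>f y - peval (lap 0) y\<bar> \<le> 2 * S * r powr (\<alpha> - 2)" by simp
    qed
    moreover have "\<forall>x\<in>\<Omega>. norm x < 1 \<longrightarrow> \<bar>u x - peval 0 x\<bar> \<le> 2 * S * norm x powr 0"
    proof (intro ballI impI)
      fix x assume x: "x \<in> \<Omega>" "norm x < 1"
      \<comment> \<open>\<open>norm x powr 0\<close> equals 1 only away from the origin.\<close>
      then have "x \<noteq> 0" using flat by (auto simp: flat_boundary_def)
      moreover have "\<bar>u x\<bar> \<le> S" using data x by (auto simp: dirichlet_data_def)
      ultimately show "\<bar>u x - peval 0 x\<bar> \<le> 2 * S * norm x powr 0" using S by simp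
    qed
    ultimately obtain H where H: "odd_in N H" "H \<in> polys 0"
      "\<And>x. x \<in> \<Omega> \<Longrightarrow> norm x < 1 \<Longrightarrow> \<bar>u x - peval 0 x - peval H x\<bar> \<le> C * (2 * S) * norm x powr \<alpha>"
      using C(2)[OF vp flat, of "2 * S" 0] S by auto
    have "H = 0"
    proof (rule poly_mapping_eqI, rule ccontr)
      fix \<sigma> assume "lookup H \<sigma> \<noteq> lookup 0 \<sigma>"
      then have "lookup H \<sigma> \<noteq> 0" by simp
      then have "\<sigma> = 0" "odd (lookup \<sigma> N)" using H(1,2) by (auto simp: polys_iff odd_in_def mdeg_eq_0)
      then show False by simp
    qed
    then show "\<bar>u x\<bar> \<le> 2 * C * S * norm x powr \<alpha>" using H(3)[OF x] by (simp add: mult_ac)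
  qed
qed

text \<open>The Laplacian of a polynomial of degree m can match only the part of P_f of degree at
  most m - 2; the condition on \<open>psubst\<close> says that the boundary values of P and P_g
  agree to order m.\<close>

definition expansion ::
    "nat \<Rightarrow> nat \<Rightarrow> real \<Rightarrow> 'n::finite \<Rightarrow> (real ^ 'n) set \<Rightarrow> (real ^ 'n \<Rightarrow> real) \<Rightarrow> 'n mpoly \<Rightarrow> 'n mpoly \<Rightarrow> 'n mpoly \<Rightarrow>
     real \<Rightarrow> 'n mpoly \<Rightarrow> bool" where
  "expansion k m \<alpha> N \<Omega> u Pf Pg Pb A P \<longleftrightarrow> P \<in> polys m \<and> low_order (Suc k) P \<and> lap P = trunc_lt (m - 1) Pf \<and>
     low_order (Suc m) (psubst N (P - Pg) Pb) \<and> cnorm P \<le> A \<and>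
     (\<forall>x\<in>\<Omega>. norm x < 1 \<longrightarrow> \<bar>u x - peval P x\<bar> \<le> A * norm x powr (real m + \<alpha>))"

lemma low_order_uminus: "low_order d (- P) = low_order d P"
  by (simp add: low_order_def)

lemma polys_diff: "P \<in> polys d \<Longrightarrow> Q \<in> polys d \<Longrightarrow> P - Q \<in> polys d"
  unfolding polys_iff by (metis diff_0_right lookup_minus)

lemma polys_add: "P \<in> polys d \<Longrightarrow> Q \<in> polys d \<Longrightarrow> P + Q \<in> polys d"
  unfolding polys_iff by (metis add_0 lookup_add)

lemma polys_mono: "P \<in> polys d \<Longrightarrow> d \<le> e \<Longrightarrow> P \<in> polys e"
  unfolding polys_iff by (meson order_trans)

lemma homogeneous_polys: "homogeneous d P \<Longrightarrow> P \<in> polys d"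
  by (auto simp: homogeneous_def polys_iff)

lemma homogeneous_low_order: "homogeneous d P \<Longrightarrow> low_order d P"
  by (auto simp: homogeneous_def low_order_def)

text \<open>
  The new homogeneous part is \<open>Q + H\<close>: \<open>Q\<close> absorbs the next terms of \<open>P\<^sub>f\<close> and of the boundary data,
  and \<open>H\<close> is harmonic and odd in \<open>x\<^sub>N\<close>, so that neither \<open>H\<close> nor the part of \<open>Q\<close> divisible by \<open>x\<^sub>N\<^sup>2\<close>
  contributes to the boundary values in degree \<open>m + 1\<close>.
\<close>

lemma expansion_step:
  fixes k l m :: nat and \<alpha> K M C0 :: real
  assumes \<alpha>: "0 < \<alpha>" "\<alpha> < 1" and K: "0 < K" and M: "1 \<le> M" and kl: "1 \<le> k" "1 \<le> l" "Suc m \<le> k + l" and C0: "0 < C0"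
  shows "\<exists>C>0. \<forall>(N :: 'n::finite) \<Omega> f u Pf Pg Pb S P. dirichlet_data k l \<alpha> K M N \<Omega> f u Pf Pg Pb S \<and>
    expansion k m \<alpha> N \<Omega> u Pf Pg Pb (C0 * S) P \<longrightarrow> (\<exists>P. expansion k (Suc m) \<alpha> N \<Omega> u Pf Pg Pb (C * S) P)"
proof -
  obtain cQ where cQ: "cQ > 0" "\<And>(N :: 'n) p q. (\<forall>\<sigma>. lookup p \<sigma> \<noteq> 0 \<longrightarrow> mdeg \<sigma> + 2 = Suc m) \<Longrightarrow> homogeneous (Suc m) q \<Longrightarrow>
     \<exists>Q. lap Q = p \<and> homogeneous (Suc m) Q \<and> divisible_sq N (Q - q) \<and> cnorm Q \<le> cQ * (cnorm p + cnorm q)"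
    using cauchy_data[where 'n = 'n, of "Suc m"] by blast
  obtain cG where cG: "cG > 0" "\<And>\<Omega> f u (N :: 'n) P B. viscosity_problem \<Omega> f u (real CARD('n)) \<Longrightarrow> flat_boundary K \<alpha> N \<Omega> \<Longrightarrow> 0 < B \<Longrightarrow>
      \<forall>x\<in>\<Omega>. norm x < 1 \<longrightarrow> \<bar>u x - peval P x\<bar> \<le> B * norm x powr (real m + \<alpha>) \<Longrightarrow>
      data_controlled \<Omega> f u P B (real m + 1 + \<alpha>) \<Longrightarrow>
      \<exists>H. lap H = 0 \<and> odd_in N H \<and> homogeneous (Suc m) H \<and> cnorm H \<le> cG * B \<and>
          (\<forall>x\<in>\<Omega>. norm x < 1 \<longrightarrow> \<bar>u x - peval P x - peval H x\<bar> \<le> cG * B * norm x powr (real m + 1 + \<alpha>))"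
    using order_gain[where 'n = 'n, OF \<alpha> K, of m] by metis
  \<comment> \<open>D bounds the effect of substituting P_b on \<open>cnorm\<close>; C1, C2 and C3
    bound Q, R and the boundary error of P + Q, and C4 covers all hypotheses of
    \<open>order_gain\<close>.\<close>
  define D where "D = M ^ (k + l)"
  have D: "D \<ge> 1" using M by (simp add: D_def)
  define C1 where "C1 = cQ * (2 + D * (1 + C0))"
  define C2 where "C2 = 1 + C0 + C1"
  define C3 where "C3 = 1 + real (k + l) * D * C2 * K + D * C2"
  define C4 where "C4 = C0 + C1 + 2 + C3"
  define C where "C = C0 + C1 + cG * C4"
  have C1: "C1 > 0" using cQ D C0 by (simp add: C1_def add_pos_pos)
  have C2: "C2 > 0" using C1 C0 by (simp add: C2_def add_pos_pos)
  have C3: "C3 > 0" using C2 D K by (simp add: C3_def add_pos_nonneg)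
  have C4: "C4 > 0" using C3 C1 C0 by (simp add: C4_def add_pos_pos)
  have C: "C > 0" "cG * C4 \<le> C" using C4 C1 C0 cG by (simp_all add: C_def add_pos_pos)
  show ?thesis
  proof (intro exI[of _ C] conjI allI impI C(1))
    fix N :: 'n and \<Omega> f u Pf Pg Pb S P
    assume asm: "dirichlet_data k l \<alpha> K M N \<Omega> f u Pf Pg Pb S \<and> expansion k m \<alpha> N \<Omega> u Pf Pg Pb (C0 * S) P"
    then have S: "0 < S" and flat: "flat_boundary K \<alpha> N \<Omega>" and vp: "viscosity_problem \<Omega> f u (real CARD('n))"
      and uB: "\<exists>B. \<forall>x\<in>\<Omega>. norm x < 1 \<longrightarrow> \<bar>u x\<bar> \<le> B * norm x powr (real k + \<alpha>)"
      and gb: "\<And>x. x \<in> frontier \<Omega> \<Longrightarrow> norm x < 1 \<Longrightarrow> \<bar>u x - peval Pg x\<bar> \<le> S * norm x powr (real (k + l) + \<alpha>)"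
      and fb: "\<And>x. x \<in> \<Omega> \<Longrightarrow> norm x < 1 \<Longrightarrow> \<bar>f x - peval Pf x\<bar> \<le> S * norm x powr (real (k + l - 2) + \<alpha>)"
      and Pf: "cnorm Pf \<le> S" and Pg: "Pg \<in> polys (k + l)" "low_order (Suc k) Pg" "cnorm Pg \<le> S"
      and Pb: "low_order 2 Pb" "free_of N Pb" "cnorm Pb \<le> M"
      and Pb_bd: "\<And>x. x \<in> frontier \<Omega> \<Longrightarrow> norm x < 1 \<Longrightarrow> \<bar>x $ N - peval Pb x\<bar> \<le> K * norm x powr (real l + \<alpha>)"
      and P: "P \<in> polys m" "low_order (Suc k) P" "lap P = trunc_lt (m - 1) Pf" "low_order (Suc m) (psubst N (P - Pg) Pb)"
        "cnorm P \<le> C0 * S" and uP: "\<And>x. x \<in> \<Omega> \<Longrightarrow> norm x < 1 \<Longrightarrow> \<bar>u x - peval P x\<bar> \<le> C0 * S * norm x powr (real m + \<alpha>)"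
      unfolding dirichlet_data_def expansion_def by blast+
    \<comment> \<open>The part of P_f of degree m - 1, which the new term of degree m + 1 must
      produce; for m = 0 it is 0.\<close>
    define p where "p = trunc_lt m Pf - trunc_lt (m - 1) Pf"
    define T where "T = psubst N (Pg - P) Pb"
    \<comment> \<open>The first possible mismatch of the boundary values, since T starts in degree m
      + 1.\<close>
    define q where "q = pfilter (\<lambda>\<sigma>. mdeg \<sigma> = Suc m) T"
    have p: "mdeg \<sigma> + 2 = Suc m" if "lookup p \<sigma> \<noteq> 0" for \<sigma>
      using that by (auto simp: p_def lookup_minus lookup_pfilter split: if_splits)
    have p_norm: "cnorm p \<le> 2 * S"
      using cnorm_diff[of "trunc_lt m Pf" "trunc_lt (m - 1) Pf"] cnorm_pfilter[of _ Pf] Pf unfolding p_def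
      by (smt (verit))
    have q_hom: "homogeneous (Suc m) q" by (auto simp: q_def homogeneous_def lookup_pfilter)
    have gP: "Pg - P \<in> polys (k + l)" using Pg(1) polys_mono[OF P(1)] kl by (intro polys_diff) auto
    have T_low: "low_order (Suc m) T"
    proof -
      have "T = - psubst N (P - Pg) Pb" by (simp add: T_def psubst_diff)
      then show ?thesis using P(4) by (simp add: low_order_uminus)
    qed
    have q_norm: "cnorm q \<le> D * (1 + C0) * S"
    proof -
      have "cnorm q \<le> cnorm T" unfolding q_def by (rule cnorm_pfilter)
      also have "\<dots> \<le> D * cnorm (Pg - P)" unfolding T_def D_def by (rule cnorm_psubst[OF gP Pb(3) M])
      also have "\<dots> \<le> D * (S + C0 * S)"
        using cnorm_diff[of Pg P] Pg(3) P(5) D by (intro mult_left_mono) auto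
      finally show ?thesis by (simp add: algebra_simps)
    qed
    have q_free: "free_of N q"
      using free_of_psubst[OF Pb(2), of "Pg - P"] by (auto simp: q_def T_def free_of_def lookup_pfilter)
    obtain Q where Q: "lap Q = p" "homogeneous (Suc m) Q" "divisible_sq N (Q - q)" "cnorm Q \<le> cQ * (cnorm p + cnorm q)"
      using cQ(2)[of p q N] p q_hom by blast
    have Q_norm: "cnorm Q \<le> C1 * S"
    proof -
      have "cQ * (cnorm p + cnorm q) \<le> cQ * (2 * S + D * (1 + C0) * S)"
        using p_norm q_norm cQ by (intro mult_left_mono) auto
      then show ?thesis using Q(4) by (simp add: C1_def algebra_simps)
    qed
    define R where "R = Pg - P - Q"
    have R_polys: "R \<in> polys (k + l)"
      unfolding R_def by (intro polys_diff[OF gP] polys_mono[OF homogeneous_polys[OF Q(2)] kl(3)])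
    have R_norm: "cnorm R \<le> C2 * S"
      using cnorm_diff[of "Pg - P" Q] cnorm_diff[of Pg P] Pg(3) P(5) Q_norm by (simp add: R_def C2_def algebra_simps)
    have R_low: "low_order (Suc (min k m)) R"
      unfolding R_def using Pg(2) P(2) homogeneous_low_order[OF Q(2)]
      by (intro low_order_diff) (auto elim: low_order_mono)
    have R_psubst: "low_order (Suc (Suc m)) (psubst N R Pb)"
    proof -
      \<comment> \<open>q is free of x_N, so substitution leaves it alone. T - q has lost its lowest
        degree, and Q - q is divisible by x_N^2, each factor of which counts twice.\<close>
      have "psubst N R Pb = (T - q) - psubst N (Q - q) Pb"
        by (simp add: R_def T_def psubst_diff psubst_free_of[OF q_free])
      moreover have "low_order (Suc (Suc m)) (T - q)"
        unfolding low_order_def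
      proof (intro allI impI)
        fix \<sigma> assume \<sigma>: "lookup (T - q) \<sigma> \<noteq> 0"
        then have "mdeg \<sigma> \<noteq> Suc m" "lookup T \<sigma> \<noteq> 0" by (auto simp: q_def lookup_minus lookup_pfilter split: if_splits)
        then show "Suc (Suc m) \<le> mdeg \<sigma>" using T_low by (auto simp: low_order_def Suc_le_eq order_less_le)
      qed
      moreover have "low_order (Suc (Suc m)) (psubst N (Q - q) Pb)"
      proof (rule low_order_psubst[OF Pb(1)])
        fix \<sigma> assume \<sigma>: "lookup (Q - q) \<sigma> \<noteq> 0"
        then have "mdeg \<sigma> = Suc m" using homogeneous_diff[OF Q(2) q_hom] by (simp add: homogeneous_def)
        moreover have "2 \<le> lookup \<sigma> N" using Q(3) \<sigma> by (simp add: divisible_sq_def)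
        ultimately show "Suc (Suc m) \<le> mdeg \<sigma> + lookup \<sigma> N" by simp
      qed
      ultimately show ?thesis by (simp add: low_order_diff)
    qed
    have lapPQ: "lap (P + Q) = trunc_lt m Pf" by (simp add: lap_add P(3) Q(1) p_def)
    have ctrl: "data_controlled \<Omega> f u (P + Q) (C4 * S) (real m + 1 + \<alpha>)"
      unfolding data_controlled_def
    proof (intro allI impI conjI ballI)
      fix r :: real and x assume r: "0 < r \<and> r \<le> 1" and x: "x \<in> frontier \<Omega>" "norm x < r"
      define y where "y = norm x"
      have y: "0 \<le> y" "y \<le> 1" using x r by (simp_all add: y_def)
      have 1: "\<bar>u x - peval Pg x\<bar> \<le> S * y powr (real m + 1 + \<alpha>)"
      proof -
        have "y powr (real (k + l) + \<alpha>) \<le> y powr (real m + 1 + \<alpha>)" using y kl by (intro powr_mono') auto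
        then have "S * y powr (real (k + l) + \<alpha>) \<le> S * y powr (real m + 1 + \<alpha>)" using S by simp
        then show ?thesis using gb[of x] x r by (simp add: y_def)
      qed
      have 2: "\<bar>peval (psubst N R Pb) x\<bar> \<le> D * C2 * S * y powr (real m + 1 + \<alpha>)"
      proof -
        have "\<bar>peval (psubst N R Pb) x\<bar> \<le> cnorm (psubst N R Pb) * y ^ Suc (Suc m)"
          unfolding y_def by (rule peval_le_cnorm[OF R_psubst]) (use y y_def in simp)
        also have "\<dots> \<le> (D * (C2 * S)) * y powr (real m + 1 + \<alpha>)"
        proof (rule mult_mono)
          have "cnorm (psubst N R Pb) \<le> D * cnorm R" unfolding D_def by (rule cnorm_psubst[OF R_polys Pb(3) M])
          also have "\<dots> \<le> D * (C2 * S)" using R_norm D by (intro mult_left_mono) auto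
          finally show "cnorm (psubst N R Pb) \<le> D * (C2 * S)" .
          show "y ^ Suc (Suc m) \<le> y powr (real m + 1 + \<alpha>)" using y \<alpha> by (intro power_le_powr) auto
        qed (use D C2 S y in auto)
        finally show ?thesis by (simp add: mult_ac)
      qed
      \<comment> \<open>R starts in degree min k m + 1, so replacing x_N by P_b costs |x|^(min k m +
        l + \<alpha>); and min k m + l \<ge> m + 1 because l \<ge> 1 and m + 1 \<le> k + l.\<close>
      have 3: "\<bar>peval R x - peval (psubst N R Pb) x\<bar> \<le> real (k + l) * D * C2 * K * S * y powr (real m + 1 + \<alpha>)"
      proof -
        have "\<bar>peval Pb x\<bar> \<le> cnorm Pb * y ^ 2" unfolding y_def by (rule peval_le_cnorm[OF Pb(1)]) (use y y_def in simp)
        also have "\<dots> \<le> M * y" using Pb(3) M y by (intro mult_mono) (auto simp: power2_eq_square mult_left_le)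
        finally have "\<bar>peval R x - peval (psubst N R Pb) x\<bar> \<le> real (k + l) * D * cnorm R * (y ^ min k m * \<bar>x $ N - peval Pb x\<bar>)"
          unfolding D_def y_def using y by (intro peval_psubst_diff[OF R_polys R_low _ _ M]) (auto simp: y_def)
        also have "\<dots> \<le> real (k + l) * D * (C2 * S) * (y ^ min k m * (K * y powr (real l + \<alpha>)))"
          using Pb_bd[of x] x r y R_norm D C2 S unfolding y_def by (intro mult_mono) (auto simp: cnorm_nonneg)
        also have "\<dots> = real (k + l) * D * C2 * K * S * (y ^ min k m * y powr (real l + \<alpha>))" by (simp only: mult_ac)
        also have "y ^ min k m * y powr (real l + \<alpha>) = y powr (real (min k m) + (real l + \<alpha>))"
          using y by (intro power_mult_powr) auto
        also have "real (k + l) * D * C2 * K * S * \<dots> \<le> real (k + l) * D * C2 * K * S * y powr (real m + 1 + \<alpha>)"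
        proof (rule mult_left_mono)
          have "Suc m \<le> min k m + l" using kl by auto
          then have "real m + 1 + \<alpha> \<le> real (min k m) + (real l + \<alpha>)" by linarith
          then show "y powr (real (min k m) + (real l + \<alpha>)) \<le> y powr (real m + 1 + \<alpha>)" using y by (intro powr_mono') auto
        qed (use D C2 K S in auto)
        finally show ?thesis .
      qed
      have "u x - peval (P + Q) x = (u x - peval Pg x) + (peval R x - peval (psubst N R Pb) x) + peval (psubst N R Pb) x"
        by (simp add: R_def peval_add peval_diff)
      then have "\<bar>u x - peval (P + Q) x\<bar> \<le> C3 * (S * y powr (real m + 1 + \<alpha>))"
        using 1 2 3 by (simp add: C3_def algebra_simps)
      also have "\<dots> \<le> C4 * (S * r powr (real m + 1 + \<alpha>))"
        using C0 C1 C3 S y x \<alpha> by (intro mult_mono powr_mono2) (auto simp: C4_def y_def)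
      finally show "\<bar>u x - peval (P + Q) x\<bar> \<le> C4 * S * r powr (real m + 1 + \<alpha>)" by (simp add: mult.assoc)
    next
      fix r :: real and x assume r: "0 < r \<and> r \<le> 1" and x: "x \<in> \<Omega>" "norm x < r"
      have "\<bar>f x - peval Pf x\<bar> \<le> S * norm x powr (real (k + l - 2) + \<alpha>)" using fb x r by auto
      also have "\<dots> \<le> S * r powr (real (k + l - 2) + \<alpha>)" using S x \<alpha> by (intro mult_left_mono powr_mono2) auto
      also have "\<dots> \<le> S * r powr (real m + 1 + \<alpha> - 2)" using S r kl by (intro mult_left_mono powr_mono') auto
      finally have 1: "\<bar>f x - peval Pf x\<bar> \<le> S * r powr (real m + 1 + \<alpha> - 2)" .
      have "\<bar>peval (Pf - trunc_lt m Pf) x\<bar> \<le> cnorm (Pf - trunc_lt m Pf) * norm x ^ m"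
        using x r by (intro peval_le_cnorm) (auto simp: low_order_def lookup_minus lookup_pfilter split: if_splits)
      also have "\<dots> \<le> S * r ^ m"
      proof (intro mult_mono power_mono)
        have "Pf - trunc_lt m Pf = pfilter (\<lambda>\<sigma>. \<not> mdeg \<sigma> < m) Pf"
          by (rule poly_mapping_eqI) (simp add: lookup_minus lookup_pfilter)
        then show "cnorm (Pf - trunc_lt m Pf) \<le> S" using cnorm_pfilter[of _ Pf] Pf by (metis order_trans)
      qed (use x r S in auto)
      also have "\<dots> = S * r powr real m" using r by (simp add: powr_realpow)
      also have "\<dots> \<le> S * r powr (real m + 1 + \<alpha> - 2)" using S r \<alpha> by (intro mult_left_mono powr_mono') auto
      finally have "\<bar>f x - peval (lap (P + Q)) x\<bar> \<le> 2 * (S * r powr (real m + 1 + \<alpha> - 2))"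
        unfolding lapPQ using 1 by (simp add: peval_diff)
      also have "\<dots> \<le> C4 * (S * r powr (real m + 1 + \<alpha> - 2))"
        using C0 C1 C3 S by (intro mult_right_mono) (auto simp: C4_def)
      finally show "\<bar>f x - peval (lap (P + Q)) x\<bar> \<le> C4 * S * r powr (real m + 1 + \<alpha> - 2)" by (simp add: mult.assoc)
    qed
    have near: "\<forall>x\<in>\<Omega>. norm x < 1 \<longrightarrow> \<bar>u x - peval (P + Q) x\<bar> \<le> C4 * S * norm x powr (real m + \<alpha>)"
    proof (intro ballI impI)
      fix x assume x: "x \<in> \<Omega>" "norm x < 1"
      have "\<bar>peval Q x\<bar> \<le> cnorm Q * norm x ^ Suc m"
        using x by (intro peval_le_cnorm homogeneous_low_order[OF Q(2)]) auto
      also have "\<dots> \<le> C1 * S * norm x powr (real m + \<alpha>)"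
        using x \<alpha> C1 S by (intro mult_mono[OF Q_norm] power_le_powr) auto
      finally have "\<bar>u x - peval (P + Q) x\<bar> \<le> (C0 + C1) * (S * norm x powr (real m + \<alpha>))"
        using uP[OF x] by (simp add: peval_add algebra_simps)
      also have "\<dots> \<le> C4 * (S * norm x powr (real m + \<alpha>))"
        using C3 S by (intro mult_right_mono) (auto simp: C4_def)
      finally show "\<bar>u x - peval (P + Q) x\<bar> \<le> C4 * S * norm x powr (real m + \<alpha>)" by (simp add: mult.assoc)
    qed
    obtain H where H: "lap H = 0" "odd_in N H" "homogeneous (Suc m) H" "cnorm H \<le> cG * (C4 * S)"
      "\<And>x. x \<in> \<Omega> \<Longrightarrow> norm x < 1 \<Longrightarrow> \<bar>u x - peval (P + Q) x - peval H x\<bar> \<le> cG * (C4 * S) * norm x powr (real m + 1 + \<alpha>)"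
      using cG(2)[OF vp flat _ near ctrl] C4 S by auto
    define P' where "P' = P + Q + H"
    have uP': "\<bar>u x - peval P' x\<bar> \<le> C * S * norm x powr (real m + 1 + \<alpha>)" if x: "x \<in> \<Omega>" "norm x < 1" for x
    proof -
      have "\<bar>u x - peval P' x\<bar> \<le> (cG * C4) * (S * norm x powr (real m + 1 + \<alpha>))"
        using H(5)[OF x] by (simp add: P'_def peval_add algebra_simps)
      also have "\<dots> \<le> C * (S * norm x powr (real m + 1 + \<alpha>))" using C S by (intro mult_right_mono) auto
      finally show ?thesis by (simp add: mult.assoc)
    qed
    have P'_polys: "P' \<in> polys (Suc m)"
      unfolding P'_def
      by (intro polys_add polys_mono[OF P(1)] homogeneous_polys[OF Q(2)] homogeneous_polys[OF H(3)]) simp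
    \<comment> \<open>For m < k the new polynomial has degree at most k and approximates u beyond
      its own degree; as u is itself O(|x|^(k+\<alpha>)), it must vanish.\<close>
    have P'_low: "low_order (Suc k) P'"
    proof (cases "k \<le> m")
      case True
      then show ?thesis unfolding P'_def
        using P(2) homogeneous_low_order[OF Q(2)] homogeneous_low_order[OF H(3)]
        by (intro low_order_add) (auto elim: low_order_mono)
    next
      case False
      obtain B where B: "\<And>x. x \<in> \<Omega> \<Longrightarrow> norm x < 1 \<Longrightarrow> \<bar>u x\<bar> \<le> B * norm x powr (real k + \<alpha>)" using uB by blast
      have "lookup P' \<sigma> = 0" if \<sigma>: "mdeg \<sigma> \<le> Suc m" for \<sigma>
      proof (rule vanishing_low_order[OF flat K \<alpha>(1)])
        show "real (mdeg \<sigma>) < real m + 1 + \<alpha>" using \<sigma> \<alpha> by linarith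
        fix x assume x: "x \<in> \<Omega>" "norm x < 1"
        have "\<bar>u x\<bar> \<le> \<bar>B\<bar> * norm x powr (real k + \<alpha>)"
          using B[OF x] mult_right_mono[OF abs_ge_self[of B], of "norm x powr (real k + \<alpha>)"] by simp
        also have "\<dots> \<le> \<bar>B\<bar> * norm x powr (real m + 1 + \<alpha>)"
          using False x by (intro mult_left_mono powr_mono') auto
        finally show "\<bar>peval P' x\<bar> \<le> (\<bar>B\<bar> + C * S) * norm x powr (real m + 1 + \<alpha>)"
          using uP'[OF x] by (simp add: algebra_simps)
      qed
      then have "P' = 0" using P'_polys by (intro poly_mapping_eqI) (auto simp: polys_iff)
      then show ?thesis by (simp add: low_order_def)
    qed
    have "expansion k (Suc m) \<alpha> N \<Omega> u Pf Pg Pb (C * S) P'"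
      unfolding expansion_def
    proof (intro conjI ballI impI P'_polys P'_low)
      show "lap P' = trunc_lt (Suc m - 1) Pf" using lapPQ H(1) by (simp add: P'_def lap_add)
      \<comment> \<open>H is odd in x_N and so gains a degree under substitution.\<close>
      have "psubst N (P' - Pg) Pb = psubst N H Pb - psubst N R Pb"
        by (simp add: P'_def R_def psubst_diff psubst_add)
      moreover have "low_order (Suc (Suc m)) (psubst N H Pb)"
      proof (rule low_order_psubst[OF Pb(1)])
        fix \<sigma> assume "lookup H \<sigma> \<noteq> 0"
        then have "mdeg \<sigma> = Suc m" "odd (lookup \<sigma> N)" using H(2,3) by (auto simp: homogeneous_def odd_in_def)
        then show "Suc (Suc m) \<le> mdeg \<sigma> + lookup \<sigma> N" by (cases "lookup \<sigma> N") auto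
      qed
      ultimately show "low_order (Suc (Suc m)) (psubst N (P' - Pg) Pb)" using R_psubst by (simp add: low_order_diff)
      have "cnorm P' \<le> cnorm P + cnorm Q + cnorm H"
        unfolding P'_def using cnorm_add[of "P + Q" H] cnorm_add[of P Q] by linarith
      then show "cnorm P' \<le> C * S" using P(5) Q_norm H(4) by (simp add: C_def algebra_simps)
      show "\<bar>u x - peval P' x\<bar> \<le> C * S * norm x powr (real (Suc m) + \<alpha>)" if "x \<in> \<Omega>" "norm x < 1" for x
        using uP'[OF that] by (simp add: add.commute)
    qed
    then show "\<exists>P. expansion k (Suc m) \<alpha> N \<Omega> u Pf Pg Pb (C * S) P" by blast
  qed
qed

text \<open>The induction on m keeps the constant in front of the quantifiers over the domain and
  the data. It starts with P = 0.\<close>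

lemma boundary_expansion:
  fixes k l m :: nat and \<alpha> K M :: real
  assumes \<alpha>: "0 < \<alpha>" "\<alpha> < 1" and K: "0 < K" and M: "1 \<le> M" and kl: "1 \<le> k" "1 \<le> l"
  shows "m \<le> k + l \<Longrightarrow> \<exists>C>0. \<forall>(N :: 'n::finite) \<Omega> f u Pf Pg Pb S. dirichlet_data k l \<alpha> K M N \<Omega> f u Pf Pg Pb S \<longrightarrow>
    (\<exists>P. expansion k m \<alpha> N \<Omega> u Pf Pg Pb (C * S) P)"
proof (induction m)
  case 0
  obtain C where C: "C > 0" "\<And>(N :: 'n) \<Omega> f u Pf Pg Pb S. dirichlet_data k l \<alpha> K M N \<Omega> f u Pf Pg Pb S \<Longrightarrow>
    (\<forall>x\<in>\<Omega>. norm x < 1 \<longrightarrow> \<bar>u x\<bar> \<le> C * S * norm x powr \<alpha>)"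
    using expansion_start[where 'n = 'n, OF \<alpha> K kl] by blast
  show ?case
  proof (intro exI[of _ C] conjI allI impI C(1))
    fix N :: 'n and \<Omega> f u Pf Pg Pb S assume data: "dirichlet_data k l \<alpha> K M N \<Omega> f u Pf Pg Pb S"
    have "trunc_lt 0 Pf = 0" by (rule poly_mapping_eqI) (simp add: lookup_pfilter)
    moreover have "low_order (Suc 0) (psubst N (0 - Pg) Pb)"
      using data by (intro low_order_psubst) (auto simp: dirichlet_data_def low_order_def)
    ultimately have "expansion k 0 \<alpha> N \<Omega> u Pf Pg Pb (C * S) 0"
      using C(2)[OF data] C(1) data by (auto simp: expansion_def polys_iff low_order_def dirichlet_data_def)
    then show "\<exists>P. expansion k 0 \<alpha> N \<Omega> u Pf Pg Pb (C * S) P" by blast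
  qed
next
  case (Suc m)
  then obtain C0 where C0: "C0 > 0" "\<And>(N :: 'n) \<Omega> f u Pf Pg Pb S. dirichlet_data k l \<alpha> K M N \<Omega> f u Pf Pg Pb S \<Longrightarrow>
    \<exists>P. expansion k m \<alpha> N \<Omega> u Pf Pg Pb (C0 * S) P" by auto
  then show ?case using expansion_step[where 'n = 'n, OF \<alpha> K M kl Suc.prems C0(1)] by metis
qed

section \<open>Norms\<close>

lemma mfact_ge_1: "1 \<le> mfact \<sigma>"
  unfolding mfact_def by (intro prod_ge_1) (simp add: fact_ge_1)

lemma poly_norm_nonneg: "0 \<le> poly_norm P"
  by (simp add: poly_norm_def sum_nonneg)

lemma cnorm_le_poly_norm: "cnorm P \<le> poly_norm P"
  unfolding cnorm_def poly_norm_def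
proof (rule sum_mono)
  fix \<sigma>
  show "\<bar>lookup P \<sigma>\<bar> \<le> \<bar>taylor_coeff P \<sigma>\<bar>"
    using mult_right_mono[OF mfact_ge_1[of \<sigma>], of "\<bar>lookup P \<sigma>\<bar>"] mfact_ge_1[of \<sigma>]
    by (simp add: taylor_coeff_def abs_mult)
qed

lemma poly_norm_le_cnorm:
  assumes "P \<in> polys d"
  shows "poly_norm (P :: 'n::finite mpoly) \<le> (\<Sum>\<sigma>\<in>monomials_upto d. mfact (\<sigma> :: 'n \<Rightarrow>\<^sub>0 nat)) * cnorm P"
proof -
  let ?F = "\<Sum>\<sigma>\<in>monomials_upto d. mfact (\<sigma> :: 'n \<Rightarrow>\<^sub>0 nat)"
  have "poly_norm P \<le> (\<Sum>\<sigma>\<in>keys P. ?F * \<bar>lookup P \<sigma>\<bar>)"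
    unfolding poly_norm_def
  proof (rule sum_mono)
    fix \<sigma> assume "\<sigma> \<in> keys P"
    then have "\<sigma> \<in> monomials_upto d" using assms by (simp add: polys_def monomials_upto_def)
    then have "mfact \<sigma> \<le> ?F"
      by (intro member_le_sum) (auto simp: monomials_upto_def finite_mdeg_le intro: order_trans[OF zero_le_one mfact_ge_1])
    then show "\<bar>taylor_coeff P \<sigma>\<bar> \<le> ?F * \<bar>lookup P \<sigma>\<bar>"
      using mfact_ge_1[of \<sigma>] by (simp add: taylor_coeff_def abs_mult mult_right_mono)
  qed
  then show ?thesis by (simp add: cnorm_def sum_distrib_left)
qed

lemma deriv_norm0_le: "deriv_norm0 i P \<le> poly_norm P"
proof -
  have "deriv_norm0 i P \<le> (\<Sum>\<sigma> | \<sigma> \<in> keys P \<and> mdeg \<sigma> = i. \<bar>taylor_coeff P \<sigma>\<bar>)"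
    using L2_set_le_sum_abs[of "taylor_coeff P"] by (simp add: deriv_norm0_def L2_set_def)
  also have "\<dots> \<le> poly_norm P" unfolding poly_norm_def by (rule sum_mono2) auto
  finally show ?thesis .
qed

lemma deriv_norm0_eq_0:
  assumes "deriv_norm0 i P = 0" "mdeg \<sigma> = i"
  shows "lookup P \<sigma> = 0"
proof (rule ccontr)
  assume \<sigma>: "lookup P \<sigma> \<noteq> 0"
  have "(\<Sum>\<sigma> | \<sigma> \<in> keys P \<and> mdeg \<sigma> = i. (taylor_coeff P \<sigma>)\<^sup>2) = 0"
    using assms(1) by (simp add: deriv_norm0_def)
  then have "(taylor_coeff P \<sigma>)\<^sup>2 = 0"
    using \<sigma> assms(2) by (subst (asm) sum_nonneg_eq_0_iff) (auto simp: in_keys_iff)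
  then show False using \<sigma> mfact_ge_1[of \<sigma>] by (auto simp: taylor_coeff_def)
qed

lemma C_pt_seminorm_nonneg: "C_pt k \<alpha> D h P \<Longrightarrow> 0 \<le> C_pt_seminorm k \<alpha> D h P"
  unfolding C_pt_seminorm_def C_pt_def by (intro cInf_greatest) auto

text \<open>The infimum is attained: for x \<noteq> 0 the inequality is divided by the power of |x|,
  and at x = 0 it does not involve K.\<close>

lemma C_pt_bound_seminorm:
  assumes "C_pt k \<alpha> D h P"
  shows "C_pt_bound k \<alpha> D h P (C_pt_seminorm k \<alpha> D h P)"
  unfolding C_pt_bound_def
proof
  fix x assume x: "x \<in> D \<inter> ball 0 1"
  let ?y = "norm x powr (real k + \<alpha>)" and ?A = "{K. 0 < K \<and> C_pt_bound k \<alpha> D h P K}"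
  have ne: "?A \<noteq> {}" using assms by (auto simp: C_pt_def)
  have K: "\<bar>h x - peval P x\<bar> \<le> K * ?y" if "K \<in> ?A" for K using that x by (auto simp: C_pt_bound_def)
  show "\<bar>h x - peval P x\<bar> \<le> C_pt_seminorm k \<alpha> D h P * ?y"
  proof (cases "?y = 0")
    case True
    then show ?thesis using K ne by fastforce
  next
    case False
    then have y: "0 < ?y" by (simp add: order_less_le)
    have "\<bar>h x - peval P x\<bar> / ?y \<le> Inf ?A"
      using K y by (intro cInf_greatest[OF ne]) (simp add: pos_divide_le_eq)
    then show ?thesis using y by (simp add: C_pt_seminorm_def pos_divide_le_eq)
  qed
qed

lemma bdry_bound_mono:
  assumes "bdry_bound l \<alpha> N \<Omega> P K" "K \<le> K'"
  shows "bdry_bound l \<alpha> N \<Omega> P K'"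
proof -
  have "K * norm (tangential N x) powr (real l + \<alpha>) \<le> K' * norm (tangential N x) powr (real l + \<alpha>)" for x
    using assms(2) by (intro mult_right_mono) auto
  then show ?thesis using assms(1) unfolding bdry_bound_def by (smt (verit) Int_iff mem_Collect_eq subset_iff)
qed

text \<open>A constant strictly above the norm exceeds some admissible one, and admissibility is
  monotone.\<close>

lemma bdry_bound_of_norm:
  assumes "bdry_C_pt l \<alpha> N \<Omega> P" "bdry_norm l \<alpha> N \<Omega> P < K"
  shows "bdry_bound l \<alpha> N \<Omega> P K" "poly_norm P \<le> K"
proof -
  let ?A = "{K. 0 < K \<and> bdry_bound l \<alpha> N \<Omega> P K}"
  have ne: "?A \<noteq> {}" using assms(1) by (auto simp: bdry_C_pt_def)
  have "0 \<le> Inf ?A" by (rule cInf_greatest[OF ne]) auto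
  then show "poly_norm P \<le> K" using assms(2) by (simp add: bdry_norm_def bdry_seminorm_def)
  have "Inf ?A < K" using assms(2) poly_norm_nonneg[of P] by (simp add: bdry_norm_def bdry_seminorm_def)
  then obtain K' where "K' \<in> ?A" "K' < K" using cInf_lessD[OF ne] by blast
  then show "bdry_bound l \<alpha> N \<Omega> P K" using bdry_bound_mono[of l \<alpha> N \<Omega> P K' K] by auto
qed

text \<open>Where |u| exceeds a number above the essential supremum, it does so on an open set,
  which has positive measure unless empty. The bound B makes the essential supremum finite, so that
  \<open>real_of_ereal\<close> is faithful.\<close>

lemma Linf_norm_bound:
  fixes u :: "real ^ 'n::finite \<Rightarrow> real"
  assumes D: "open D" and cont: "continuous_on D u" and B: "\<And>x. x \<in> D \<Longrightarrow> \<bar>u x\<bar> \<le> B" and x: "x \<in> D"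
  shows "\<bar>u x\<bar> \<le> Linf_norm D u"
proof -
  define L where "L = esssup (lebesgue_on D) (\<lambda>x. ereal \<bar>u x\<bar>)"
  have Dm: "D \<in> sets lebesgue" using D by (simp add: lebesgue_openin)
  have meas: "(\<lambda>x. ereal \<bar>u x\<bar>) \<in> borel_measurable (lebesgue_on D)"
    using continuous_imp_measurable_on_sets_lebesgue[OF cont Dm] by measurable
  have LB: "L \<le> ereal B" unfolding L_def by (rule esssup_I[OF meas]) (use B in auto)
  have Lx: "ereal \<bar>u x\<bar> \<le> L"
  proof (rule ccontr)
    assume "\<not> ereal \<bar>u x\<bar> \<le> L"
    then have "L < ereal \<bar>u x\<bar>" by simp
    from ereal_dense2[OF this] obtain c where c: "L < ereal c" "ereal c < ereal \<bar>u x\<bar>" by blast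
    have "AE y in lebesgue. y \<in> D \<longrightarrow> ereal \<bar>u y\<bar> \<le> L"
      using esssup_AE[where M = "lebesgue_on D" and f = "\<lambda>x. ereal \<bar>u x\<bar>"] Dm
      by (simp add: L_def AE_restrict_space_iff)
    then obtain Z where Z: "Z \<in> null_sets lebesgue" "{y. \<not> (y \<in> D \<longrightarrow> ereal \<bar>u y\<bar> \<le> L)} \<subseteq> Z"
      unfolding eventually_ae_filter by auto
    have "open {y \<in> D. c < \<bar>u y\<bar>}"
      using continuous_on_open_vimage[OF D, of "\<lambda>y. \<bar>u y\<bar>"] cont open_greaterThan[of c]
      by (auto simp: vimage_def Int_def conj_commute intro: continuous_intros)
    then obtain e where e: "e > 0" "ball x e \<subseteq> {y \<in> D. c < \<bar>u y\<bar>}"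
      using x c(2) open_contains_ball by (metis (mono_tags, lifting) less_ereal.simps(1) mem_Collect_eq)
    have "{y \<in> D. c < \<bar>u y\<bar>} \<subseteq> Z"
    proof
      fix y assume y: "y \<in> {y \<in> D. c < \<bar>u y\<bar>}"
      then have "L < ereal \<bar>u y\<bar>" using c(1) by (metis less_ereal.simps(1) less_trans mem_Collect_eq)
      then show "y \<in> Z" using Z(2) y by auto
    qed
    then have "ball x e \<in> null_sets lebesgue" using null_sets_completion_subset[OF _ Z(1)] e(2) by blast
    then have "ball x e \<in> null_sets lborel" by (simp add: null_sets_completion_iff)
    then have "measure lborel (ball x e) = 0" by (rule measure_eq_0_null_sets)
    then show False using content_ball_pos[OF e(1), of x] by simp
  qed
  from Lx LB have "\<bar>L\<bar> \<noteq> \<infinity>" by auto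
  then show ?thesis using Lx by (cases L) (auto simp: Linf_norm_def L_def[symmetric])
qed

lemma psubst_0 [simp]: "psubst N 0 Q = 0"
  by (simp add: psubst_def)

lemma cnorm_eq_0: "cnorm P \<le> 0 \<Longrightarrow> P = 0"
  using lookup_le_cnorm[of P] by (intro poly_mapping_eqI) (metis abs_le_zero_iff lookup_zero order_trans)

lemma norm_tangential_le: "norm (tangential N x) \<le> norm x"
  by (rule norm_le_componentwise_cart) (simp add: tangential_def)

theorem theorem1p7:
  fixes k l :: nat and \<alpha> M :: real
  assumes "k \<ge> 1" and "l \<ge> 1" and "0 < \<alpha>" and "\<alpha> < 1"
  shows "\<exists>C>0. \<forall>(N :: 'n::finite) (\<Omega> :: (real ^ 'n) set) (u :: real ^ 'n \<Rightarrow> real) (f :: real ^ 'n \<Rightarrow> real)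
      (g :: real ^ 'n \<Rightarrow> real) (Pu :: 'n mpoly) (Pf :: 'n mpoly) (Pg :: 'n mpoly) (P\<Omega> :: 'n mpoly).
    open \<Omega> \<and> connected \<Omega> \<and> bounded \<Omega> \<and> 0 \<in> frontier \<Omega> \<and>
    viscosity_solution (\<Omega> \<inter> ball 0 1) (frontier \<Omega> \<inter> ball 0 1) f g u \<and>
    C_pt k \<alpha> (\<Omega> \<inter> ball 0 1) u Pu \<and>
    C_pt (k + l - 2) \<alpha> (\<Omega> \<inter> ball 0 1) f Pf \<and>
    C_pt (k + l) \<alpha> (frontier \<Omega> \<inter> ball 0 1) g Pg \<and>
    bdry_C_pt l \<alpha> N \<Omega> P\<Omega> \<and> bdry_norm l \<alpha> N \<Omega> P\<Omega> = M \<and>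
    peval Pu 0 = 0 \<and> (\<forall>i\<in>{1..k}. deriv_norm0 i Pu = 0) \<and> (\<forall>i\<in>{1..k}. deriv_norm0 i Pg = 0)
    \<longrightarrow>
    (let S = Linf_norm (\<Omega> \<inter> ball 0 1) u + C_pt_norm (k + l - 2) \<alpha> (\<Omega> \<inter> ball 0 1) f Pf
               + C_pt_norm (k + l) \<alpha> (frontier \<Omega> \<inter> ball 0 1) g Pg
     in \<exists>P \<in> polys (k + l).
          C_pt (k + l) \<alpha> (\<Omega> \<inter> ball 0 1) u P \<and>
          (\<forall>x \<in> \<Omega> \<inter> ball 0 1.
             \<bar>u x - peval P x\<bar> \<le> C * norm x powr (real (k + l) + \<alpha>) * S) \<and>
          (\<Sum>i = k+1..k+l. deriv_norm0 i P) \<le> C * S \<and>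
          (\<forall>x. laplacian (peval P) x = peval Pf x) \<and>
          poly_truncate (k + l) (psubst N P P\<Omega>) = poly_truncate (k + l) (psubst N Pg P\<Omega>))"
proof -
  \<comment> \<open>Strictly above the norm, as \<open>bdry_bound_of_norm\<close> requires, and at
    least 1 so that its powers increase.\<close>
  define M' where "M' = \<bar>M\<bar> + 1"
  have M': "1 \<le> M'" "M < M'" by (auto simp: M'_def)
  \<comment> \<open>Flatness 2 M': one M' for P_\<Omega>, which starts in degree 2, and one for the
    deviation of the boundary from its graph.\<close>
  obtain C0 where C0: "C0 > 0" "\<And>(N :: 'n) \<Omega> f u Pf Pg Pb S. dirichlet_data k l \<alpha> (2 * M') M' N \<Omega> f u Pf Pg Pb S \<Longrightarrow>
    \<exists>P. expansion k (k + l) \<alpha> N \<Omega> u Pf Pg Pb (C0 * S) P"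
    using boundary_expansion[where 'n = 'n, OF assms(3,4) _ M'(1) assms(1,2), of "2 * M'" "k + l"] M' by auto
  define F where "F = (\<Sum>\<sigma>\<in>monomials_upto (k + l). mfact (\<sigma> :: 'n \<Rightarrow>\<^sub>0 nat))"
  have F: "0 \<le> F" unfolding F_def by (intro sum_nonneg order_trans[OF zero_le_one mfact_ge_1])
  \<comment> \<open>The second summand pays for the l derivative norms, each at most
    \<open>poly_norm\<close>; F converts from \<open>cnorm\<close>.\<close>
  define C where "C = C0 + real l * (F * C0)"
  have C: "0 < C" "C0 \<le> C" "real l * (F * C0) \<le> C" using C0(1) F by (auto simp: C_def add_pos_nonneg)
  show ?thesis
  proof (intro exI[of _ C] conjI allI impI C(1))
    fix N :: 'n and \<Omega> :: "(real ^ 'n) set" and u f g :: "real ^ 'n \<Rightarrow> real" and Pu Pf Pg P\<Omega> :: "'n mpoly"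
    let ?D = "\<Omega> \<inter> ball 0 1" and ?G = "frontier \<Omega> \<inter> ball 0 1"
    assume asm: "open \<Omega> \<and> connected \<Omega> \<and> bounded \<Omega> \<and> 0 \<in> frontier \<Omega> \<and>
      viscosity_solution ?D ?G f g u \<and> C_pt k \<alpha> ?D u Pu \<and> C_pt (k + l - 2) \<alpha> ?D f Pf \<and> C_pt (k + l) \<alpha> ?G g Pg \<and>
      bdry_C_pt l \<alpha> N \<Omega> P\<Omega> \<and> bdry_norm l \<alpha> N \<Omega> P\<Omega> = M \<and>
      peval Pu 0 = 0 \<and> (\<forall>i\<in>{1..k}. deriv_norm0 i Pu = 0) \<and> (\<forall>i\<in>{1..k}. deriv_norm0 i Pg = 0)"
    then have op: "open \<Omega>" and fr0: "0 \<in> frontier \<Omega>" and vs: "viscosity_solution ?D ?G f g u"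
      and Cu: "C_pt k \<alpha> ?D u Pu" and Cf: "C_pt (k + l - 2) \<alpha> ?D f Pf" and Cg: "C_pt (k + l) \<alpha> ?G g Pg"
      and bd: "bdry_C_pt l \<alpha> N \<Omega> P\<Omega>" and bn: "bdry_norm l \<alpha> N \<Omega> P\<Omega> = M" and Pu0: "peval Pu 0 = 0"
      and dPu: "\<And>i. i \<in> {1..k} \<Longrightarrow> deriv_norm0 i Pu = 0" and dPg: "\<And>i. i \<in> {1..k} \<Longrightarrow> deriv_norm0 i Pg = 0" by blast+
    define su where "su = Linf_norm ?D u"
    define S where "S = su + C_pt_norm (k + l - 2) \<alpha> ?D f Pf + C_pt_norm (k + l) \<alpha> ?G g Pg"

    \<comment> \<open>Vanishing of u and g at the origin\<close>
    have clos: "closure \<Omega> = \<Omega> \<union> frontier \<Omega>" by (simp add: closure_Un_frontier)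
    have cont: "continuous_on (closure \<Omega> \<inter> ball 0 1) u"
      using vs unfolding clos by (simp add: viscosity_solution_def Int_Un_distrib2)
    have ug: "u x = g x" if "x \<in> frontier \<Omega>" "norm x < 1" for x
      using vs that by (simp add: viscosity_solution_def)
    have vp: "viscosity_problem \<Omega> f u (real CARD('n))"
      using vs op cont by (simp add: viscosity_problem_def viscosity_solution_def)
    have zero_notin: "0 \<notin> \<Omega>" using fr0 op by (auto simp: frontier_def interior_open)
    have zero_clos: "0 \<in> closure \<Omega>" using fr0 by (simp add: frontier_def)

    have "Pu = 0"
    proof (rule poly_mapping_eqI)
      fix \<sigma> :: "'n \<Rightarrow>\<^sub>0 nat"
      have "mdeg \<sigma> = 0 \<or> mdeg \<sigma> \<in> {1..k} \<or> k < mdeg \<sigma>" by auto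
      then show "lookup Pu \<sigma> = lookup 0 \<sigma>"
        using Pu0 deriv_norm0_eq_0[OF dPu] Cu by (auto simp: lookup_0_eq_peval mdeg_eq_0 C_pt_def polys_iff)
    qed
    then obtain Ku where Ku: "Ku > 0" "\<And>x. x \<in> \<Omega> \<Longrightarrow> norm x < 1 \<Longrightarrow> \<bar>u x\<bar> \<le> Ku * norm x powr (real k + \<alpha>)"
      using Cu by (auto simp: C_pt_def C_pt_bound_def)
    have u_le: "\<bar>u x\<bar> \<le> Ku" if "x \<in> ?D" for x
    proof -
      have "norm x powr (real k + \<alpha>) \<le> 1" using that assms by (intro powr_le1) auto
      then have "Ku * norm x powr (real k + \<alpha>) \<le> Ku * 1" using Ku(1) by (intro mult_left_mono) auto
      then show ?thesis using Ku(2)[of x] that by simp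
    qed
    \<comment> \<open>g(0) is not among the data assumed to vanish; it is 0 by continuity of u up to
      the boundary point 0.\<close>
    have "\<bar>u 0\<bar> - Ku * norm (0 :: real ^ 'n) powr (real k + \<alpha>) \<le> 0"
    proof (rule bound_extends_to_closure[of \<Omega> "ball 0 1" "\<lambda>x. \<bar>u x\<bar> - Ku * norm x powr (real k + \<alpha>)"])
      show "continuous_on (closure \<Omega> \<inter> ball 0 1) (\<lambda>x. \<bar>u x\<bar> - Ku * norm x powr (real k + \<alpha>))"
        using assms by (intro continuous_intros cont continuous_on_powr') auto
    qed (use zero_clos Ku in auto)
    then have "g 0 = 0" using ug[of 0] fr0 by simp
    have su: "\<bar>u x\<bar> \<le> su" if "x \<in> \<Omega>" "norm x < 1" for x
      unfolding su_def
    proof (rule Linf_norm_bound)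
      show "continuous_on ?D u" using cont closure_subset by (intro continuous_on_subset[OF cont]) auto
    qed (use op u_le that in auto)
    have "?D \<noteq> {}"
      using zero_clos open_Int_closure_eq_empty[of "ball 0 1" \<Omega>] by (auto simp: Int_commute)
    then have su0: "0 \<le> su" using su by (force intro: order_trans[OF abs_ge_zero])

    \<comment> \<open>Bounds of the data by S, and the order of P_g\<close>
    have nf: "cnorm Pf + C_pt_seminorm (k + l - 2) \<alpha> ?D f Pf \<le> C_pt_norm (k + l - 2) \<alpha> ?D f Pf"
      and ng: "cnorm Pg + C_pt_seminorm (k + l) \<alpha> ?G g Pg \<le> C_pt_norm (k + l) \<alpha> ?G g Pg"
      by (simp_all add: C_pt_norm_def cnorm_le_poly_norm)
    note nonneg = C_pt_seminorm_nonneg[OF Cf] C_pt_seminorm_nonneg[OF Cg] cnorm_nonneg[of Pf] cnorm_nonneg[of Pg] su0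
    have S: "0 \<le> S" "su \<le> S" "cnorm Pf \<le> S" "cnorm Pg \<le> S"
      "C_pt_seminorm (k + l - 2) \<alpha> ?D f Pf \<le> S" "C_pt_seminorm (k + l) \<alpha> ?G g Pg \<le> S"
      using nf ng nonneg by (simp_all add: S_def)
    have fP: "\<bar>f x - peval Pf x\<bar> \<le> S * norm x powr (real (k + l - 2) + \<alpha>)" if "x \<in> \<Omega>" "norm x < 1" for x
    proof -
      have "\<bar>f x - peval Pf x\<bar> \<le> C_pt_seminorm (k + l - 2) \<alpha> ?D f Pf * norm x powr (real (k + l - 2) + \<alpha>)"
        using C_pt_bound_seminorm[OF Cf] that by (auto simp: C_pt_bound_def)
      then show ?thesis using mult_right_mono[OF S(5), of "norm x powr (real (k + l - 2) + \<alpha>)"] by simp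
    qed
    have gP: "\<bar>u x - peval Pg x\<bar> \<le> S * norm x powr (real (k + l) + \<alpha>)" if "x \<in> frontier \<Omega>" "norm x < 1" for x
    proof -
      have "\<bar>g x - peval Pg x\<bar> \<le> C_pt_seminorm (k + l) \<alpha> ?G g Pg * norm x powr (real (k + l) + \<alpha>)"
        using C_pt_bound_seminorm[OF Cg] that by (auto simp: C_pt_bound_def)
      then show ?thesis using mult_right_mono[OF S(6), of "norm x powr (real (k + l) + \<alpha>)"] ug[OF that] by simp
    qed
    have Pg_low: "low_order (Suc k) Pg"
      unfolding low_order_def
    proof (intro allI impI, rule ccontr)
      fix \<sigma> assume \<sigma>: "lookup Pg \<sigma> \<noteq> 0" "\<not> Suc k \<le> mdeg \<sigma>"
      \<comment> \<open>At the origin the bound \<open>gP\<close> reads |u(0) - P_g(0)| \<le>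
        0.\<close>
      have "lookup Pg 0 = 0" using gP[OF fr0] ug[OF fr0] \<open>g 0 = 0\<close> by (simp add: lookup_0_eq_peval)
      moreover have "mdeg \<sigma> = 0 \<or> mdeg \<sigma> \<in> {1..k}" using \<sigma>(2) by auto
      ultimately show False using \<sigma>(1) deriv_norm0_eq_0[OF dPg] by (auto simp: mdeg_eq_0)
    qed

    \<comment> \<open>The boundary as a perturbed graph\<close>
    have Pb: "bdry_bound l \<alpha> N \<Omega> P\<Omega> M'" "poly_norm P\<Omega> \<le> M'"
      using bdry_bound_of_norm[OF bd] bn M'(2) by auto
    have Pb_norm: "cnorm P\<Omega> \<le> M'" using cnorm_le_poly_norm[of P\<Omega>] Pb(2) by linarith
    have Pb_free: "free_of N P\<Omega>" using bd by (auto simp: bdry_C_pt_def free_of_def in_keys_iff)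
    have Pb_low: "low_order 2 P\<Omega>"
      unfolding low_order_def
    proof (intro allI impI, rule ccontr)
      fix \<sigma> assume \<sigma>: "lookup P\<Omega> \<sigma> \<noteq> 0" "\<not> 2 \<le> mdeg \<sigma>"
      then have "mdeg \<sigma> = 0 \<or> mdeg \<sigma> = 1" by auto
      then show False
        using \<sigma>(1) bd deriv_norm0_eq_0[of 1 P\<Omega> \<sigma>] by (auto simp: bdry_C_pt_def mdeg_eq_0 lookup_0_eq_peval)
    qed
    have tang: "peval P\<Omega> (tangential N x) = peval P\<Omega> x" for x
      by (rule peval_free_of[OF Pb_free]) (simp add: tangential_def)
    define w where "w x = M' * norm (tangential N x) powr (real l + \<alpha>)" for x
    have w: "0 \<le> w x" "w x \<le> M' * norm x powr (real l + \<alpha>)" for x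
      using M' assms norm_tangential_le[of N x] by (auto simp: w_def intro!: mult_left_mono powr_mono2)
    have above: "x \<in> \<Omega>" if "peval P\<Omega> x + w x < x $ N" "norm x < 1" for x
      using Pb(1) that by (auto simp: bdry_bound_def w_def tang)
    have below: "peval P\<Omega> x - w x \<le> x $ N" if "x \<in> \<Omega>" "norm x < 1" for x
      using Pb(1) that by (fastforce simp: bdry_bound_def w_def tang)
    have small: "\<bar>peval P\<Omega> x\<bar> + w x \<le> 2 * M' * norm x powr (1 + \<alpha>)" if "norm x < 1" for x
    proof -
      have "\<bar>peval P\<Omega> x\<bar> \<le> cnorm P\<Omega> * norm x ^ 2" using that by (intro peval_le_cnorm[OF Pb_low]) auto
      also have "\<dots> \<le> M' * norm x powr (1 + \<alpha>)"
        using that assms M' by (intro mult_mono[OF Pb_norm] power_le_powr) auto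
      finally have "\<bar>peval P\<Omega> x\<bar> \<le> M' * norm x powr (1 + \<alpha>)" .
      moreover have "w x \<le> M' * norm x powr (1 + \<alpha>)"
        by (rule order_trans[OF w(2) mult_left_mono[OF powr_mono']]) (use that assms M' in auto)
      ultimately show ?thesis by simp
    qed
    have flat: "flat_boundary (2 * M') \<alpha> N \<Omega>"
      unfolding flat_boundary_def
    proof (intro conjI zero_notin allI impI)
      fix x :: "real ^ 'n" assume x: "norm x < 1"
      show "- (2 * M' * norm x powr (1 + \<alpha>)) \<le> x $ N" if "x \<in> \<Omega>" using below[OF that x] small[OF x] by linarith
      show "x \<in> \<Omega>" if "2 * M' * norm x powr (1 + \<alpha>) < x $ N" using small[OF x] that x by (intro above) auto
    qed
    have graph: "\<bar>x $ N - peval P\<Omega> x\<bar> \<le> 2 * M' * norm x powr (real l + \<alpha>)" if x: "x \<in> frontier \<Omega>" "norm x < 1" for x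
    proof -
      have xn: "x \<notin> \<Omega>" "x \<in> closure \<Omega>" using x op by (auto simp: frontier_def interior_open)
      have "x $ N \<le> peval P\<Omega> x + w x" using above[of x] xn x(2) by force
      moreover have "peval P\<Omega> x - w x - x $ N \<le> 0"
      proof (rule bound_extends_to_closure[of \<Omega> "ball 0 1" "\<lambda>x. peval P\<Omega> x - w x - x $ N"])
        have "continuous_on A (\<lambda>x. tangential N x)" for A :: "(real ^ 'n) set"
        proof -
          have "continuous_on A (\<lambda>x. if i = N then 0 else x $ i)" for i by (cases "i = N") (auto intro!: continuous_intros)
          then show ?thesis unfolding tangential_def by (rule continuous_on_vec_lambda)
        qed
        then show "continuous_on (closure \<Omega> \<inter> ball 0 1) (\<lambda>x. peval P\<Omega> x - w x - x $ N)"
          unfolding w_def using assms by (intro continuous_intros continuous_on_powr') auto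
      qed (use below xn x in auto)
      moreover have "0 \<le> M' * norm x powr (real l + \<alpha>)" using M' by simp
      ultimately show ?thesis using w(2)[of x] by linarith
    qed

    \<comment> \<open>The expansion polynomial\<close>
    have "\<exists>P \<in> polys (k + l). (\<forall>x\<in>?D. \<bar>u x - peval P x\<bar> \<le> C * norm x powr (real (k + l) + \<alpha>) * S) \<and>
      (\<Sum>i = k+1..k+l. deriv_norm0 i P) \<le> C * S \<and> lap P = Pf \<and>
      poly_truncate (k + l) (psubst N P P\<Omega>) = poly_truncate (k + l) (psubst N Pg P\<Omega>)"
    proof (cases "S = 0")
      case True
      \<comment> \<open>\<open>dirichlet_data\<close> asks for a positive S; if S = 0, then u, P_f
        and P_g vanish and P = 0 will do.\<close>
      have "Pf = 0" "Pg = 0" using S(3,4) True by (auto intro: cnorm_eq_0)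
      moreover have "u x = 0" if "x \<in> ?D" for x using su[of x] S(2) True that by auto
      ultimately show ?thesis
        using True by (intro bexI[of _ 0]) (auto simp: polys_def deriv_norm0_def)
    next
      case False
      then have Spos: "0 < S" using S(1) by simp
      have "dirichlet_data k l \<alpha> (2 * M') M' N \<Omega> f u Pf Pg P\<Omega> S"
        unfolding dirichlet_data_def
      proof (intro conjI ballI impI)
        show "\<bar>u x\<bar> \<le> S" if "x \<in> \<Omega>" "norm x < 1" for x using su[OF that] S(2) by linarith
        show "\<exists>B. \<forall>x\<in>\<Omega>. norm x < 1 \<longrightarrow> \<bar>u x\<bar> \<le> B * norm x powr (real k + \<alpha>)" using Ku(2) by blast
        show "Pg \<in> polys (k + l)" using Cg by (simp add: C_pt_def)
      qed (use vp flat Spos gP fP S Pg_low Pb_low Pb_free Pb_norm graph in blast)+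
      then obtain P where "expansion k (k + l) \<alpha> N \<Omega> u Pf Pg P\<Omega> (C0 * S) P" using C0(2) by blast
      then have P: "P \<in> polys (k + l)" "lap P = trunc_lt (k + l - 1) Pf"
        "low_order (Suc (k + l)) (psubst N (P - Pg) P\<Omega>)" "cnorm P \<le> C0 * S"
        "\<And>x. x \<in> \<Omega> \<Longrightarrow> norm x < 1 \<Longrightarrow> \<bar>u x - peval P x\<bar> \<le> C0 * S * norm x powr (real (k + l) + \<alpha>)"
        unfolding expansion_def by blast+
      \<comment> \<open>P_f has degree at most k + l - 2, so at order k + l nothing of it is cut
        off.\<close>
      have "trunc_lt (k + l - 1) Pf = Pf"
      proof (rule poly_mapping_eqI)
        fix \<sigma>
        have "mdeg \<sigma> \<le> k + l - 2" if "lookup Pf \<sigma> \<noteq> 0" using Cf that by (auto simp: C_pt_def polys_iff)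
        then show "lookup (trunc_lt (k + l - 1) Pf) \<sigma> = lookup Pf \<sigma>"
          using assms(1,2) by (cases "lookup Pf \<sigma> = 0") (auto simp: lookup_pfilter)
      qed
      then have "lap P = Pf" using P(2) by simp
      moreover have "poly_truncate (k + l) (psubst N P P\<Omega>) = poly_truncate (k + l) (psubst N Pg P\<Omega>)"
      proof (rule poly_mapping_eqI)
        fix \<sigma>
        have "lookup (psubst N P P\<Omega>) \<sigma> = lookup (psubst N Pg P\<Omega>) \<sigma>" if "mdeg \<sigma> \<le> k + l"
          using P(3) that by (auto simp: psubst_diff low_order_def lookup_minus)
        then show "lookup (poly_truncate (k + l) (psubst N P P\<Omega>)) \<sigma> = lookup (poly_truncate (k + l) (psubst N Pg P\<Omega>)) \<sigma>"
          by (simp add: lookup_poly_truncate)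
      qed
      moreover have "\<bar>u x - peval P x\<bar> \<le> C * norm x powr (real (k + l) + \<alpha>) * S" if "x \<in> ?D" for x
      proof -
        have "C0 * (S * norm x powr (real (k + l) + \<alpha>)) \<le> C * (S * norm x powr (real (k + l) + \<alpha>))"
          using C(2) Spos by (intro mult_right_mono) auto
        then show ?thesis using P(5)[of x] that by (simp add: mult_ac)
      qed
      moreover have "(\<Sum>i = k+1..k+l. deriv_norm0 i P) \<le> C * S"
      proof -
        have "poly_norm P \<le> F * (C0 * S)"
          using poly_norm_le_cnorm[OF P(1)] mult_left_mono[OF P(4) F] by (simp add: F_def)
        then have "(\<Sum>i = k+1..k+l. deriv_norm0 i P) \<le> (\<Sum>i = k+1..k+l. F * (C0 * S))"
          by (intro sum_mono order_trans[OF deriv_norm0_le])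
        also have "\<dots> = real l * (F * C0) * S" by simp
        also have "\<dots> \<le> C * S" using C(3) Spos by (intro mult_right_mono) auto
        finally show ?thesis .
      qed
      ultimately show ?thesis using P(1) by blast
    qed
    then obtain P where P: "P \<in> polys (k + l)" "\<And>x. x \<in> ?D \<Longrightarrow> \<bar>u x - peval P x\<bar> \<le> C * norm x powr (real (k + l) + \<alpha>) * S"
      "(\<Sum>i = k+1..k+l. deriv_norm0 i P) \<le> C * S" "lap P = Pf"
      "poly_truncate (k + l) (psubst N P P\<Omega>) = poly_truncate (k + l) (psubst N Pg P\<Omega>)" by blast
    \<comment> \<open>\<open>C_pt\<close> wants a positive constant and S may be 0, whence the added
      1.\<close>
    have "C_pt (k + l) \<alpha> ?D u P"
      unfolding C_pt_def C_pt_bound_def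
    proof (intro conjI P(1) exI[of _ "C * S + 1"] ballI)
      show "0 < C * S + 1" using C S by (simp add: add_nonneg_pos)
      fix x assume "x \<in> ?D \<inter> ball 0 1"
      then have "\<bar>u x - peval P x\<bar> \<le> (C * S) * norm x powr (real (k + l) + \<alpha>)" using P(2)[of x] by (simp add: mult_ac)
      also have "\<dots> \<le> (C * S + 1) * norm x powr (real (k + l) + \<alpha>)" by (intro mult_right_mono) auto
      finally show "\<bar>u x - peval P x\<bar> \<le> (C * S + 1) * norm x powr (real (k + l) + \<alpha>)" .
    qed
    then show "let S = Linf_norm ?D u + C_pt_norm (k + l - 2) \<alpha> ?D f Pf + C_pt_norm (k + l) \<alpha> ?G g Pg
      in \<exists>P \<in> polys (k + l). C_pt (k + l) \<alpha> ?D u P \<and>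
          (\<forall>x \<in> ?D. \<bar>u x - peval P x\<bar> \<le> C * norm x powr (real (k + l) + \<alpha>) * S) \<and>
          (\<Sum>i = k+1..k+l. deriv_norm0 i P) \<le> C * S \<and>
          (\<forall>x. laplacian (peval P) x = peval Pf x) \<and>
          poly_truncate (k + l) (psubst N P P\<Omega>) = poly_truncate (k + l) (psubst N Pg P\<Omega>)"
      unfolding Let_def su_def[symmetric] S_def[symmetric]
      using P by (intro bexI[of _ P]) (auto simp: laplacian_peval)
  qed
qed

end
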